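(* Let $0<c_3<c_4<1$ be constants depending only on $b,d$, let $c_1=\frac{c_3}{4\tilde b}$, $c_2=c_1^2/2$, and for $N_1$ put $N_2=N_1^{2/c_1}$, $N_3=e^{N_2^{c_2}}$. Let $\lambda>1$, $\bar\rho\in[\rho/2,4\rho/5]$, and assume $N_1$ is sufficiently large (depending on $b,d,\rho,S,v$). Suppose the Green's functions satisfy property $P$ with parameters $(c_1,\bar\rho)$ at sizes $N_1$ and $N_2$, with semi-algebraic sets $\Omega_{N_1},\Omega_{N_2}$, and let $\omega\in\Omega_{N_1}\cap\Omega_{N_2}$, $E$ in the fixed bounded energy interval, and $X_{N_1}=X_{N_1}(\omega,E)$. Fix $1\le j\le d$ and $x=(x^1,\dots,x^d)\in\mathbb{T}^b$. Assume there exist $N\in[\frac14N_3^{c_3},N_3^{c_4}]$, $\Lambda\in\mathcal{E}_N$ and $\bar\Lambda\subset\Lambda$ with $\mathrm{diam}(\bar\Lambda)\leq10N^{1/(10d)}$ such that for every $k\in\Lambda\setminus\bar\Lambda$ there is $W\in\mathcal{E}_{N_1}$ with $k\in W\subset\Lambda\setminus\bar\Lambda$, $\mathrm{dist}(k,(\Lambda\setminus\bar\Lambda)\setminus W)\geq N_1/2$, and $x+k\omega\bmod\mathbb{Z}^b\notin X_{N_1}$. Let $$Y=\{y\in\mathbb{R}^{b_j}:\ |y-x^j|\leq e^{-\rho N_1},\ \|G_\Lambda(E;(x^1,\dots,x^{j-1},y,x^{j+1},\dots,x^d))\|\geq e^{\sqrt N}\}.$$ Then $\mathrm{mes}(Y)\leq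 e^{-N^{1/(3b_j)}}$.
   Context: Setting: integers $d\geq1$, $b_1,\dots,b_d\geq1$, $b=\sum b_i$, $\tilde b=\max_ib_i$; $|n|=\max_i|n_i|$ on $\mathbb{Z}^d$ and $|y|=\max_i|y_i|$ on $\mathbb{R}^{b_j}$; $\mathrm{diam}$, $\mathrm{dist}$ are with respect to this norm. $S$ is a self-adjoint Toeplitz matrix on $\ell^2(\mathbb{Z}^d)$ with $|S(n,n')|\leq e^{-\rho|n-n'|}$, $\rho>0$; $v$ real analytic on $\mathbb{T}^b$; $H(x)=S+\lambda v(x+n\omega)\delta_{nn'}$, $x=(x^1,\dots,x^d)$, $x^j\in\mathbb{T}^{b_j}$, $n\omega=(n_1\omega^1,\dots,n_d\omega^d)$. Energies $E$ range over a fixed bounded interval. For finite $\Lambda$, $G_\Lambda(E;x)=(R_\Lambda(\lambda^{-1}H(x)-E)R_\Lambda)^{-1}$ on $\ell^2(\Lambda)$ ($R_\Lambda$ coordinate restriction), entries $G_\Lambda(E;x)(n,n')$, $\|\cdot\|$ the $\ell^2$ operator norm ($=\infty$ if not invertible). Elementary regions of size $N$ centered at $0$: $Q_N=[-N,N]^d$, or $[-N,N]^d\setminus\{n:n_i\varsigma_i0\ \forall i\}$ with each $\varsigma_i\in\{<,>,\emptyset\}$ ($\emptyset$ = no condition), at least two not $\emptyset$; $\mathcal{E}_N^0$ is the set of these, $\mathcal{E}_N$ the set of all their translates by $\mathbb{Z}^d$. For $x\in\mathbb{T}^b$, $x_j^\neg=(x^1,\dots,x^{j-1},x^{j+1},\dots,x^d)$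 and for $X\subset\mathbb{T}^b$, $X(x_j^\neg)=\{\theta\in\mathbb{T}^{b_j}:(x^1,\dots,\theta,\dots,x^d)\in X\}$ ($\theta$ in block $j$). $(E,x)$ is $(\bar\rho,N)$ good if for every $Q_N\in\mathcal{E}_N^0$: $\|G_{Q_N}(E;x)\|\leq e^{\sqrt N}$ and $|G_{Q_N}(E;x)(n,n')|\leq e^{-\bar\rho|n-n'|}$ for $|n-n'|\geq N/10$. Property $P$ with parameters $(\gamma,\bar\rho)$ at size $N$: there is a semi-algebraic $\Omega_N\subset\mathbb{T}^b$ with $\deg(\Omega_N)\leq N^{4d}$ such that for any $\omega\in\Omega_N$, $E\in\mathbb{R}$ there is $X_N=X_N(\omega,E)\subset\mathbb{T}^b$ with $\sup_{j,x_j^\neg}\mathrm{mes}(X_N(x_j^\neg))\leq e^{-N^\gamma}$ and $(E,x)$ is $(\bar\rho,N)$ good for every $x\notin X_N$. (Semi-algebraic set of degree $\le D$: finite union of sets defined by polynomial equalities/inequalities, with (number of polynomials)$\times$(max degree)$\le D$.) *)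

theory Defs
  imports "HOL-Analysis.Analysis"
begin

text \<open>Coordinates of the torus T^b are indexed by a finite type 'i; the blocks
 (1..d) by a finite type 'd; blk i is the block of coordinate i.  Lattice points
 n in Z^d are functions 'd => int.  Points of T^b are represented by real vectors
 'i => real (lifts); functions on T^b are 1-periodic functions.\<close>

definition normZ :: "('d::finite \<Rightarrow> int) \<Rightarrow> real" where
  "normZ m = Max (range (\<lambda>i. real_of_int \<bar>m i\<bar>))"

definition diamZ :: "('d::finite \<Rightarrow> int) set \<Rightarrow> real" where
  "diamZ A = (if A = {} then 0 else Max {normZ (\<lambda>i. n i - m i) | n m. n \<in> A \<and> m \<in> A})"

definition distZ :: "('d::finite \<Rightarrow> int) \<Rightarrow> ('d \<Rightarrow> int) set \<Rightarrow> ereal" where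
  "distZ k A = Inf ((\<lambda>m. ereal (normZ (\<lambda>i. k i - m i))) ` A)"

datatype cutrel = CLt | CGt | CAny

fun cut_holds :: "cutrel \<Rightarrow> int \<Rightarrow> bool" where
  "cut_holds CLt a = (a < 0)"
| "cut_holds CGt a = (a > 0)"
| "cut_holds CAny a = True"

definition cubeZ :: "real \<Rightarrow> ('d::finite \<Rightarrow> int) set" where
  "cubeZ N = {n. \<forall>i. \<bar>real_of_int (n i)\<bar> \<le> N}"

definition elem0 :: "real \<Rightarrow> ('d::finite \<Rightarrow> int) set set" where
  "elem0 N = {cubeZ N} \<union>
     {cubeZ N - {n. \<forall>i. cut_holds (\<sigma> i) (n i)} | \<sigma>::'d \<Rightarrow> cutrel. 2 \<le> card {i. \<sigma> i \<noteq> CAny}}"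

definition elem :: "real \<Rightarrow> ('d::finite \<Rightarrow> int) set set" where
  "elem N = {(\<lambda>n. (\<lambda>i. n i + k i)) ` Q | Q k. Q \<in> elem0 N}"

definition torus :: "('i \<Rightarrow> real) set" where
  "torus = {x. \<forall>i. 0 \<le> x i \<and> x i < 1}"

definition tmod :: "('i \<Rightarrow> real) \<Rightarrow> ('i \<Rightarrow> real)" where
  "tmod x = (\<lambda>i. frac (x i))"

definition periodic1 :: "(('i \<Rightarrow> real) \<Rightarrow> real) \<Rightarrow> bool" where
  "periodic1 f \<longleftrightarrow> (\<forall>x (m::'i \<Rightarrow> int). f (\<lambda>i. x i + real_of_int (m i)) = f x)"

definition real_analytic :: "(('i::finite \<Rightarrow> real) \<Rightarrow> real) \<Rightarrow> bool" where
  "real_analytic f \<longleftrightarrow> (\<forall>a. \<exists>r>0. \<exists>c :: ('i \<Rightarrow> nat) \<Rightarrow> real. \<forall>y. (\<forall>i. \<bar>y i - a i\<bar> < r) \<longrightarrow>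
      ((\<lambda>\<alpha>. c \<alpha> * (\<Prod>i\<in>UNIV. (y i - a i) ^ \<alpha> i)) has_sum f y) UNIV)"

definition shift :: "('i \<Rightarrow> 'd) \<Rightarrow> ('i \<Rightarrow> real) \<Rightarrow> ('d \<Rightarrow> int) \<Rightarrow> ('i \<Rightarrow> real) \<Rightarrow> ('i \<Rightarrow> real)" where
  "shift blk \<omega> n x = (\<lambda>i. x i + real_of_int (n (blk i)) * \<omega> i)"

text \<open>Matrix entries of lambda^{-1} H(x) - E (S has entries S(n,n') = s(n-n')).\<close>
definition hmat :: "('i \<Rightarrow> 'd) \<Rightarrow> (('d \<Rightarrow> int) \<Rightarrow> complex) \<Rightarrow> (('i \<Rightarrow> real) \<Rightarrow> real) \<Rightarrow> real
    \<Rightarrow> ('i \<Rightarrow> real) \<Rightarrow> real \<Rightarrow> ('i \<Rightarrow> real) \<Rightarrow> ('d \<Rightarrow> int) \<Rightarrow> ('d \<Rightarrow> int) \<Rightarrow> complex" where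
  "hmat blk s v lam \<omega> E x n n' =
     s (\<lambda>i. n i - n' i) / complex_of_real lam
     + (if n = n' then complex_of_real (v (shift blk \<omega> n x) - E) else 0)"

definition is_inverse_on :: "('a set) \<Rightarrow> ('a \<Rightarrow> 'a \<Rightarrow> complex) \<Rightarrow> ('a \<Rightarrow> 'a \<Rightarrow> complex) \<Rightarrow> bool" where
  "is_inverse_on L A B \<longleftrightarrow>
     (\<forall>n\<in>L. \<forall>n'\<in>L. (\<Sum>k\<in>L. A n k * B k n') = (if n = n' then 1 else 0)) \<and>
     (\<forall>n\<in>L. \<forall>n'\<in>L. (\<Sum>k\<in>L. B n k * A k n') = (if n = n' then 1 else 0))"

definition invertible_on :: "('a set) \<Rightarrow> ('a \<Rightarrow> 'a \<Rightarrow> complex) \<Rightarrow> bool" where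
  "invertible_on L A \<longleftrightarrow> (\<exists>B. is_inverse_on L A B)"

definition inv_on :: "('a set) \<Rightarrow> ('a \<Rightarrow> 'a \<Rightarrow> complex) \<Rightarrow> ('a \<Rightarrow> 'a \<Rightarrow> complex)" where
  "inv_on L A = (let B = (SOME B. is_inverse_on L A B) in
                   (\<lambda>n n'. if n \<in> L \<and> n' \<in> L then B n n' else 0))"

definition opnorm_on :: "('a set) \<Rightarrow> ('a \<Rightarrow> 'a \<Rightarrow> complex) \<Rightarrow> real" where
  "opnorm_on L B = Sup {sqrt (\<Sum>n\<in>L. (cmod (\<Sum>k\<in>L. B n k * u k))\<^sup>2) | u. (\<Sum>k\<in>L. (cmod (u k))\<^sup>2) \<le> 1}"

definition greens where
  "greens blk s v lam \<omega> E x L = inv_on L (hmat blk s v lam \<omega> E x)"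

definition gnorm :: "('i \<Rightarrow> 'd) \<Rightarrow> (('d \<Rightarrow> int) \<Rightarrow> complex) \<Rightarrow> (('i \<Rightarrow> real) \<Rightarrow> real) \<Rightarrow> real
    \<Rightarrow> ('i \<Rightarrow> real) \<Rightarrow> real \<Rightarrow> ('i \<Rightarrow> real) \<Rightarrow> ('d \<Rightarrow> int) set \<Rightarrow> ereal" where
  "gnorm blk s v lam \<omega> E x L =
     (if invertible_on L (hmat blk s v lam \<omega> E x)
      then ereal (opnorm_on L (greens blk s v lam \<omega> E x L)) else \<infinity>)"

definition good :: "('i \<Rightarrow> 'd::finite) \<Rightarrow> (('d \<Rightarrow> int) \<Rightarrow> complex) \<Rightarrow> (('i \<Rightarrow> real) \<Rightarrow> real) \<Rightarrow> real
    \<Rightarrow> ('i \<Rightarrow> real) \<Rightarrow> real \<Rightarrow> real \<Rightarrow> real \<Rightarrow> ('i \<Rightarrow> real) \<Rightarrow> bool" where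
  "good blk s v lam \<omega> rb N E x \<longleftrightarrow>
     (\<forall>Q\<in>elem0 N. gnorm blk s v lam \<omega> E x Q \<le> ereal (exp (sqrt N)) \<and>
        (\<forall>n\<in>Q. \<forall>n'\<in>Q. normZ (\<lambda>i. n i - n' i) \<ge> N / 10 \<longrightarrow>
            cmod (greens blk s v lam \<omega> E x Q n n') \<le> exp (- rb * normZ (\<lambda>i. n i - n' i))))"

definition blockM :: "('i \<Rightarrow> 'd) \<Rightarrow> 'd \<Rightarrow> ('i \<Rightarrow> real) measure" where
  "blockM blk j = PiM {i. blk i = j} (\<lambda>_. lborel)"

text \<open>mes(A) \<le> r, read as outer measure (A need not be known measurable).\<close>
definition mes_le :: "'a measure \<Rightarrow> 'a set \<Rightarrow> real \<Rightarrow> bool" where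
  "mes_le M A r \<longleftrightarrow> (\<exists>Z\<in>sets M. A \<subseteq> Z \<and> emeasure M Z \<le> ennreal r)"

definition xsection :: "('i \<Rightarrow> 'd) \<Rightarrow> ('i \<Rightarrow> real) set \<Rightarrow> 'd \<Rightarrow> ('i \<Rightarrow> real) \<Rightarrow> ('i \<Rightarrow> real) set" where
  "xsection blk X j x = {\<theta> \<in> {i. blk i = j} \<rightarrow>\<^sub>E UNIV. (\<lambda>i. if blk i = j then \<theta> i else x i) \<in> X}"

definition mpoly_ok :: "(('i \<Rightarrow> nat) \<Rightarrow> real) \<Rightarrow> bool" where
  "mpoly_ok c \<longleftrightarrow> finite {\<alpha>. c \<alpha> \<noteq> 0}"

definition mpoly_eval :: "(('i::finite \<Rightarrow> nat) \<Rightarrow> real) \<Rightarrow> ('i \<Rightarrow> real) \<Rightarrow> real" where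
  "mpoly_eval c x = (\<Sum>\<alpha>\<in>{\<alpha>. c \<alpha> \<noteq> 0}. c \<alpha> * (\<Prod>i\<in>UNIV. x i ^ \<alpha> i))"

definition mpoly_deg :: "(('i::finite \<Rightarrow> nat) \<Rightarrow> real) \<Rightarrow> nat" where
  "mpoly_deg c = Max (insert 0 {(\<Sum>i\<in>UNIV. \<alpha> i) | \<alpha>. c \<alpha> \<noteq> 0})"

datatype prel = PEq | PLt | PGt | PLe | PGe

fun prel_holds :: "prel \<Rightarrow> real \<Rightarrow> bool" where
  "prel_holds PEq a = (a = 0)"
| "prel_holds PLt a = (a < 0)"
| "prel_holds PGt a = (a > 0)"
| "prel_holds PLe a = (a \<le> 0)"
| "prel_holds PGe a = (a \<ge> 0)"

definition semialg_deg_le :: "('i::finite \<Rightarrow> real) set \<Rightarrow> real \<Rightarrow> bool" where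
  "semialg_deg_le S D \<longleftrightarrow> (\<exists>(ps :: (('i \<Rightarrow> nat) \<Rightarrow> real) list) (\<Sigma> :: (nat \<Rightarrow> prel) set).
      finite \<Sigma> \<and> (\<forall>p\<in>set ps. mpoly_ok p) \<and>
      S = (\<Union>\<sigma>\<in>\<Sigma>. {x. \<forall>l<length ps. prel_holds (\<sigma> l) (mpoly_eval (ps ! l) x)}) \<and>
      real (length ps) * real (Max (insert 0 (mpoly_deg ` set ps))) \<le> D)"

definition propP :: "('i::finite \<Rightarrow> 'd::finite) \<Rightarrow> (('d \<Rightarrow> int) \<Rightarrow> complex) \<Rightarrow> (('i \<Rightarrow> real) \<Rightarrow> real) \<Rightarrow> real
    \<Rightarrow> real \<Rightarrow> real \<Rightarrow> real \<Rightarrow> ('i \<Rightarrow> real) set \<Rightarrow> (('i \<Rightarrow> real) \<Rightarrow> real \<Rightarrow> ('i \<Rightarrow> real) set) \<Rightarrow> bool" where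
  "propP blk s v lam \<gamma> rb N \<Omega> X \<longleftrightarrow>
     \<Omega> \<subseteq> torus \<and> semialg_deg_le \<Omega> (N ^ (4 * CARD('d))) \<and>
     (\<forall>\<omega>\<in>\<Omega>. \<forall>E::real. X \<omega> E \<subseteq> torus \<and>
        (\<forall>j x. mes_le (blockM blk j) (xsection blk (X \<omega> E) j x) (exp (- (N powr \<gamma>)))) \<and>
        (\<forall>x\<in>torus - X \<omega> E. good blk s v lam \<omega> rb N E x))"

definition bsize :: "('i::finite \<Rightarrow> 'd) \<Rightarrow> 'd \<Rightarrow> nat" where
  "bsize blk j = card {i. blk i = j}"

definition btilde :: "('i::finite \<Rightarrow> 'd::finite) \<Rightarrow> nat" where
  "btilde blk = Max (range (bsize blk))"

end

theory Submission
  imports "Jordan_Normal_Form.Determinant" "HOL-Complex_Analysis.Complex_Analysis"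
    "HOL-Real_Asymp.Real_Asymp" Defs
begin

hide_const (open) Congruence.elem

text \<open>
  Write \<open>U = \<Lambda> - \<Lambda>b\<close>. The good windows of size \<open>N\<^sub>1\<close> and the resolvent identity bound the inverse of the
  restriction to \<open>U\<close> at \<open>x\<close>, and, by perturbation, at all complex points at distance
  \<open>O(exp (- \<rho> N\<^sub>1))\<close>. Hence the Schur complement of \<open>U\<close> is an analytic matrix of size
  \<open>card \<Lambda>b = O(N powr (1/10))\<close>, and its determinant \<open>f\<close> is bounded above. The exceptional set of size \<open>N\<^sub>2\<close> is so
  small that some point \<open>y\<^sub>0\<close> of the cube has only good windows of size \<open>N\<^sub>2\<close>; there the whole
  Green's function is bounded, so \<open>f\<close> is not small at \<open>y\<^sub>0\<close>. Cartan's estimate on every line through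
  \<open>y\<^sub>0\<close>, integrated over the directions, shows that \<open>f\<close> is small only on a set of tiny measure, and
  off that set the Green's function of \<open>\<Lambda>\<close> is bounded.

  All inverses are controlled through lower bounds in the sup norm; the polynomial losses in the
  volume of \<open>\<Lambda>\<close> are harmless because \<open>ln N\<close> is a small power of \<open>N\<^sub>1\<close>.
\<close>

section \<open>Cartan's estimate on a disc\<close>

text \<open>The determinant of the whole restriction to \<Lambda> would put roughly the volume of
  \<Lambda> into the exponent of Cartan's estimate, far above the permitted sqrt N. Eliminating
  \<open>U\<close> first leaves a matrix whose size is a small power of N, and this is what makes
  the threshold exp (sqrt N) reachable.

  The point \<open>y0\<close> cannot be found with the sets of size N_1: their sections have measure
  up to exp (- N_1^c_1), more than the volume of a cube of side comparable to exp (- \<rho> N_1). At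
  size N_2 = N_1^(2/c_1) the bound becomes exp (- N_1^2), which survives a union over all sites of
  \<Lambda> and is still below the volume of the cube.

  Everything is reduced to one complex variable by restricting to lines through \<open>y0\<close>.
  Since rays are averaged, instead of treating the coordinates of the block one after the other, the
  measure bound comes out as exp (- N^(1/3)) for every block size, and the exponent 1 / (3 b_j)
  follows from it.\<close>

lemma remove_zero:
  fixes f :: "complex \<Rightarrow> complex"
  assumes holf: "f holomorphic_on ball 0 R" and R: "R > 1"
    and bd: "\<And>z. z \<in> cball 0 1 \<Longrightarrow> cmod (f z) \<le> B"
    and a: "cmod a \<le> 1/2" "f a = 0" and f0: "f 0 \<noteq> 0"
  obtains g where "g holomorphic_on ball 0 R"
    "\<And>z. z \<in> cball 0 1 \<Longrightarrow> cmod (g z) \<le> B"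
    "cmod (g 0) \<ge> 2 * cmod (f 0)"
    "\<And>z. f z * (1 - cnj a * z) = g z * (z - a)"
proof -
  define h where "h = (\<lambda>z. if z = a then deriv f a else (f z - f a) / (z - a))"
  define g where "g = (\<lambda>z. h z * (1 - cnj a * z))"
  have a0: "a \<noteq> 0" using a f0 by auto
  have holh: "h holomorphic_on ball 0 R"
    unfolding h_def using pole_lemma_open[OF holf] by simp
  have holg: "g holomorphic_on ball 0 R"
    unfolding g_def by (intro holomorphic_intros holh)
  have eq: "f z * (1 - cnj a * z) = g z * (z - a)" for z
    using a by (auto simp: g_def h_def)
  \<comment> \<open>\<open>g\<close> is \<open>f\<close> divided by the Blaschke factor of
    \<open>a\<close>, which has modulus 1 on the unit circle. The bound \<open>B\<close> therefore
    survives there, and the maximum principle carries it inside.\<close>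
  have circ: "cmod (g z) \<le> B" if "cmod z = 1" for z
  proof -
    have "z * (cnj z - cnj a) = 1 - cnj a * z"
      using that complex_norm_square[of z] by (simp add: algebra_simps)
    hence "cmod (1 - cnj a * z) = cmod (z - a)"
      using that by (metis complex_cnj_diff complex_mod_cnj mult_1 norm_mult)
    moreover have "z \<noteq> a" using that a by auto
    ultimately have "cmod (g z) = cmod (f z)"
      using eq[of z] by (metis mult_right_cancel norm_eq_zero norm_mult right_minus_eq)
    thus ?thesis using bd[of z] that by simp
  qed
  have "cmod (g z) \<le> B" if "z \<in> cball 0 1" for z
  proof (rule maximum_modulus_frontier[of g "cball 0 1"])
    show "g holomorphic_on interior (cball 0 1)"
      using holg R by (auto intro: holomorphic_on_subset)
    show "continuous_on (closure (cball 0 1)) g"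
      using holomorphic_on_imp_continuous_on[OF holg] R
      by (auto intro!: continuous_on_subset[of "ball 0 R"])
    show "cmod (g z) \<le> B" if "z \<in> frontier (cball 0 1)" for z
      using that circ by auto
  qed (use that in auto)
  moreover have "cmod (g 0) \<ge> 2 * cmod (f 0)"
  proof -
    have "cmod (f 0) = cmod (g 0) * cmod a"
      using eq[of 0] by (simp add: norm_mult)
    also have "\<dots> \<le> cmod (g 0) * (1/2)" using a by (intro mult_left_mono) auto
    finally show ?thesis by simp
  qed
  ultimately show ?thesis using that holg eq by blast
qed

text \<open>Removing a zero from the half disc keeps the bound \<open>B\<close> and at least doubles
  the modulus at 0, which can never exceed \<open>B\<close>. So fewer than \<open>K\<close> removals
  are possible once \<open>B < 2 ^ K * cmod (f 0)\<close>, and the induction on \<open>K\<close>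
  stops. The same doubling bounds the number of zeros, as Jensen's formula would.\<close>

lemma blaschke_factorization:
  fixes f :: "complex \<Rightarrow> complex"
  assumes "f holomorphic_on ball 0 R" and R: "R > 1"
    and "\<And>z. z \<in> cball 0 1 \<Longrightarrow> cmod (f z) \<le> B"
    and "f 0 \<noteq> 0"
  shows "\<exists>as g. g holomorphic_on ball 0 R \<and> (\<forall>z\<in>cball 0 1. cmod (g z) \<le> B)
    \<and> cmod (g 0) \<ge> 2 ^ length as * cmod (f 0) \<and> (\<forall>a\<in>set as. cmod a \<le> 1/2)
    \<and> (\<forall>z\<in>cball 0 (1/2). g z \<noteq> 0)
    \<and> (\<forall>z. f z * (\<Prod>a\<leftarrow>as. 1 - cnj a * z) = g z * (\<Prod>a\<leftarrow>as. z - a))"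
proof -
  obtain K :: nat where "B < 2 ^ K * cmod (f 0)"
  proof -
    obtain K :: nat where "B / cmod (f 0) < 2 ^ K"
      using real_arch_pow[of 2 "B / cmod (f 0)"] by auto
    thus ?thesis using that[of K] assms(4) by (simp add: field_simps)
  qed
  thus ?thesis using assms(1,3,4)
  proof (induction K arbitrary: f)
    case 0
    have "cmod (f 0) \<le> B" using 0 by auto
    with 0 show ?case by auto
  next
    case (Suc K)
    show ?case
    proof (cases "\<exists>a. cmod a \<le> 1/2 \<and> f a = 0")
      case False
      thus ?thesis using Suc.prems by (intro exI[of _ "[]"] exI[of _ f]) auto
    next
      case True
      then obtain a where a: "cmod a \<le> 1/2" "f a = 0" by auto
      obtain h where h: "h holomorphic_on ball 0 R"
        "\<And>z. z \<in> cball 0 1 \<Longrightarrow> cmod (h z) \<le> B"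
        "cmod (h 0) \<ge> 2 * cmod (f 0)"
        "\<And>z. f z * (1 - cnj a * z) = h z * (z - a)"
        using remove_zero[OF Suc.prems(2) R Suc.prems(3) a Suc.prems(4)] by blast
      have "2 ^ K * (2 * cmod (f 0)) \<le> 2 ^ K * cmod (h 0)"
        using h(3) by (intro mult_left_mono) auto
      hence "B < 2 ^ K * cmod (h 0)" using Suc.prems(1) by (simp only: power_Suc mult_ac)
      moreover have "h 0 \<noteq> 0" using h(3) Suc.prems(4) by auto
      ultimately obtain as g where g: "g holomorphic_on ball 0 R" "\<forall>z\<in>cball 0 1. cmod (g z) \<le> B"
        "cmod (g 0) \<ge> 2 ^ length as * cmod (h 0)" "\<forall>a\<in>set as. cmod a \<le> 1/2"
        "\<forall>z\<in>cball 0 (1/2). g z \<noteq> 0"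
        "\<And>z. h z * (\<Prod>a\<leftarrow>as. 1 - cnj a * z) = g z * (\<Prod>a\<leftarrow>as. z - a)"
        using Suc.IH[of h] h by blast
      have "f z * (\<Prod>a\<leftarrow>a#as. 1 - cnj a * z) = g z * (\<Prod>a\<leftarrow>a#as. z - a)" for z
      proof -
        have "f z * (\<Prod>a\<leftarrow>a#as. 1 - cnj a * z)
            = (f z * (1 - cnj a * z)) * (\<Prod>a\<leftarrow>as. 1 - cnj a * z)" by simp
        also have "\<dots> = (z - a) * (h z * (\<Prod>a\<leftarrow>as. 1 - cnj a * z))"
          unfolding h(4) by simp
        also have "\<dots> = g z * (\<Prod>a\<leftarrow>a#as. z - a)" unfolding g(6) by simp
        finally show ?thesis .
      qed
      moreover have "cmod (g 0) \<ge> 2 ^ length (a#as) * cmod (f 0)"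
      proof -
        have "2 ^ length as * (2 * cmod (f 0)) \<le> 2 ^ length as * cmod (h 0)"
          using h(3) by (intro mult_left_mono) auto
        also have "\<dots> \<le> cmod (g 0)" by (fact g(3))
        finally show ?thesis by (simp add: mult_ac)
      qed
      ultimately show ?thesis using g a by (intro exI[of _ "a#as"] exI[of _ g]) auto
    qed
  qed
qed

text \<open>Harnack's inequality for the positive harmonic function \<open>H + 1 - ln \<bar>g\<bar>\<close>, obtained
  from the Schwarz lemma after a Cayley transform.\<close>

lemma zero_free_lower_bound:
  fixes g :: "complex \<Rightarrow> complex"
  assumes holg: "g holomorphic_on ball 0 R" and R: "R > 1"
    and bd: "\<And>z. z \<in> cball 0 1 \<Longrightarrow> cmod (g z) \<le> exp H"
    and nz: "\<And>z. z \<in> cball 0 (1/2) \<Longrightarrow> g z \<noteq> 0"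
    and g0: "cmod (g 0) \<ge> 1" and z: "cmod z \<le> 1/4"
  shows "cmod (g z) \<ge> exp (- 2 * (H + 1))"
proof -
  obtain h where h: "h holomorphic_on ball 0 (1/2)" "\<And>z. z \<in> ball 0 (1/2) \<Longrightarrow> exp (h z) = g z"
  proof (rule holomorphic_logarithm_exists[of "ball 0 (1/2)" g 0])
    show "g holomorphic_on ball 0 (1/2)" using holg R by (auto intro: holomorphic_on_subset)
  qed (use nz in auto)
  define p where "p = (\<lambda>z. of_real (H + 1) - h z)"
  have rep: "Re (p z) \<ge> 1" if "z \<in> ball 0 (1/2)" for z
  proof -
    have "cmod (exp (h z)) \<le> exp H" using h(2)[OF that] bd[of z] that by simp
    hence "exp (Re (h z)) \<le> exp H" by (simp only: norm_exp_eq_Re)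
    thus ?thesis by (simp add: p_def)
  qed
  define q where "q = (\<lambda>w. (p (w/2) - p 0) / (p (w/2) + cnj (p 0)))"
  have half: "w / 2 \<in> ball 0 (1/2)" if "cmod w < 1" for w :: complex
    using that by (simp add: norm_divide)
  have den: "Re (p (w/2) + cnj (p 0)) \<ge> 2" if "cmod w < 1" for w
    using rep[OF half[OF that]] rep[of 0] by simp
  have den0: "p (w/2) + cnj (p 0) \<noteq> 0" if "cmod w < 1" for w
  proof
    assume "p (w/2) + cnj (p 0) = 0"
    with den[OF that] show False by simp
  qed
  \<comment> \<open>The identity behind the Cayley transform: \<open>q\<close> has modulus below 1
    because both real parts are positive. It is used a second time to turn the bound 1/2 on
    \<open>q\<close> into an inequality between real parts.\<close>
  have id: "(cmod (u - c))\<^sup>2 = (cmod (u + cnj c))\<^sup>2 - 4 * Re u * Re c" for u c :: complex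
    unfolding cmod_power2 by (simp add: power2_eq_square algebra_simps)
  have "cmod (q w) < 1" if "cmod w < 1" for w
  proof -
    have "(cmod (p (w/2) - p 0))\<^sup>2 < (cmod (p (w/2) + cnj (p 0)))\<^sup>2"
      using id[of "p (w/2)" "p 0"] rep[OF half[OF that]] rep[of 0]
      by (smt (verit) mult_pos_pos centre_in_ball half_gt_zero)
    hence "cmod (p (w/2) - p 0) < cmod (p (w/2) + cnj (p 0))"
      using power2_less_imp_less norm_ge_zero by blast
    thus ?thesis using den0[OF that] by (simp add: q_def norm_divide)
  qed
  moreover have "q holomorphic_on ball 0 1"
  proof -
    have "(p \<circ> (\<lambda>w. w/2)) holomorphic_on ball 0 1"
    proof (rule holomorphic_on_compose_gen)
      show "p holomorphic_on ball 0 (1/2)" unfolding p_def by (intro holomorphic_intros h)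
      show "(\<lambda>w. w / 2) ` ball 0 1 \<subseteq> ball (0::complex) (1/2)" using half by auto
    qed (intro holomorphic_intros, auto)
    hence "(\<lambda>w. p (w/2)) holomorphic_on ball 0 1" by (simp add: o_def)
    thus ?thesis unfolding q_def using den0 by (intro holomorphic_intros) auto
  qed
  moreover have "q 0 = 0" by (simp add: q_def)
  moreover have z2: "cmod (2 * z) < 1" using z by (simp add: norm_mult)
  ultimately have "cmod (q (2 * z)) \<le> cmod (2 * z)"
    using Schwarz_Lemma(1)[of q "2 * z"] by blast
  hence "cmod (q (2 * z)) \<le> 1/2" using z by (simp add: norm_mult)
  hence "cmod (p z - p 0) \<le> 1/2 * cmod (p z + cnj (p 0))"
    using den0[OF z2] by (simp add: q_def norm_divide field_simps)
  hence "(cmod (p z - p 0))\<^sup>2 \<le> (1/2 * cmod (p z + cnj (p 0)))\<^sup>2"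
    by (intro power_mono) auto
  hence 1: "16 * Re (p z) * Re (p 0) \<ge> 3 * (cmod (p z + cnj (p 0)))\<^sup>2"
    using id[of "p z" "p 0"] by (simp add: power_mult_distrib power_divide)
  have 2: "(cmod (p z + cnj (p 0)))\<^sup>2 \<ge> (Re (p z) + Re (p 0))\<^sup>2"
    by (simp add: cmod_power2)
  define a c where "a = Re (p z)" and "c = Re (p 0)"
  have ac: "a \<ge> 1" "c \<ge> 1" using rep[of z] rep[of 0] z by (auto simp: a_def c_def)
  \<comment> \<open>Modulus at most 1/2 of the Cayley transform confines a / c to [1/3, 3]. The
    upper end, together with c \<le> H + 1, produces the loss \<open>2 * (H + 1)\<close>.\<close>
  have "(3 * a - c) * (a - 3 * c) \<le> 0"
    using 1 2 unfolding a_def[symmetric] c_def[symmetric]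
    by (simp add: power2_eq_square algebra_simps)
  hence "a \<le> 3 * c" using ac by (smt (verit) mult_pos_pos)
  moreover have "c \<le> H + 1"
  proof -
    have "cmod (exp (h 0)) \<ge> 1" using h(2)[of 0] g0 by simp
    hence "exp (Re (h 0)) \<ge> 1" by (simp only: norm_exp_eq_Re)
    thus ?thesis by (simp add: c_def p_def)
  qed
  ultimately have "Re (h z) \<ge> - 2 * (H + 1)" by (simp add: a_def p_def)
  moreover have "cmod (g z) = exp (Re (h z))" using h(2)[of z] z by (simp flip: norm_exp_eq_Re)
  ultimately show ?thesis by simp
qed

section \<open>Sublevel sets of products of linear factors\<close>

text \<open>Each half of the singularity contributes 2, and the points farther than 1 from \<alpha>
  at most the length 2 of the interval. Uniformity in \<alpha> matters, since \<alpha> will be the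
  real part of an arbitrary zero.\<close>

lemma nn_integral_inverse_sqrt_le:
  "(\<integral>\<^sup>+t\<in>{-1..1}. ennreal (\<bar>t - \<alpha>\<bar> powr (-1/2)) \<partial>lborel) \<le> 6"
proof -
  define p where "p = (\<lambda>u::real. ennreal (u powr (-1/2)) * indicator {0..1} u)"
  have [measurable]: "p \<in> borel_measurable borel" unfolding p_def by measurable
  have "((\<lambda>x. x powr (-1/2)) has_integral (1 powr (-1/2+1) / (-1/2+1))) {0..1::real}"
    by (rule has_integral_powr_from_0) auto
  hence "((\<lambda>x::real. x powr (-1/2)) has_integral 2) {0..1}" by simp
  hence p2: "(\<integral>\<^sup>+u. p u \<partial>lborel) = 2"
    unfolding p_def by (subst nn_integral_has_integral_lebesgue'[where I=2]) auto
  have sh1: "(\<integral>\<^sup>+t. p (t - \<alpha>) \<partial>lborel) = 2"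
    using nn_integral_real_affine[of p 1 "-\<alpha>"] p2 by simp
  have sh2: "(\<integral>\<^sup>+t. p (\<alpha> - t) \<partial>lborel) = 2"
    using nn_integral_real_affine[of p "-1" "\<alpha>"] p2 by simp
  have "ennreal (\<bar>t - \<alpha>\<bar> powr (-1/2)) * indicator {-1..1} t
      \<le> p (t - \<alpha>) + p (\<alpha> - t) + indicator {-1..1} t" for t :: real
  proof (cases "\<bar>t - \<alpha>\<bar> \<le> 1")
    case True
    thus ?thesis by (cases "t \<ge> \<alpha>") (auto simp: p_def indicator_def)
  next
    case False
    hence "\<bar>t - \<alpha>\<bar> powr (-1/2) \<le> 1 powr (-1/2)"
      by (intro powr_mono2') auto
    hence "ennreal (\<bar>t - \<alpha>\<bar> powr (-1/2)) \<le> 1" by (simp add: ennreal_le_1)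
    thus ?thesis by (auto simp: p_def indicator_def intro: add_increasing)
  qed
  hence "(\<integral>\<^sup>+t\<in>{-1..1}. ennreal (\<bar>t - \<alpha>\<bar> powr (-1/2)) \<partial>lborel)
      \<le> (\<integral>\<^sup>+t. p (t - \<alpha>) + p (\<alpha> - t) + indicator {-1..1} t \<partial>lborel)"
    by (intro nn_integral_mono) auto
  also have "\<dots> = (\<integral>\<^sup>+t. p (t - \<alpha>) \<partial>lborel) + (\<integral>\<^sup>+t. p (\<alpha> - t) \<partial>lborel) + 2"
    by (subst nn_integral_add; (subst nn_integral_add)?) auto
  also have "\<dots> = 6" unfolding sh1 sh2 by simp
  finally show ?thesis .
qed

text \<open>An averaged form of Cartan's lemma that replaces the covering of the small set by discs.
  Where the product of n factors is at most \<delta>^n, the geometric mean of sqrt (\<delta> /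
  \<bar>t - Re a\<bar>) is at least 1, hence so is the arithmetic mean. Markov's inequality for the
  sum \<open>k\<close>, whose integral is at most 6 n, then gives a bound that does not depend on
  n.\<close>

lemma emeasure_small_product_le:
  fixes as :: "complex list"
  assumes as: "as \<noteq> []" and \<delta>: "\<delta> > 0"
  shows "emeasure lborel {t\<in>{-1..1}. (\<Prod>a\<leftarrow>as. cmod (of_real t - a)) \<le> \<delta> ^ length as}
    \<le> ennreal (6 * sqrt \<delta>)"
proof -
  define n where "n = length as"
  define S where "S = {t\<in>{-1..1}. (\<Prod>a\<leftarrow>as. cmod (of_real t - a)) \<le> \<delta> ^ length as}"
  \<comment> \<open>At the real part of a zero, \<open>ln\<close> and \<open>powr\<close> take the
    default value 0 for the argument 0, and the pointwise lower bound on \<open>k\<close> would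
    fail. These finitely many points form a null set and are removed.\<close>
  define F where "F = Re ` set as"
  define k where "k = (\<lambda>t. \<Sum>a\<leftarrow>as. ennreal (\<bar>t - Re a\<bar> powr (-1/2)) * indicator {-1..1} t)"
  have n: "n > 0" using as by (simp add: n_def)
  have [measurable]: "S \<in> sets lborel"
  proof -
    have "(\<lambda>t. \<Prod>a\<leftarrow>as. cmod (of_real t - a)) \<in> borel_measurable borel"
      by (induction as) auto
    thus ?thesis unfolding S_def by simp
  qed
  have kmeas: "k \<in> borel_measurable borel"
    unfolding k_def by (induction as) auto
  have kint: "(\<integral>\<^sup>+t. k t \<partial>lborel) \<le> ennreal (6 * n)"
    unfolding k_def n_def
  proof (induction as)
    case (Cons a as)
    have m: "(\<lambda>t. \<Sum>a\<leftarrow>as. ennreal (\<bar>t - Re a\<bar> powr (-1/2)) * indicator {-1..1} t) \<in> borel_measurable lborel"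
      by (induction as) auto
    have "(\<integral>\<^sup>+t. (\<Sum>a\<leftarrow>a#as. ennreal (\<bar>t - Re a\<bar> powr (-1/2)) * indicator {-1..1} t) \<partial>lborel)
       = (\<integral>\<^sup>+t\<in>{-1..1}. ennreal (\<bar>t - Re a\<bar> powr (-1/2)) \<partial>lborel)
        + (\<integral>\<^sup>+t. (\<Sum>a\<leftarrow>as. ennreal (\<bar>t - Re a\<bar> powr (-1/2)) * indicator {-1..1} t) \<partial>lborel)"
      using m by (simp add: nn_integral_add)
    also have "\<dots> \<le> 6 + ennreal (6 * length as)"
      by (intro add_mono nn_integral_inverse_sqrt_le Cons.IH)
    also have "\<dots> = ennreal (6 * length (a#as))"
      by (simp flip: ennreal_numeral ennreal_plus add: algebra_simps)
    finally show ?case .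
  qed simp
  have lower: "ennreal (n / sqrt \<delta>) \<le> k t" if t: "t \<in> S - F" for t
  proof -
    have pos: "0 < \<bar>t - Re a\<bar>" if "a \<in> set as" for a using t that by (auto simp: F_def)
    have cm: "\<bar>t - Re a\<bar> \<le> cmod (of_real t - a)" for a
      using abs_Re_le_cmod[of "of_real t - a"] by simp
    have "(\<Prod>a\<leftarrow>as. \<bar>t - Re a\<bar>) \<le> (\<Prod>a\<leftarrow>as. cmod (of_real t - a))"
      using cm by (induction as) (auto intro!: mult_mono prod_list_nonneg)
    also have "\<dots> \<le> \<delta> ^ length as" using t by (auto simp: S_def)
    finally have pr: "(\<Prod>a\<leftarrow>as. \<bar>t - Re a\<bar>) \<le> \<delta> ^ length as" .
    have prpos: "(\<Prod>a\<leftarrow>as. \<bar>t - Re a\<bar>) > 0"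
      using pos by (induction as) auto
    have "ln (\<Prod>a\<leftarrow>as. \<bar>t - Re a\<bar>) \<le> ln (\<delta> ^ length as)" using pr prpos by simp
    also have "ln (\<Prod>a\<leftarrow>as. \<bar>t - Re a\<bar>) = (\<Sum>a\<leftarrow>as. ln \<bar>t - Re a\<bar>)"
      using pos
    proof (induction as)
      case (Cons a as)
      have "0 < \<bar>t - Re b\<bar>" if "b \<in> set as" for b using Cons.prems that by auto
      hence "(\<Prod>a\<leftarrow>as. \<bar>t - Re a\<bar>) > 0" by (induction as) (auto intro!: mult_pos_pos)
      moreover have "0 < \<bar>t - Re a\<bar>" using Cons.prems by simp
      ultimately show ?case using Cons by (simp add: ln_mult_pos)
    qed simp
    also have "ln (\<delta> ^ length as) = n * ln \<delta>" using \<delta> by (simp add: ln_realpow n_def)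
    finally have s1: "(\<Sum>a\<leftarrow>as. ln \<bar>t - Re a\<bar>) \<le> n * ln \<delta>" .
    \<comment> \<open>The tangent-line inequality for \<open>ln\<close>, applied to sqrt (\<delta> /
      u). Summed over the factors it does the work of the inequality between the two means.\<close>
    have tm: "1 + (ln \<delta> - ln u) / 2 \<le> sqrt \<delta> * u powr (-1/2)" if "u > 0" for u :: real
    proof -
      have "1 + ln (sqrt \<delta> * u powr (-1/2)) \<le> sqrt \<delta> * u powr (-1/2)"
        using ln_le_minus_one[of "sqrt \<delta> * u powr (-1/2)"] that \<delta> by simp
      moreover have "ln (sqrt \<delta> * u powr (-1/2)) = (ln \<delta> - ln u) / 2"
        using that \<delta> by (simp add: ln_mult ln_sqrt ln_powr field_simps)
      ultimately show ?thesis by linarith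
    qed
    have "(\<Sum>a\<leftarrow>as. 1 + (ln \<delta> - ln \<bar>t - Re a\<bar>) / 2) \<le> (\<Sum>a\<leftarrow>as. sqrt \<delta> * \<bar>t - Re a\<bar> powr (-1/2))"
      using pos by (intro sum_list_mono tm) auto
    moreover have "(\<Sum>a\<leftarrow>as. 1 + (ln \<delta> - ln \<bar>t - Re a\<bar>) / 2)
       = n + (n * ln \<delta> - (\<Sum>a\<leftarrow>as. ln \<bar>t - Re a\<bar>)) / 2"
      unfolding n_def by (induction as) (auto simp: field_simps)
    moreover have "(\<Sum>a\<leftarrow>as. sqrt \<delta> * \<bar>t - Re a\<bar> powr (-1/2)) = sqrt \<delta> * (\<Sum>a\<leftarrow>as. \<bar>t - Re a\<bar> powr (-1/2))"
      by (simp add: sum_list_const_mult)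
    moreover have "0 \<le> (n * ln \<delta> - (\<Sum>a\<leftarrow>as. ln \<bar>t - Re a\<bar>)) / 2" using s1 by simp
    ultimately have "real n \<le> sqrt \<delta> * (\<Sum>a\<leftarrow>as. \<bar>t - Re a\<bar> powr (-1/2))" by linarith
    hence "n / sqrt \<delta> \<le> (\<Sum>a\<leftarrow>as. \<bar>t - Re a\<bar> powr (-1/2))"
      using \<delta> by (simp add: field_simps)
    moreover have "k t = ennreal (\<Sum>a\<leftarrow>as. \<bar>t - Re a\<bar> powr (-1/2))"
    proof -
      have "t \<in> {-1..1}" using t by (auto simp: S_def)
      thus ?thesis unfolding k_def
        by (induction as) (auto intro!: ennreal_plus[symmetric] sum_list_nonneg)
    qed
    ultimately show ?thesis by (simp add: ennreal_leI)
  qed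
  have finF: "finite F" by (simp add: F_def)
  have F0: "emeasure lborel F = 0" using finF by (simp add: emeasure_lborel_countable countable_finite)
  have [measurable]: "F \<in> sets lborel" using finF by (simp add: finite_imp_closed)
  have "ennreal (n / sqrt \<delta>) * emeasure lborel (S - F) = (\<integral>\<^sup>+t. ennreal (n / sqrt \<delta>) * indicator (S - F) t \<partial>lborel)"
    by (rule nn_integral_cmult_indicator[symmetric], measurable)
  also have "\<dots> \<le> (\<integral>\<^sup>+t. k t \<partial>lborel)"
    using lower by (intro nn_integral_mono) (auto simp: indicator_def)
  also have "\<dots> \<le> ennreal (6 * n)" by (rule kint)
  finally have *: "ennreal (n / sqrt \<delta>) * emeasure lborel (S - F) \<le> ennreal (6 * n)" .
  have [simp]: "S \<in> sets borel" "F \<in> sets borel"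
    using \<open>S \<in> sets lborel\<close> \<open>F \<in> sets lborel\<close> by simp_all
  have "emeasure lborel S \<le> emeasure lborel (S - F \<union> F)"
    by (rule emeasure_mono) auto
  also have "\<dots> \<le> emeasure lborel (S - F) + emeasure lborel F"
    by (rule emeasure_subadditive) auto
  also have "\<dots> = ennreal (sqrt \<delta> / n) * (ennreal (n / sqrt \<delta>) * emeasure lborel (S - F))"
    using n \<delta> by (simp add: F0 mult.assoc[symmetric] ennreal_mult[symmetric])
  also have "\<dots> \<le> ennreal (sqrt \<delta> / n) * ennreal (6 * n)"
    by (intro mult_left_mono *) auto
  also have "\<dots> = ennreal (6 * sqrt \<delta>)"
    using n \<delta> by (simp add: ennreal_mult[symmetric])
  finally show ?thesis by (simp add: S_def)
qed

text \<open>The zero-free factor costs 4 H by Harnack, and the denominators of the Blaschke product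
  cost one more H because 2^n \<le> exp H for n zeros: this is the 5. The same inequality n ln 2
  \<le> H turns the remaining exp (- (s - 5) H) into at most \<delta>^n with \<delta> = 2 powr (5 -
  s), so neither n nor H appears in the measure.\<close>

lemma cartan_estimate_disc:
  fixes f :: "complex \<Rightarrow> complex"
  assumes holf: "f holomorphic_on ball 0 R" and R: "R > 1"
    and bd: "\<And>z. z \<in> cball 0 1 \<Longrightarrow> cmod (f z) \<le> exp H"
    and f0: "cmod (f 0) \<ge> 1" and H: "H \<ge> 1" and s: "s > 5"
  shows "emeasure lborel {t\<in>{-1/4..1/4}. cmod (f (of_real t)) \<le> exp (- s * H)}
    \<le> ennreal (6 * sqrt (2 powr (5 - s)))"
proof -
  have "f 0 \<noteq> 0" using f0 by auto
  then obtain as g where g: "g holomorphic_on ball 0 R" "\<forall>z\<in>cball 0 1. cmod (g z) \<le> exp H"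
    "cmod (g 0) \<ge> 2 ^ length as * cmod (f 0)" and as: "\<forall>a\<in>set as. cmod a \<le> 1/2"
    and nz: "\<forall>z\<in>cball 0 (1/2). g z \<noteq> 0"
    and eq: "\<And>z. f z * (\<Prod>a\<leftarrow>as. 1 - cnj a * z) = g z * (\<Prod>a\<leftarrow>as. z - a)"
    using blaschke_factorization[OF holf R bd] by blast
  define n where "n = length as"
  have "2 ^ n * 1 \<le> 2 ^ n * cmod (f 0)" using f0 by (intro mult_left_mono) auto
  hence g0: "2 ^ n \<le> cmod (g 0)" using g(3) unfolding n_def by linarith
  also have "\<dots> \<le> exp H" using g(2) by auto
  finally have nH: "2 ^ n \<le> exp H" .
  have g01: "cmod (g 0) \<ge> 1" using g0 one_le_power[of "2::real" n] by linarith
  have key: "(\<Prod>a\<leftarrow>as. cmod (of_real t - a)) \<le> exp (- (s - 5) * H)"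
    if t: "t \<in> {-1/4..1/4}" "cmod (f (of_real t)) \<le> exp (- s * H)" for t
  proof -
    have ct: "cmod (of_real t) \<le> 1/4" using t by auto
    have "exp (- 2 * (H + 1)) \<le> cmod (g (of_real t))"
      by (rule zero_free_lower_bound[OF g(1) R _ _ g01 ct]) (use g(2) nz in auto)
    moreover have "exp (- 4 * H) \<le> exp (- 2 * (H + 1))" using H by simp
    ultimately have gl: "exp (- 4 * H) \<le> cmod (g (of_real t))" by linarith
    have p2: "cmod (\<Prod>a\<leftarrow>as. 1 - cnj a * of_real t) \<le> 2 ^ n"
      using as unfolding n_def
    proof (induction as)
      case (Cons a as)
      have "cmod (1 - cnj a * of_real t) \<le> cmod 1 + cmod (cnj a * of_real t)"
        by (rule norm_triangle_ineq4)
      also have "\<dots> \<le> 1 + 1/2 * (1/4)"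
        using Cons.prems ct unfolding norm_mult complex_mod_cnj
        by (intro add_mono mult_mono) auto
      finally have "cmod (1 - cnj a * of_real t) \<le> 2" by simp
      thus ?case using Cons by (auto simp: norm_mult intro!: mult_mono)
    qed simp
    have pn: "(\<Prod>a\<leftarrow>as. cmod (of_real t - a)) = cmod (\<Prod>a\<leftarrow>as. of_real t - a)"
      by (induction as) (auto simp: norm_mult)
    have "exp (- 4 * H) * (\<Prod>a\<leftarrow>as. cmod (of_real t - a)) \<le> cmod (g (of_real t)) * cmod (\<Prod>a\<leftarrow>as. of_real t - a)"
      unfolding pn by (intro mult_right_mono gl) auto
    also have "\<dots> = cmod (f (of_real t)) * cmod (\<Prod>a\<leftarrow>as. 1 - cnj a * of_real t)"
      using eq[of "of_real t"] by (metis norm_mult)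
    also have "\<dots> \<le> exp (- s * H) * exp H"
      using t(2) order_trans[OF p2 nH] by (intro mult_mono) auto
    finally have "(\<Prod>a\<leftarrow>as. cmod (of_real t - a)) \<le> exp (- s * H) * exp H / exp (- 4 * H)"
      by (simp add: field_simps)
    also have "\<dots> = exp (- (s - 5) * H)"
      unfolding exp_add[symmetric] exp_diff[symmetric] by (simp add: algebra_simps)
    finally show ?thesis .
  qed
  show ?thesis
  proof (cases "as = []")
    case True
    have "(s - 5) * H > 0" using s H by (intro mult_pos_pos) auto
    hence "exp (- (s - 5) * H) < 1" unfolding exp_less_one_iff by linarith
    hence "{t\<in>{-1/4..1/4}. cmod (f (of_real t)) \<le> exp (- s * H)} = {}" using key True by fastforce
    thus ?thesis by (simp only: emeasure_empty zero_le)
  next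
    case False
    define \<delta> :: real where "\<delta> = 2 powr (5 - s)"
    have "exp (- (s - 5) * H) \<le> \<delta> ^ n"
    proof -
      have "n * ln 2 \<le> H" using nH by (metis exp_gt_zero ln_exp ln_le_cancel_iff ln_realpow zero_less_numeral zero_less_power)
      hence "(s - 5) * (n * ln 2) \<le> (s - 5) * H" using s by (intro mult_left_mono) auto
      hence "exp (- (s - 5) * H) \<le> exp (- (s - 5) * (n * ln 2))"
        unfolding exp_le_cancel_iff by linarith
      also have "\<dots> = \<delta> ^ n" by (simp add: \<delta>_def powr_def exp_of_nat_mult[symmetric] algebra_simps)
      finally show ?thesis .
    qed
    hence "{t\<in>{-1/4..1/4}. cmod (f (of_real t)) \<le> exp (- s * H)}
        \<subseteq> {t\<in>{-1..1}. (\<Prod>a\<leftarrow>as. cmod (of_real t - a)) \<le> \<delta> ^ length as}"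
      using key by (fastforce simp: n_def)
    moreover have "{t\<in>{-1..1}. (\<Prod>a\<leftarrow>as. cmod (of_real t - a)) \<le> \<delta> ^ length as} \<in> sets lborel"
    proof -
      have "(\<lambda>t. \<Prod>a\<leftarrow>as. cmod (of_real t - a)) \<in> borel_measurable borel"
        by (induction as) auto
      thus ?thesis by simp
    qed
    ultimately have "emeasure lborel {t\<in>{-1/4..1/4}. cmod (f (of_real t)) \<le> exp (- s * H)}
       \<le> emeasure lborel {t\<in>{-1..1}. (\<Prod>a\<leftarrow>as. cmod (of_real t - a)) \<le> \<delta> ^ length as}"
      by (rule emeasure_mono)
    also have "\<dots> \<le> ennreal (6 * sqrt \<delta>)"
      by (rule emeasure_small_product_le) (use False in \<open>auto simp: \<delta>_def\<close>)
    finally show ?thesis by (simp add: \<delta>_def)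
  qed
qed

text \<open>Scaling by 8 stretches [-1/4, 1/4] to [-2, 2], which contains [1, 2], and multiplies
  lengths by 8, whence 48 = 8 * 6. The interval keeps away from 0 because \<open>t\<close> will
  serve as a dilation factor.\<close>

lemma cartan_estimate_ray:
  fixes f :: "complex \<Rightarrow> complex"
  assumes holf: "f holomorphic_on ball 0 R" and R: "R > 8"
    and bd: "\<And>z. z \<in> cball 0 8 \<Longrightarrow> cmod (f z) \<le> exp H"
    and f0: "cmod (f 0) \<ge> 1" and H: "H \<ge> 1" and s: "s > 5"
  shows "{t\<in>{1..2}. cmod (f (of_real t)) \<le> exp (- s * H)} \<in> sets lborel"
    and "emeasure lborel {t\<in>{1..2}. cmod (f (of_real t)) \<le> exp (- s * H)}
    \<le> ennreal (48 * sqrt (2 powr (5 - s)))"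
proof -
  define g where "g = (\<lambda>z. f (8 * z))"
  define T where "T = {t\<in>{1..2}. cmod (f (of_real t)) \<le> exp (- s * H)}"
  have "continuous_on {1..2} (\<lambda>t. cmod (f (of_real t)))"
    using R by (intro continuous_intros continuous_on_compose2[OF holomorphic_on_imp_continuous_on[OF holf]]) auto
  hence "closed T" unfolding T_def
    by (intro continuous_on_closed_Collect_le[of "{1..2}" _ "\<lambda>_. exp (- s * H)"]) auto
  hence meas: "T \<in> sets lborel" by simp
  thus "{t\<in>{1..2}. cmod (f (of_real t)) \<le> exp (- s * H)} \<in> sets lborel" by (simp add: T_def)
  define S where "S = {t\<in>{-1/4..1/4}. cmod (g (of_real t)) \<le> exp (- s * H)}"
  have holg: "g holomorphic_on ball 0 (R / 8)"
  proof -
    have "(f \<circ> (\<lambda>z. 8 * z)) holomorphic_on ball 0 (R / 8)"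
      by (rule holomorphic_on_compose_gen[OF _ holf])
        (auto intro!: holomorphic_intros simp: norm_mult field_simps)
    thus ?thesis by (simp add: g_def o_def)
  qed
  have "emeasure lborel S \<le> ennreal (6 * sqrt (2 powr (5 - s)))"
    unfolding S_def
    by (rule cartan_estimate_disc[OF holg _ _ _ H s]) (use R bd f0 in \<open>auto simp: g_def norm_mult\<close>)
  moreover have "S \<in> sets lborel"
  proof -
    have "continuous_on {-1/4..1/4} (\<lambda>t. cmod (g (of_real t)))"
      using R by (intro continuous_intros continuous_on_compose2[OF holomorphic_on_imp_continuous_on[OF holg]]) auto
    hence "closed S" unfolding S_def
      by (intro continuous_on_closed_Collect_le[of "{-1/4..1/4}" _ "\<lambda>_. exp (- s * H)"]) auto
    thus ?thesis by simp
  qed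
  moreover have "t / 8 \<in> S" if "t \<in> T" for t
    using that by (auto simp: S_def T_def g_def)
  hence "indicator T t \<le> (indicator S (t/8) :: ennreal)" for t
    by (auto simp: indicator_def)
  hence "(\<integral>\<^sup>+t. indicator T t \<partial>lborel) \<le> (\<integral>\<^sup>+t. (indicator S (t/8) :: ennreal) \<partial>lborel)"
    by (intro nn_integral_mono) auto
  moreover have "(\<integral>\<^sup>+t. indicator S t \<partial>lborel) = ennreal (1/8) * (\<integral>\<^sup>+t. (indicator S (t/8) :: ennreal) \<partial>lborel)"
    using nn_integral_real_affine[of "indicator S" "1/8" 0] \<open>S \<in> sets lborel\<close> by simp
  ultimately have "emeasure lborel T \<le> ennreal 8 * (ennreal (1/8) * (\<integral>\<^sup>+t. (indicator S (t/8) :: ennreal) \<partial>lborel))"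
    using meas by (simp add: mult.assoc[symmetric] ennreal_mult[symmetric] del: ennreal_numeral)
  also have "\<dots> = ennreal 8 * emeasure lborel S"
    using \<open>(\<integral>\<^sup>+t. indicator S t \<partial>lborel) = _\<close> \<open>S \<in> sets lborel\<close> by simp
  also have "\<dots> \<le> ennreal 8 * ennreal (6 * sqrt (2 powr (5 - s)))"
    using \<open>emeasure lborel S \<le> _\<close> by (intro mult_left_mono) auto
  also have "\<dots> = ennreal (48 * sqrt (2 powr (5 - s)))"
    by (subst ennreal_mult[symmetric]) auto
  finally show "emeasure lborel {t\<in>{1..2}. cmod (f (of_real t)) \<le> exp (- s * H)}
    \<le> ennreal (48 * sqrt (2 powr (5 - s)))" by (simp add: T_def)
qed

section \<open>Integration along rays\<close>

lemma emeasure_PiM_lborel_affine: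
  fixes c :: "'i \<Rightarrow> real"
  assumes I: "finite I" and t: "t > 0" and A: "A \<in> sets (PiM I (\<lambda>_. lborel))"
  shows "(\<lambda>w. \<lambda>i\<in>I. c i + t * w i) \<in> PiM I (\<lambda>_. lborel) \<rightarrow>\<^sub>M PiM I (\<lambda>_. lborel)"
    and "emeasure (PiM I (\<lambda>_. lborel)) A = ennreal (t ^ card I) *
      emeasure (PiM I (\<lambda>_. lborel)) ((\<lambda>w. \<lambda>i\<in>I. c i + t * w i) -` A \<inter> space (PiM I (\<lambda>_. lborel)))"
proof -
  define M where "M = PiM I (\<lambda>_. lborel :: real measure)"
  define \<phi> where "\<phi> = (\<lambda>w. \<lambda>i\<in>I. c i + t * w i)"
  interpret product_sigma_finite "\<lambda>_. lborel :: real measure" by standard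
  have m[measurable]: "\<phi> \<in> M \<rightarrow>\<^sub>M M"
    unfolding \<phi>_def M_def by measurable
  show "(\<lambda>w. \<lambda>i\<in>I. c i + t * w i) \<in> PiM I (\<lambda>_. lborel) \<rightarrow>\<^sub>M PiM I (\<lambda>_. lborel)"
    using m by (simp add: \<phi>_def M_def)
  have one: "emeasure lborel B = ennreal t * emeasure lborel ((\<lambda>x. c + t * x) -` B)"
    if "B \<in> sets lborel" for B and c :: real
  proof -
    have "emeasure lborel B = emeasure (density (distr lborel borel (\<lambda>x. c + t * x)) (\<lambda>_. ennreal t)) B"
      using lborel_real_affine[of t c] t by simp
    also have "\<dots> = ennreal t * emeasure (distr lborel borel (\<lambda>x. c + t * x)) B"
      using that by (subst emeasure_density) (auto simp: nn_integral_cmult_indicator)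
    also have "emeasure (distr lborel borel (\<lambda>x. c + t * x)) B = emeasure lborel ((\<lambda>x. c + t * x) -` B)"
      using that by (subst emeasure_distr) auto
    finally show ?thesis .
  qed
  have "scale_measure (ennreal (t ^ card I)) (distr M M \<phi>) = M"
    unfolding M_def
  proof (rule PiM_eqI[OF I])
    fix B :: "'i \<Rightarrow> real set" assume B: "\<And>i. i \<in> I \<Longrightarrow> B i \<in> sets lborel"
    have B': "Pi\<^sub>E I B \<in> sets M" unfolding M_def using B I by (intro sets_PiM_I_finite) auto
    have C: "(\<lambda>x. c i + t * x) -` B i \<in> sets lborel" if "i \<in> I" for i
      using measurable_sets[of "\<lambda>x. c i + t * x" lborel lborel "B i"] B[OF that] by simp
    have "emeasure (distr M M \<phi>) (Pi\<^sub>E I B) = emeasure M (\<phi> -` Pi\<^sub>E I B \<inter> space M)"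
      using B' by (subst emeasure_distr) auto
    also have "\<phi> -` Pi\<^sub>E I B \<inter> space M = Pi\<^sub>E I (\<lambda>i. (\<lambda>x. c i + t * x) -` B i)"
      by (auto simp: \<phi>_def M_def space_PiM PiE_iff)
    also have "emeasure M \<dots> = (\<Prod>i\<in>I. emeasure lborel ((\<lambda>x. c i + t * x) -` B i))"
      unfolding M_def using C I by (subst emeasure_PiM) auto
    finally have "emeasure (scale_measure (ennreal (t ^ card I)) (distr M M \<phi>)) (Pi\<^sub>E I B)
      = ennreal t ^ card I * (\<Prod>i\<in>I. emeasure lborel ((\<lambda>x. c i + t * x) -` B i))"
      using t by (simp add: ennreal_power)
    also have "\<dots> = (\<Prod>i\<in>I. ennreal t * emeasure lborel ((\<lambda>x. c i + t * x) -` B i))"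
      by (simp add: prod.distrib)
    also have "\<dots> = (\<Prod>i\<in>I. emeasure lborel (B i))"
      using one B by (intro prod.cong) auto
    finally show "emeasure (scale_measure (ennreal (t ^ card I)) (distr (PiM I (\<lambda>_. lborel)) (PiM I (\<lambda>_. lborel)) \<phi>)) (Pi\<^sub>E I B)
      = (\<Prod>i\<in>I. emeasure lborel (B i))" by (simp add: M_def)
  qed simp
  hence "emeasure M A = emeasure (scale_measure (ennreal (t ^ card I)) (distr M M \<phi>)) A" by simp
  also have "\<dots> = ennreal (t ^ card I) * emeasure (distr M M \<phi>) A" by simp
  also have "emeasure (distr M M \<phi>) A = emeasure M (\<phi> -` A \<inter> space M)"
    using A m by (subst emeasure_distr) (simp_all add: M_def)
  finally show "emeasure (PiM I (\<lambda>_. lborel)) A = ennreal (t ^ card I) *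
      emeasure (PiM I (\<lambda>_. lborel)) ((\<lambda>w. \<lambda>i\<in>I. c i + t * w i) -` A \<inter> space (PiM I (\<lambda>_. lborel)))"
    by (simp add: M_def \<phi>_def)
qed

lemma emeasure_PiM_lborel_cube:
  fixes c :: "'i \<Rightarrow> real"
  assumes I: "finite I" and r: "r \<ge> 0"
  shows "{w \<in> I \<rightarrow>\<^sub>E UNIV. \<forall>i\<in>I. \<bar>w i - c i\<bar> \<le> r} \<in> sets (PiM I (\<lambda>_. lborel))"
    and "emeasure (PiM I (\<lambda>_. lborel)) {w \<in> I \<rightarrow>\<^sub>E UNIV. \<forall>i\<in>I. \<bar>w i - c i\<bar> \<le> r} = ennreal ((2 * r) ^ card I)"
proof -
  interpret product_sigma_finite "\<lambda>_. lborel :: real measure" by standard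
  have eq: "{w \<in> I \<rightarrow>\<^sub>E UNIV. \<forall>i\<in>I. \<bar>w i - c i\<bar> \<le> r} = Pi\<^sub>E I (\<lambda>i. {c i - r..c i + r})"
    by (rule Set.set_eqI) (auto simp: PiE_iff abs_le_iff)
  show "{w \<in> I \<rightarrow>\<^sub>E UNIV. \<forall>i\<in>I. \<bar>w i - c i\<bar> \<le> r} \<in> sets (PiM I (\<lambda>_. lborel))"
    unfolding eq using I by (intro sets_PiM_I_finite) auto
  show "emeasure (PiM I (\<lambda>_. lborel)) {w \<in> I \<rightarrow>\<^sub>E UNIV. \<forall>i\<in>I. \<bar>w i - c i\<bar> \<le> r} = ennreal ((2 * r) ^ card I)"
    unfolding eq using I r by (subst emeasure_PiM) (auto simp: ennreal_power)
qed

text \<open>A substitute for polar coordinates. For each fixed \<open>t\<close> in [1, 2] the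
  dilation by \<open>t\<close> about \<open>y0\<close> has Jacobian at most 2 ^ card I, and since t
  \<ge> 1 the directions that hit \<open>Z\<close> stay in the cube \<open>Q\<close>. So the measure
  of \<open>Z\<close> is at most 2 ^ card I times the integral of \<open>F t\<close> for every such
  \<open>t\<close>; averaging over \<open>t\<close> and exchanging the integrals leaves the
  one-dimensional measures on rays.\<close>

lemma emeasure_le_of_rays:
  fixes y0 :: "'i \<Rightarrow> real"
  assumes I: "finite I" and Z: "Z \<in> sets (PiM I (\<lambda>_. lborel))" and r: "r \<ge> 0"
    and Zr: "\<And>y. y \<in> Z \<Longrightarrow> \<forall>i\<in>I. \<bar>y i - y0 i\<bar> \<le> r"
    and ray: "\<And>w. w \<in> I \<rightarrow>\<^sub>E UNIV \<Longrightarrow> \<forall>i\<in>I. \<bar>w i\<bar> \<le> r \<Longrightarrow>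
       emeasure lborel {t\<in>{1..2}. (\<lambda>i\<in>I. y0 i + t * w i) \<in> Z} \<le> ennreal \<kappa>"
    and \<kappa>: "\<kappa> \<ge> 0"
  shows "emeasure (PiM I (\<lambda>_. lborel)) Z \<le> ennreal (\<kappa> * (4 * r) ^ card I)"
proof -
  define M where "M = PiM I (\<lambda>_. lborel :: real measure)"
  define Q where "Q = {w \<in> I \<rightarrow>\<^sub>E UNIV. \<forall>i\<in>I. \<bar>w i - 0\<bar> \<le> r}"
  have Qs[measurable]: "Q \<in> sets M" and Qm: "emeasure M Q = ennreal ((2 * r) ^ card I)"
    unfolding Q_def M_def using emeasure_PiM_lborel_cube[OF I r, of "\<lambda>_. 0"] by auto
  have Z'[measurable]: "Z \<in> sets M" using Z by (simp add: M_def)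
  interpret product_sigma_finite "\<lambda>_. lborel :: real measure" by standard
  interpret M: sigma_finite_measure M unfolding M_def by (rule sigma_finite[OF I])
  interpret P: pair_sigma_finite lborel M ..
  define \<phi> where "\<phi> = (\<lambda>t w. \<lambda>i\<in>I. y0 i + t * w i :: real)"
  have \<phi>m[measurable]: "(\<lambda>(t, w). \<phi> t w) \<in> lborel \<Otimes>\<^sub>M M \<rightarrow>\<^sub>M M"
    unfolding \<phi>_def M_def case_prod_beta by measurable
  define F where "F = (\<lambda>t w. indicator {1..2} t * (indicator Q w * indicator Z (\<phi> t w)) :: ennreal)"
  have Fm[measurable]: "(\<lambda>(t, w). F t w) \<in> borel_measurable (lborel \<Otimes>\<^sub>M M)"
    unfolding F_def by measurable
  have lower: "ennreal ((1/2) ^ card I) * emeasure M Z \<le> (\<integral>\<^sup>+w. F t w \<partial>M)" if t: "t \<in> {1..2}" for t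
  proof -
    have t0: "t > 0" using t by auto
    have \<phi>t: "\<phi> t \<in> M \<rightarrow>\<^sub>M M" using emeasure_PiM_lborel_affine(1)[OF I t0 Z] by (simp add: \<phi>_def M_def)
    define B where "B = \<phi> t -` Z \<inter> space M"
    have Bm: "B \<in> sets M" unfolding B_def using \<phi>t Z' by (rule measurable_sets)
    have "emeasure M Z = ennreal (t ^ card I) * emeasure M B"
      using emeasure_PiM_lborel_affine(2)[OF I t0 Z] by (simp add: B_def \<phi>_def M_def)
    hence "ennreal ((1/2) ^ card I) * emeasure M Z = ennreal ((1/2) ^ card I * t ^ card I) * emeasure M B"
      using t0 by (simp add: ennreal_mult mult.assoc)
    also have "\<dots> \<le> ennreal 1 * emeasure M B"
    proof (intro mult_right_mono ennreal_leI)
      have "(1/2) ^ card I * t ^ card I = (t / 2) ^ card I" by (simp add: power_divide)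
      also have "\<dots> \<le> 1" using t by (intro power_le_one) auto
      finally show "(1/2) ^ card I * t ^ card I \<le> 1" .
    qed auto
    also have "\<dots> = (\<integral>\<^sup>+w. indicator B w \<partial>M)" using Bm by simp
    also have "\<dots> \<le> (\<integral>\<^sup>+w. F t w \<partial>M)"
    proof (intro nn_integral_mono)
      fix w assume w: "w \<in> space M"
      show "indicator B w \<le> F t w"
      proof (cases "w \<in> B")
        case True
        hence wZ: "\<phi> t w \<in> Z" by (simp add: B_def)
        have "\<bar>w i\<bar> \<le> r" if "i \<in> I" for i
        proof -
          have "\<bar>\<phi> t w i - y0 i\<bar> \<le> r" using Zr[OF wZ] that by auto
          hence "t * \<bar>w i\<bar> \<le> r" using that t0 by (simp add: \<phi>_def abs_mult)
          moreover have "1 * \<bar>w i\<bar> \<le> t * \<bar>w i\<bar>" using t by (intro mult_right_mono) auto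
          ultimately show ?thesis by simp
        qed
        hence "w \<in> Q" using w by (auto simp: Q_def M_def space_PiM)
        thus ?thesis using wZ t by (simp add: F_def indicator_def)
      qed simp
    qed
    finally show ?thesis .
  qed
  have "ennreal ((1/2) ^ card I) * emeasure M Z
      = (\<integral>\<^sup>+t. ennreal ((1/2) ^ card I) * emeasure M Z * indicator {1..2::real} t \<partial>lborel)"
    by (subst nn_integral_cmult_indicator) auto
  also have "\<dots> \<le> (\<integral>\<^sup>+t. (\<integral>\<^sup>+w. F t w \<partial>M) \<partial>lborel)"
    using lower by (intro nn_integral_mono) (auto simp: indicator_def)
  also have "\<dots> = (\<integral>\<^sup>+w. (\<integral>\<^sup>+t. F t w \<partial>lborel) \<partial>M)"
    by (rule P.Fubini'[symmetric]) (rule Fm)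
  also have "\<dots> \<le> (\<integral>\<^sup>+w. ennreal \<kappa> * indicator Q w \<partial>M)"
  proof (intro nn_integral_mono)
    fix w assume w: "w \<in> space M"
    show "(\<integral>\<^sup>+t. F t w \<partial>lborel) \<le> ennreal \<kappa> * indicator Q w"
    proof (cases "w \<in> Q")
      case False thus ?thesis by (simp add: F_def)
    next
      case True
      have "(\<lambda>t. \<phi> t w) \<in> lborel \<rightarrow>\<^sub>M M"
        using measurable_compose[OF measurable_Pair2'[OF w] \<phi>m] by simp
      hence "{t\<in>space lborel. \<phi> t w \<in> Z} \<in> sets lborel" by measurable
      hence m: "{t\<in>{1..2}. \<phi> t w \<in> Z} \<in> sets lborel"
        using sets.Int[of "{1..2}" lborel "{t\<in>space lborel. \<phi> t w \<in> Z}"]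
        by (simp add: Int_def)
      have "(\<integral>\<^sup>+t. F t w \<partial>lborel) = (\<integral>\<^sup>+t. indicator {t\<in>{1..2}. \<phi> t w \<in> Z} t \<partial>lborel)"
        using True by (intro nn_integral_cong) (auto simp: F_def indicator_def)
      also have "\<dots> = emeasure lborel {t\<in>{1..2}. \<phi> t w \<in> Z}"
        by (rule nn_integral_indicator[OF m])
      also have "\<dots> \<le> ennreal \<kappa>"
        using ray[of w] True by (auto simp: Q_def \<phi>_def)
      finally show ?thesis using True by simp
    qed
  qed
  also have "\<dots> = ennreal \<kappa> * ennreal ((2 * r) ^ card I)"
    by (subst nn_integral_cmult_indicator) (auto simp: Qm)
  finally have *: "ennreal ((1/2) ^ card I) * emeasure M Z \<le> ennreal (\<kappa> * (2 * r) ^ card I)"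
    using \<kappa> r by (subst ennreal_mult) auto
  have "emeasure M Z = ennreal (2 ^ card I) * (ennreal ((1/2) ^ card I) * emeasure M Z)"
    unfolding mult.assoc[symmetric] ennreal_mult[symmetric]
    by (subst ennreal_mult[symmetric]) (auto simp flip: power_mult_distrib)
  also have "\<dots> \<le> ennreal (2 ^ card I) * ennreal (\<kappa> * (2 * r) ^ card I)"
    by (intro mult_left_mono *) auto
  also have "\<dots> = ennreal (2 ^ card I * (\<kappa> * (2 * r) ^ card I))"
    by (subst ennreal_mult) (use \<kappa> r in auto)
  also have "2 ^ card I * (\<kappa> * (2 * r) ^ card I) = \<kappa> * (4 * r) ^ card I"
    using power_mult_distrib[of 2 "2 * r" "card I"] by auto
  finally show ?thesis by (simp add: M_def)
qed

section \<open>Matrices indexed by finite sets\<close>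

text \<open>On a finite set this means invertibility with an inverse of norm at most \<beta> from
  sup norm to sup norm; injectivity is the case \<open>c = 0\<close>. The form is convenient because
  it survives perturbation and patching without an inverse being named.\<close>

definition bounded_below_on :: "'a set \<Rightarrow> ('a \<Rightarrow> 'a \<Rightarrow> complex) \<Rightarrow> real \<Rightarrow> bool" where
  "bounded_below_on L A \<beta> \<longleftrightarrow> (\<forall>u c. (\<forall>n\<in>L. cmod (\<Sum>m\<in>L. A n m * u m) \<le> c) \<longrightarrow> (\<forall>k\<in>L. cmod (u k) \<le> \<beta> * c))"

text \<open>Transports matrices indexed by lattice points to matrices indexed by numbers, for which
  determinant and adjugate exist. The enumeration depends on \<open>L\<close> alone, so determinants
  of a family of matrices are one fixed polynomial in the entries.\<close>

definition enum_of :: "'a set \<Rightarrow> nat \<Rightarrow> 'a" where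
  "enum_of L = (SOME f. bij_betw f {0..<card L} L)"

definition index_of :: "'a set \<Rightarrow> 'a \<Rightarrow> nat" where
  "index_of L = inv_into {0..<card L} (enum_of L)"

definition mat_on :: "'a set \<Rightarrow> ('a \<Rightarrow> 'a \<Rightarrow> 'b) \<Rightarrow> 'b Matrix.mat" where
  "mat_on L A = Matrix.mat (card L) (card L) (\<lambda>(i, j). A (enum_of L i) (enum_of L j))"

definition det_on :: "'a set \<Rightarrow> ('a \<Rightarrow> 'a \<Rightarrow> 'b::comm_ring_1) \<Rightarrow> 'b" where
  "det_on L A = Determinant.det (mat_on L A)"

definition adj_on :: "'a set \<Rightarrow> ('a \<Rightarrow> 'a \<Rightarrow> 'b::comm_ring_1) \<Rightarrow> 'a \<Rightarrow> 'a \<Rightarrow> 'b" where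
  "adj_on L A n n' = index_mat (adj_mat (mat_on L A)) (index_of L n, index_of L n')"

lemma enum_of_bij: "finite L \<Longrightarrow> bij_betw (enum_of L) {0..<card L} L"
  unfolding enum_of_def by (rule someI_ex[of "\<lambda>f. bij_betw f _ _"]) (rule ex_bij_betw_nat_finite)

lemma enum_of_in: "finite L \<Longrightarrow> i < card L \<Longrightarrow> enum_of L i \<in> L"
  using enum_of_bij[of L] by (auto simp: bij_betw_def)

lemma index_of_less: "finite L \<Longrightarrow> n \<in> L \<Longrightarrow> index_of L n < card L"
  using enum_of_bij[of L] inv_into_into[of n "enum_of L" "{0..<card L}"]
  by (auto simp: bij_betw_def index_of_def)

lemma enum_of_index_of: "finite L \<Longrightarrow> n \<in> L \<Longrightarrow> enum_of L (index_of L n) = n"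
  using enum_of_bij[of L] by (auto simp: bij_betw_def index_of_def f_inv_into_f)

lemma index_of_eq_iff: "finite L \<Longrightarrow> n \<in> L \<Longrightarrow> n' \<in> L \<Longrightarrow> index_of L n = index_of L n' \<longleftrightarrow> n = n'"
  by (metis enum_of_index_of)

lemma sum_enum_of: "finite L \<Longrightarrow> (\<Sum>i\<in>{0..<card L}. f (enum_of L i)) = (\<Sum>n\<in>L. f n)"
  using sum.reindex_bij_betw[OF enum_of_bij] by metis

lemma mat_on_carrier: "mat_on L A \<in> carrier_mat (card L) (card L)"
  by (simp add: mat_on_def)

lemma mat_on_index: "finite L \<Longrightarrow> n \<in> L \<Longrightarrow> n' \<in> L \<Longrightarrow>
    index_mat (mat_on L A) (index_of L n, index_of L n') = A n n'"
  by (simp add: mat_on_def index_of_less enum_of_index_of)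

lemma mat_on_mult:
  assumes "finite L"
  shows "mat_on L A * mat_on L B = mat_on L (\<lambda>n m. \<Sum>k\<in>L. A n k * B k m)"
  by (rule eq_matI) (auto simp: mat_on_def scalar_prod_def simp flip: sum_enum_of[OF assms])

lemma mat_on_one:
  assumes "finite L"
  shows "mat_on L (\<lambda>n m. if n = m then 1 else 0) = 1\<^sub>m (card L)"
proof -
  have "enum_of L i = enum_of L j \<longleftrightarrow> i = j" if "i < card L" "j < card L" for i j
    using enum_of_bij[OF assms] that by (auto simp: bij_betw_def inj_on_def)
  thus ?thesis by (intro eq_matI) (auto simp: mat_on_def)
qed

lemma det_on_inverse:
  assumes "finite L" "is_inverse_on L A B"
  shows "det_on L A * det_on L B = 1"
proof -
  have "mat_on L A * mat_on L B = mat_on L (\<lambda>n m. if n = m then 1 else 0)"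
    unfolding mat_on_mult[OF assms(1)]
    using assms enum_of_in[OF assms(1)] by (intro eq_matI) (auto simp: mat_on_def is_inverse_on_def)
  hence "Determinant.det (mat_on L A * mat_on L B) = 1"
    by (simp add: mat_on_one[OF assms(1)])
  thus ?thesis unfolding det_on_def
    by (subst Determinant.det_mult[OF mat_on_carrier mat_on_carrier, symmetric])
qed

lemma sum_index_of:
  assumes "finite L"
  shows "(\<Sum>k\<in>L. f (index_of L k)) = (\<Sum>k\<in>{0..<card L}. f k)"
  using sum.reindex_bij_betw[OF bij_betw_inv_into[OF enum_of_bij[OF assms]], of f] by (simp add: index_of_def)

lemma index_mat_mult_eq_sum:
  assumes "finite L" "n \<in> L" "n' \<in> L" "X \<in> carrier_mat (card L) (card L)" "Y \<in> carrier_mat (card L) (card L)"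
  shows "index_mat (X * Y) (index_of L n, index_of L n')
    = (\<Sum>k\<in>L. index_mat X (index_of L n, index_of L k) * index_mat Y (index_of L k, index_of L n'))"
  using assms index_of_less[OF assms(1,2)] index_of_less[OF assms(1,3)]
  by (subst sum_index_of) (auto simp: scalar_prod_def)

lemma adj_on_mult:
  assumes L: "finite L" and n: "n \<in> L" "n' \<in> L"
  shows "(\<Sum>k\<in>L. A n k * adj_on L A k n') = (if n = n' then det_on L A else 0)"
    and "(\<Sum>k\<in>L. adj_on L A n k * A k n') = (if n = n' then det_on L A else 0)"
proof -
  note c = mat_on_carrier[of L A]
  note a = adj_mat[OF c]
  have i: "index_of L n < card L" "index_of L n' < card L" using n L by (auto simp: index_of_less)
  have rhs: "index_mat (Determinant.det (mat_on L A) \<cdot>\<^sub>m 1\<^sub>m (card L)) (index_of L n, index_of L n')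
      = (if n = n' then det_on L A else 0)"
    using i n L by (auto simp: det_on_def index_of_eq_iff)
  show "(\<Sum>k\<in>L. A n k * adj_on L A k n') = (if n = n' then det_on L A else 0)"
    using index_mat_mult_eq_sum[OF L n c a(1)] n L unfolding a(2) rhs by (simp add: adj_on_def mat_on_index)
  show "(\<Sum>k\<in>L. adj_on L A n k * A k n') = (if n = n' then det_on L A else 0)"
    using index_mat_mult_eq_sum[OF L n a(1) c] n L unfolding a(3) rhs by (simp add: adj_on_def mat_on_index)
qed

lemma is_inverse_on_adj:
  assumes L: "finite L" and nz: "det_on L A \<noteq> 0"
  shows "is_inverse_on L A (\<lambda>n n'. adj_on L A n n' / det_on L A)"
  unfolding is_inverse_on_def
  using adj_on_mult[OF L, of _ _ A] nz by (simp add: sum_divide_distrib[symmetric])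

text \<open>A vanishing determinant yields a nonzero kernel vector, which the lower bound with
  \<open>c = 0\<close> excludes.\<close>

lemma bounded_below_on_det:
  assumes L: "finite L" and b: "bounded_below_on L A \<beta>"
  shows "det_on L A \<noteq> 0"
proof
  assume "det_on L A = 0"
  then obtain w where w: "w \<in> carrier_vec (card L)" "w \<noteq> 0\<^sub>v (card L)" "mat_on L A *\<^sub>v w = 0\<^sub>v (card L)"
    unfolding det_on_def using det_0_iff_vec_prod_zero[OF mat_on_carrier] by blast
  define u where "u = (\<lambda>n. vec_index w (index_of L n))"
  have "(\<Sum>m\<in>L. A n m * u m) = 0" if n: "n \<in> L" for n
  proof -
    have "(\<Sum>m\<in>L. A n m * u m) = (\<Sum>m\<in>L. index_mat (mat_on L A) (index_of L n, index_of L m) * vec_index w (index_of L m))"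
      using n L by (intro sum.cong) (auto simp: u_def mat_on_index)
    also have "\<dots> = (\<Sum>m\<in>{0..<card L}. index_mat (mat_on L A) (index_of L n, m) * vec_index w m)"
      by (rule sum_index_of[OF L])
    also have "\<dots> = vec_index (mat_on L A *\<^sub>v w) (index_of L n)"
      using index_of_less[OF L n] w(1) mat_on_carrier[of L A] by (auto simp: scalar_prod_def)
    also have "\<dots> = 0" unfolding w(3) using index_of_less[OF L n] by simp
    finally show ?thesis .
  qed
  hence u0: "u k = 0" if "k \<in> L" for k
    using b[unfolded bounded_below_on_def, rule_format, of u 0 k] that by auto
  have "w = 0\<^sub>v (card L)"
  proof (rule eq_vecI)
    fix i assume i: "i < dim_vec (0\<^sub>v (card L))"
    have "index_of L (enum_of L i) = i"
      using enum_of_bij[OF L] i unfolding index_of_def by (intro inv_into_f_f) (auto simp: bij_betw_def)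
    thus "vec_index w i = vec_index (0\<^sub>v (card L)) i"
      using u0[OF enum_of_in[OF L, of i]] i by (simp add: u_def)
  qed (use w in simp)
  with w show False by simp
qed

lemma bounded_below_on_invertible:
  "finite L \<Longrightarrow> bounded_below_on L A \<beta> \<Longrightarrow> invertible_on L A"
  unfolding invertible_on_def using is_inverse_on_adj bounded_below_on_det by metis

section \<open>Regularity and size of determinants and adjugates\<close>

text \<open>The Leibniz formula is a polynomial in the entries, so every class of functions that
  contains the constants and is closed under sums and products passes to the determinant. The class
  is abstract because both measurability and holomorphy are obtained this way.\<close>

lemma det_closure:
  assumes const: "\<And>c. P (\<lambda>_. c)" and add: "\<And>f g. P f \<Longrightarrow> P g \<Longrightarrow> P (\<lambda>t. f t + g t)"
    and mult: "\<And>f g. P f \<Longrightarrow> P g \<Longrightarrow> P (\<lambda>t. f t * g t)"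
    and ent: "\<And>i j. i < n \<Longrightarrow> j < n \<Longrightarrow> P (\<lambda>t. F t i j)"
  shows "P (\<lambda>t. Determinant.det (Matrix.mat n n (\<lambda>(i, j). F t i j)) :: 'b::comm_ring_1)"
proof -
  have sum: "P (\<lambda>t. \<Sum>x\<in>X. f x t)" if "finite X" "\<And>x. x \<in> X \<Longrightarrow> P (f x)" for X and f :: "_ \<Rightarrow> _ \<Rightarrow> 'b"
    using that
  proof (induction X rule: finite_induct)
    case empty thus ?case using const[of 0] by simp
  next
    case (insert x X)
    have "P (\<lambda>t. f x t + (\<Sum> x\<in>X. f x t))" by (rule add) (use insert in auto)
    thus ?case using insert.hyps by simp
  qed
  have prod: "P (\<lambda>t. \<Prod>x\<in>X. f x t)" if "finite X" "\<And>x. x \<in> X \<Longrightarrow> P (f x)" for X and f :: "_ \<Rightarrow> _ \<Rightarrow> 'b"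
    using that
  proof (induction X rule: finite_induct)
    case empty thus ?case using const[of 1] by simp
  next
    case (insert x X)
    have "P (\<lambda>t. f x t * (\<Prod> x\<in>X. f x t))" by (rule mult) (use insert in auto)
    thus ?case using insert.hyps by simp
  qed
  have eq: "Determinant.det (Matrix.mat n n (\<lambda>(i, j). F t i j))
      = (\<Sum>p\<in>{p. p permutes {0..<n}}. signof p * (\<Prod>i\<in>{0..<n}. F t i (p i)))" for t
    by (subst det_def') (auto intro!: sum.cong prod.cong simp: permutes_in_image)
  show ?thesis unfolding eq
  proof (rule sum)
    fix p assume p: "p \<in> {p. p permutes {0..<n}}"
    show "P (\<lambda>t. signof p * (\<Prod>i\<in>{0..<n}. F t i (p i)))"
      by (rule mult[OF const prod]) (use p in \<open>auto intro!: ent simp: permutes_in_image\<close>)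
  qed (simp add: finite_permutations)
qed

lemma det_on_closure:
  assumes L: "finite L" and const: "\<And>c. P (\<lambda>_. c)" and add: "\<And>f g. P f \<Longrightarrow> P g \<Longrightarrow> P (\<lambda>t. f t + g t)"
    and mult: "\<And>f g. P f \<Longrightarrow> P g \<Longrightarrow> P (\<lambda>t. f t * g t)"
    and ent: "\<And>n m. n \<in> L \<Longrightarrow> m \<in> L \<Longrightarrow> P (\<lambda>t. A t n m)"
  shows "P (\<lambda>t. det_on L (A t) :: 'b::comm_ring_1)"
  unfolding det_on_def mat_on_def
  by (rule det_closure[OF const add mult]) (auto intro: ent enum_of_in[OF L])

lemma adj_on_closure:
  assumes L: "finite L" and const: "\<And>c. P (\<lambda>_. c)" and add: "\<And>f g. P f \<Longrightarrow> P g \<Longrightarrow> P (\<lambda>t. f t + g t)"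
    and mult: "\<And>f g. P f \<Longrightarrow> P g \<Longrightarrow> P (\<lambda>t. f t * g t)"
    and ent: "\<And>n m. n \<in> L \<Longrightarrow> m \<in> L \<Longrightarrow> P (\<lambda>t. A t n m)"
    and nm: "n \<in> L" "m \<in> L"
  shows "P (\<lambda>t. adj_on L (A t) n m :: 'b::comm_ring_1)"
proof -
  define i j where "i = index_of L n" and "j = index_of L m"
  have ij: "i < card L" "j < card L" using index_of_less[OF L] nm by (auto simp: i_def j_def)
  have md: "mat_delete (mat_on L (A t)) j i = Matrix.mat (card L - 1) (card L - 1) (\<lambda>(i', j'). A t
        (enum_of L (if i' < j then i' else Suc i')) (enum_of L (if j' < i then j' else Suc j')))" for t
    by (rule eq_matI) (auto simp: mat_on_def mat_delete_def)
  have eq: "adj_on L (A t) n m = (-1) ^ (j + i) *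
     Determinant.det (Matrix.mat (card L - 1) (card L - 1) (\<lambda>(i', j'). A t
        (enum_of L (if i' < j then i' else Suc i')) (enum_of L (if j' < i then j' else Suc j'))))" for t
    using ij mat_on_carrier[of L "A t"] unfolding adj_on_def i_def[symmetric] j_def[symmetric]
    by (simp add: adj_mat_def cofactor_def md)
  show ?thesis unfolding eq
    by (rule mult[OF const det_closure[where P = P, OF const add mult]])
       (auto intro!: ent enum_of_in[OF L])
qed

lemma cmod_det_le:
  assumes A: "A \<in> carrier_mat n n" and c: "\<And>i j. i < n \<Longrightarrow> j < n \<Longrightarrow> cmod (index_mat A (i, j)) \<le> c"
  shows "cmod (Determinant.det A) \<le> fact n * c ^ n"
proof -
  have "cmod (Determinant.det A) \<le> (\<Sum>p\<in>{p. p permutes {0..<n}}. cmod (signof p * (\<Prod>i\<in>{0..<n}. index_mat A (i, p i))))"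
    unfolding det_def'[OF A] by (rule norm_sum)
  also have "\<dots> \<le> (\<Sum>p\<in>{p. p permutes {0..<n}}. c ^ n)"
  proof (intro sum_mono)
    fix p assume p: "p \<in> {p. p permutes {0..<n}}"
    have "cmod (signof p * (\<Prod>i\<in>{0..<n}. index_mat A (i, p i))) = (\<Prod>i\<in>{0..<n}. cmod (index_mat A (i, p i)))"
      by (simp add: norm_mult prod_norm sign_def)
    also have "\<dots> \<le> (\<Prod>i\<in>{0..<n}. c)"
      using p by (intro prod_mono conjI c) (auto simp: permutes_in_image)
    finally show "cmod (signof p * (\<Prod>i\<in>{0..<n}. index_mat A (i, p i))) \<le> c ^ n" by simp
  qed
  also have "\<dots> = fact n * c ^ n"
    by (simp add: card_permutations[of "{0..<n}" n])
  finally show ?thesis .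
qed

lemma cmod_det_on_le:
  assumes L: "finite L" and c: "\<And>n m. n \<in> L \<Longrightarrow> m \<in> L \<Longrightarrow> cmod (A n m) \<le> c"
  shows "cmod (det_on L A) \<le> fact (card L) * c ^ card L"
  unfolding det_on_def
  by (rule cmod_det_le[OF mat_on_carrier]) (auto simp: mat_on_def intro!: c enum_of_in[OF L])

text \<open>The minors have size \<open>card L - 1\<close>; with c \<ge> 1 their bound is relaxed to
  the one for the full determinant, so that a single constant controls both.\<close>

lemma cmod_adj_on_le:
  assumes L: "finite L" and c: "\<And>n m. n \<in> L \<Longrightarrow> m \<in> L \<Longrightarrow> cmod (A n m) \<le> c" and c1: "c \<ge> 1"
    and nm: "n \<in> L" "m \<in> L"
  shows "cmod (adj_on L A n m) \<le> fact (card L) * c ^ card L"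
proof -
  define i j where "i = index_of L n" and "j = index_of L m"
  have ij: "i < card L" "j < card L" using index_of_less[OF L] nm by (auto simp: i_def j_def)
  have "cmod (adj_on L A n m) = cmod (Determinant.det (mat_delete (mat_on L A) j i))"
    using ij unfolding adj_on_def i_def[symmetric] j_def[symmetric]
    by (simp add: adj_mat_def cofactor_def mat_on_def norm_mult norm_power)
  also have "\<dots> \<le> fact (card L - 1) * c ^ (card L - 1)"
    by (rule cmod_det_le[OF mat_delete_carrier[OF mat_on_carrier]])
      (auto simp: mat_delete_def mat_on_def intro!: c enum_of_in[OF L])
  also have "\<dots> \<le> fact (card L) * c ^ card L"
    using c1 by (intro mult_mono fact_mono power_increasing) auto
  finally show ?thesis .
qed

section \<open>Inverses, operator norms and sup-norm lower bounds\<close>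

lemma sum_delta_mult:
  fixes f :: "'a \<Rightarrow> complex"
  assumes "finite L" "n \<in> L"
  shows "(\<Sum>m\<in>L. (if n = m then 1 else 0) * f m) = f n"
proof -
  have "(\<Sum>m\<in>L. (if n = m then 1 else 0) * f m) = (\<Sum>m\<in>L. if n = m then f m else 0)"
    by (intro sum.cong) auto
  thus ?thesis using assms by simp
qed

lemma is_inverse_on_apply:
  assumes L: "finite L" and inv: "is_inverse_on L A B" and n: "n \<in> L"
  shows "(\<Sum>k\<in>L. A n k * (\<Sum>m\<in>L. B k m * u m)) = u n"
    and "(\<Sum>k\<in>L. B n k * (\<Sum>m\<in>L. A k m * u m)) = u n"
proof -
  have gen: "(\<Sum>k\<in>L. X n k * (\<Sum>m\<in>L. Y k m * u m)) = (\<Sum>m\<in>L. (\<Sum>k\<in>L. X n k * Y k m) * u m)"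
    for X Y :: "'a \<Rightarrow> 'a \<Rightarrow> complex"
    unfolding sum_distrib_left sum_distrib_right by (subst sum.swap) (simp add: mult.assoc)
  have "(\<Sum>m\<in>L. (\<Sum>k\<in>L. A n k * B k m) * u m) = (\<Sum>m\<in>L. (if n = m then 1 else 0) * u m)"
    using inv n by (intro sum.cong) (auto simp: is_inverse_on_def)
  thus "(\<Sum>k\<in>L. A n k * (\<Sum>m\<in>L. B k m * u m)) = u n"
    unfolding gen using sum_delta_mult[OF L n] by simp
  have "(\<Sum>m\<in>L. (\<Sum>k\<in>L. B n k * A k m) * u m) = (\<Sum>m\<in>L. (if n = m then 1 else 0) * u m)"
    using inv n by (intro sum.cong) (auto simp: is_inverse_on_def)
  thus "(\<Sum>k\<in>L. B n k * (\<Sum>m\<in>L. A k m * u m)) = u n"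
    unfolding gen using sum_delta_mult[OF L n] by simp
qed

lemma is_inverse_on_inv_on: "invertible_on L A \<Longrightarrow> is_inverse_on L A (inv_on L A)"
proof -
  assume "invertible_on L A"
  hence "is_inverse_on L A (SOME B. is_inverse_on L A B)"
    unfolding invertible_on_def by (rule someI_ex)
  thus ?thesis unfolding is_inverse_on_def inv_on_def Let_def by simp
qed

lemma bounded_below_onD:
  "bounded_below_on L A \<beta> \<Longrightarrow> (\<And>n. n \<in> L \<Longrightarrow> cmod (\<Sum>m\<in>L. A n m * u m) \<le> c) \<Longrightarrow> k \<in> L \<Longrightarrow> cmod (u k) \<le> \<beta> * c"
  unfolding bounded_below_on_def by blast

lemma bounded_below_on_inverse_entry:
  assumes L: "finite L" and inv: "is_inverse_on L A B" and b: "bounded_below_on L A \<beta>"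
    and nm: "n \<in> L" "m \<in> L"
  shows "cmod (B n m) \<le> \<beta>"
proof -
  have "cmod (\<Sum>k\<in>L. A n' k * B k m) \<le> 1" if "n' \<in> L" for n'
    using inv that nm by (simp add: is_inverse_on_def)
  from bounded_below_onD[OF b this nm(1)] show ?thesis by simp
qed

lemma bounded_below_on_of_inverse:
  fixes b :: real
  assumes L: "finite L" and inv: "is_inverse_on L A B"
    and bd: "\<And>n m. n \<in> L \<Longrightarrow> m \<in> L \<Longrightarrow> cmod (B n m) \<le> b"
  shows "bounded_below_on L A (card L * b)"
  unfolding bounded_below_on_def
proof (intro allI impI ballI)
  fix u c k assume h: "\<forall>n\<in>L. cmod (\<Sum>m\<in>L. A n m * u m) \<le> c" and k: "k \<in> L"
  have "u k = (\<Sum>n\<in>L. B k n * (\<Sum>m\<in>L. A n m * u m))"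
    using is_inverse_on_apply(2)[OF L inv k] by simp
  also have "cmod \<dots> \<le> (\<Sum>n\<in>L. b * c)"
  proof (rule sum_norm_le)
    fix n assume n: "n \<in> L"
    have "0 \<le> b" using bd[OF k n] norm_ge_zero order_trans by blast
    thus "cmod (B k n * (\<Sum>m\<in>L. A n m * u m)) \<le> b * c"
      unfolding norm_mult using bd[OF k n] h n by (intro mult_mono) auto
  qed
  finally show "cmod (u k) \<le> card L * b * c" by simp
qed

lemma cmod_le_one_of_sum_squares:
  assumes "finite L" "n \<in> L" "(\<Sum>k\<in>L. (cmod (u k))\<^sup>2) \<le> 1"
  shows "cmod (u n) \<le> 1"
proof -
  have "(cmod (u n))\<^sup>2 \<le> (\<Sum>k\<in>L. (cmod (u k))\<^sup>2)"
    using assms member_le_sum[of n L "\<lambda>k. (cmod (u k))\<^sup>2"] by simp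
  also have "\<dots> \<le> 1\<^sup>2" using assms by simp
  finally show ?thesis by (rule power2_le_imp_le) simp
qed

lemma opnorm_on_inv_on_le:
  fixes \<beta> :: real
  assumes L: "finite L" and b: "bounded_below_on L A \<beta>" and \<beta>: "\<beta> \<ge> 0"
  shows "opnorm_on L (inv_on L A) \<le> card L * \<beta>"
  unfolding opnorm_on_def
proof (rule cSup_least)
  show "{sqrt (\<Sum>n\<in>L. (cmod (\<Sum>k\<in>L. inv_on L A n k * u k))\<^sup>2) |u. (\<Sum>k\<in>L. (cmod (u k))\<^sup>2) \<le> 1} \<noteq> {}"
    by (auto intro!: exI[of _ "\<lambda>_. 0"])
next
  fix x assume "x \<in> {sqrt (\<Sum>n\<in>L. (cmod (\<Sum>k\<in>L. inv_on L A n k * u k))\<^sup>2) |u. (\<Sum>k\<in>L. (cmod (u k))\<^sup>2) \<le> 1}"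
  then obtain u where x: "x = sqrt (\<Sum>n\<in>L. (cmod (\<Sum>k\<in>L. inv_on L A n k * u k))\<^sup>2)"
    and u: "(\<Sum>k\<in>L. (cmod (u k))\<^sup>2) \<le> 1" by auto
  define w where "w = (\<lambda>n. \<Sum>k\<in>L. inv_on L A n k * u k)"
  have inv: "is_inverse_on L A (inv_on L A)"
    using is_inverse_on_inv_on bounded_below_on_invertible L b by blast
  note u1 = cmod_le_one_of_sum_squares[OF L _ u]
  have "cmod (\<Sum>m\<in>L. A n m * w m) \<le> 1" if "n \<in> L" for n
    using is_inverse_on_apply(1)[OF L inv that, of u] u1[OF that] by (simp add: w_def)
  from bounded_below_onD[OF b this] have w: "cmod (w k) \<le> \<beta>" if "k \<in> L" for k using that by simp
  have "x \<le> (\<Sum>n\<in>L. cmod (w n))"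
    using L2_set_le_sum[of L "\<lambda>n. cmod (w n)"] by (simp add: x L2_set_def w_def)
  also have "\<dots> \<le> (\<Sum>n\<in>L. \<beta>)" using w by (intro sum_mono) auto
  finally show "x \<le> card L * \<beta>" by simp
qed

lemma cmod_entry_le_opnorm_on:
  assumes L: "finite L" and nm: "n \<in> L" "m \<in> L"
  shows "cmod (B n m) \<le> opnorm_on L B"
proof -
  define S where "S = {sqrt (\<Sum>n\<in>L. (cmod (\<Sum>k\<in>L. B n k * u k))\<^sup>2) |u. (\<Sum>k\<in>L. (cmod (u k))\<^sup>2) \<le> 1}"
  define u where "u = (\<lambda>k. if k = m then 1 else 0 :: complex)"
  have Bu: "(\<Sum>k\<in>L. B n' k * u k) = B n' m" for n'
    using L nm by (simp add: u_def if_distrib sum.delta cong: if_cong)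
  have "(\<Sum>k\<in>L. (cmod (u k))\<^sup>2) = (\<Sum>k\<in>L. if k = m then 1 else 0)"
    by (intro sum.cong) (auto simp: u_def)
  hence "(\<Sum>k\<in>L. (cmod (u k))\<^sup>2) \<le> 1" using L nm by simp
  hence 1: "sqrt (\<Sum>n'\<in>L. (cmod (B n' m))\<^sup>2) \<in> S"
    unfolding S_def mem_Collect_eq by (intro exI[of _ u]) (simp add: Bu)
  have "bdd_above S"
  proof (rule bdd_aboveI)
    fix x assume "x \<in> S"
    then obtain u where x: "x = sqrt (\<Sum>n\<in>L. (cmod (\<Sum>k\<in>L. B n k * u k))\<^sup>2)"
      and u: "(\<Sum>k\<in>L. (cmod (u k))\<^sup>2) \<le> 1" unfolding S_def by auto
    note u1 = cmod_le_one_of_sum_squares[OF L _ u]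
    have "x \<le> (\<Sum>n\<in>L. cmod (\<Sum>k\<in>L. B n k * u k))"
      unfolding x using L2_set_le_sum[of L "\<lambda>n. cmod (\<Sum>k\<in>L. B n k * u k)"] by (simp add: L2_set_def)
    also have "\<dots> \<le> (\<Sum>n\<in>L. \<Sum>k\<in>L. cmod (B n k) * 1)"
      using u1 by (intro sum_mono sum_norm_le) (auto simp: norm_mult intro!: mult_left_le)
    finally show "x \<le> (\<Sum>n\<in>L. \<Sum>k\<in>L. cmod (B n k) * 1)" .
  qed
  have "cmod (B n m) = sqrt ((cmod (B n m))\<^sup>2)" by simp
  also have "\<dots> \<le> sqrt (\<Sum>n'\<in>L. (cmod (B n' m))\<^sup>2)"
    using L nm by (intro real_sqrt_le_mono member_le_sum[of n L "\<lambda>n'. (cmod (B n' m))\<^sup>2"]) auto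
  also have "\<dots> \<le> Sup S" using 1 \<open>bdd_above S\<close> by (rule cSup_upper)
  finally show ?thesis by (simp add: opnorm_on_def S_def)
qed

text \<open>The hypothesis is available for every upper bound \<open>M\<close> of \<open>u\<close>,
  hence for the maximum itself, where it reads M \<le> a + M / 2. Finiteness of \<open>L\<close>
  ensures that the maximum is attained, so the second term can be absorbed.\<close>

lemma sup_absorb:
  fixes u :: "'a \<Rightarrow> complex"
  assumes L: "finite L" and h: "\<And>M k. (\<And>k. k \<in> L \<Longrightarrow> cmod (u k) \<le> M) \<Longrightarrow> k \<in> L \<Longrightarrow> cmod (u k) \<le> a + M / 2"
    and k: "k \<in> L"
  shows "cmod (u k) \<le> 2 * a"
proof -
  define M where "M = Max ((\<lambda>k. cmod (u k)) ` L)"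
  have M: "cmod (u k) \<le> M" if "k \<in> L" for k
    using that L by (auto simp: M_def)
  have "M \<in> (\<lambda>k. cmod (u k)) ` L" unfolding M_def using L k by (intro Max_in) auto
  then obtain l where "l \<in> L" "M = cmod (u l)" by auto
  with h[OF M, of l] have "M \<le> 2 * a" by auto
  thus ?thesis using M[OF k] by simp
qed

lemma bounded_below_on_perturb:
  assumes L: "finite L" and b: "bounded_below_on L A \<beta>" and \<beta>: "\<beta> \<ge> 0"
    and pert: "\<And>n. n \<in> L \<Longrightarrow> (\<Sum>m\<in>L. cmod (A' n m - A n m)) \<le> \<eta>" and \<eta>: "\<beta> * \<eta> \<le> 1/2"
  shows "bounded_below_on L A' (2 * \<beta>)"
  unfolding bounded_below_on_def
proof (intro allI impI ballI)
  fix u c k assume h: "\<forall>n\<in>L. cmod (\<Sum>m\<in>L. A' n m * u m) \<le> c" and k: "k \<in> L"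
  have "cmod (u k) \<le> \<beta> * c + M / 2" if M: "\<And>k. k \<in> L \<Longrightarrow> cmod (u k) \<le> M" and k: "k \<in> L" for M k
  proof -
    have M0: "M \<ge> 0" using M[OF k] norm_ge_zero order_trans by blast
    have "cmod (\<Sum>m\<in>L. A n m * u m) \<le> c + \<eta> * M" if n: "n \<in> L" for n
    proof -
      have "(\<Sum>m\<in>L. A n m * u m) = (\<Sum>m\<in>L. A' n m * u m) - (\<Sum>m\<in>L. (A' n m - A n m) * u m)"
        by (simp add: sum_subtractf[symmetric] algebra_simps)
      also have "cmod \<dots> \<le> cmod (\<Sum>m\<in>L. A' n m * u m) + cmod (\<Sum>m\<in>L. (A' n m - A n m) * u m)"
        by (rule norm_triangle_ineq4)
      also have "cmod (\<Sum>m\<in>L. (A' n m - A n m) * u m) \<le> (\<Sum>m\<in>L. cmod (A' n m - A n m) * M)"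
        using M by (intro sum_norm_le) (auto simp: norm_mult intro!: mult_left_mono)
      also have "\<dots> \<le> \<eta> * M"
        unfolding sum_distrib_right[symmetric] using pert[OF n] M0 by (rule mult_right_mono)
      finally show ?thesis using h n by force
    qed
    from bounded_below_onD[OF b this k] have "cmod (u k) \<le> \<beta> * c + (\<beta> * \<eta>) * M"
      by (simp add: algebra_simps)
    moreover have "(\<beta> * \<eta>) * M \<le> 1/2 * M" using \<eta> M0 by (rule mult_right_mono)
    ultimately show ?thesis by simp
  qed
  from sup_absorb[of L u "\<beta> * c" k, OF L this k] show "cmod (u k) \<le> 2 * \<beta> * c" by simp
qed

text \<open>On a window \<open>W\<close> the restricted equation is A_W u = A u - A_(W, U - W) u.
  Row \<open>k\<close> of the window inverse recovers \<open>u k\<close> from A u at cost \<beta>,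
  and from the values outside the window with total weight at most 1/2, which is absorbed.
  Invertibility on \<open>U\<close> is thus a consequence of invertibility on the windows.\<close>

lemma bounded_below_on_cover:
  assumes U: "finite U"
    and cov: "\<And>k. k \<in> U \<Longrightarrow> \<exists>W G. k \<in> W \<and> W \<subseteq> U \<and> is_inverse_on W A G
       \<and> (\<Sum>n\<in>W. cmod (G k n)) \<le> \<beta> \<and> (\<Sum>n\<in>W. \<Sum>m\<in>U - W. cmod (G k n) * cmod (A n m)) \<le> 1/2"
  shows "bounded_below_on U A (2 * \<beta>)"
  unfolding bounded_below_on_def
proof (intro allI impI ballI)
  fix u c k assume h: "\<forall>n\<in>U. cmod (\<Sum>m\<in>U. A n m * u m) \<le> c" and k: "k \<in> U"
  have "cmod (u k) \<le> \<beta> * c + M / 2" if M: "\<And>k. k \<in> U \<Longrightarrow> cmod (u k) \<le> M" and k: "k \<in> U" for M k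
  proof -
    have M0: "M \<ge> 0" using M[OF k] norm_ge_zero order_trans by blast
    have c0: "c \<ge> 0" using h k norm_ge_zero order_trans by blast
    obtain W G where W: "k \<in> W" "W \<subseteq> U" and inv: "is_inverse_on W A G"
      and G: "(\<Sum>n\<in>W. cmod (G k n)) \<le> \<beta>" "(\<Sum>n\<in>W. \<Sum>m\<in>U - W. cmod (G k n) * cmod (A n m)) \<le> 1/2"
      using cov[OF k] by blast
    have fW: "finite W" using W U finite_subset by blast
    have split: "(\<Sum>m\<in>W. A n m * u m) = (\<Sum>m\<in>U. A n m * u m) - (\<Sum>m\<in>U - W. A n m * u m)" for n
      using sum.subset_diff[OF W(2) U, of "\<lambda>m. A n m * u m"] by simp
    have "u k = (\<Sum>n\<in>W. G k n * (\<Sum>m\<in>W. A n m * u m))"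
      using is_inverse_on_apply(2)[OF fW inv W(1)] by simp
    also have "cmod \<dots> \<le> (\<Sum>n\<in>W. cmod (G k n) * c + (\<Sum>m\<in>U - W. cmod (G k n) * cmod (A n m)) * M)"
    proof (rule sum_norm_le)
      fix n assume n: "n \<in> W"
      have "cmod (\<Sum>m\<in>W. A n m * u m) \<le> cmod (\<Sum>m\<in>U. A n m * u m) + cmod (\<Sum>m\<in>U - W. A n m * u m)"
        unfolding split by (rule norm_triangle_ineq4)
      also have "\<dots> \<le> c + (\<Sum>m\<in>U - W. cmod (A n m) * M)"
        using h n W M by (intro add_mono sum_norm_le) (auto simp: norm_mult intro!: mult_left_mono)
      finally have "cmod (G k n) * cmod (\<Sum>m\<in>W. A n m * u m) \<le> cmod (G k n) * (c + (\<Sum>m\<in>U - W. cmod (A n m) * M))"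
        by (rule mult_left_mono) simp
      thus "cmod (G k n * (\<Sum>m\<in>W. A n m * u m)) \<le> cmod (G k n) * c + (\<Sum>m\<in>U - W. cmod (G k n) * cmod (A n m)) * M"
        unfolding norm_mult distrib_left by (simp add: sum_distrib_left sum_distrib_right mult.assoc)
    qed
    also have "\<dots> = (\<Sum>n\<in>W. cmod (G k n)) * c + (\<Sum>n\<in>W. \<Sum>m\<in>U - W. cmod (G k n) * cmod (A n m)) * M"
      by (simp add: sum.distrib sum_distrib_right)
    also have "\<dots> \<le> \<beta> * c + 1/2 * M"
      using G c0 M0 by (intro add_mono mult_right_mono)
    finally show ?thesis by simp
  qed
  from sup_absorb[of U u "\<beta> * c" k, OF U this k] show "cmod (u k) \<le> 2 * \<beta> * c" by simp
qed

section \<open>Schur complements\<close>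

definition schur :: "'a set \<Rightarrow> ('a \<Rightarrow> 'a \<Rightarrow> complex) \<Rightarrow> ('a \<Rightarrow> 'a \<Rightarrow> complex) \<Rightarrow> 'a \<Rightarrow> 'a \<Rightarrow> complex" where
  "schur U A G n n' = A n n' - (\<Sum>k\<in>U. \<Sum>l\<in>U. A n k * G k l * A l n')"

lemma schur_apply:
  "(\<Sum>m\<in>V. schur U A G n m * u m) = (\<Sum>m\<in>V. A n m * u m)
     - (\<Sum>k\<in>U. A n k * (\<Sum>l\<in>U. G k l * (\<Sum>m\<in>V. A l m * u m)))"
proof -
  have "(\<Sum>m\<in>V. (\<Sum>k\<in>U. \<Sum>l\<in>U. A n k * G k l * A l m) * u m)
      = (\<Sum>m\<in>V. \<Sum>k\<in>U. \<Sum>l\<in>U. A n k * G k l * A l m * u m)"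
    by (simp add: sum_distrib_right)
  also have "\<dots> = (\<Sum>k\<in>U. \<Sum>l\<in>U. \<Sum>m\<in>V. A n k * G k l * A l m * u m)"
    by (subst sum.swap) (intro sum.cong refl sum.swap)
  also have "\<dots> = (\<Sum>k\<in>U. A n k * (\<Sum>l\<in>U. G k l * (\<Sum>m\<in>V. A l m * u m)))"
    by (simp add: sum_distrib_left mult.assoc)
  finally show ?thesis unfolding schur_def by (simp add: left_diff_distrib sum_subtractf)
qed

text \<open>Extend \<open>u\<close> from \<open>V\<close> to \<open>U\<close> by \<open>w\<close>,
  chosen so that the full matrix applied to \<open>w\<close> vanishes on \<open>U\<close>. On
  \<open>V\<close> it then equals the Schur complement applied to \<open>u\<close>, so the lower
  bound passes over with the same constant.\<close>

lemma bounded_below_on_schur: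
  assumes fin: "finite U" "finite V" and dis: "U \<inter> V = {}" and inv: "is_inverse_on U A G"
    and b: "bounded_below_on (U \<union> V) A \<beta>"
  shows "bounded_below_on V (schur U A G) \<beta>"
  unfolding bounded_below_on_def
proof (intro allI impI ballI)
  fix u c k assume h: "\<forall>n\<in>V. cmod (\<Sum>m\<in>V. schur U A G n m * u m) \<le> c" and k: "k \<in> V"
  have c0: "c \<ge> 0" using h k norm_ge_zero order_trans by blast
  define w where "w = (\<lambda>n. if n \<in> V then u n else - (\<Sum>l\<in>U. G n l * (\<Sum>m\<in>V. A l m * u m)))"
  have sp: "(\<Sum>m\<in>U \<union> V. A n m * w m) = (\<Sum>m\<in>V. A n m * u m)
     - (\<Sum>k\<in>U. A n k * (\<Sum>l\<in>U. G k l * (\<Sum>m\<in>V. A l m * u m)))" for n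
  proof -
    have "(\<Sum>m\<in>U. A n m * w m) = (\<Sum>k\<in>U. - (A n k * (\<Sum>l\<in>U. G k l * (\<Sum>m\<in>V. A l m * u m))))"
      using dis by (intro sum.cong) (auto simp: w_def)
    moreover have "(\<Sum>m\<in>V. A n m * w m) = (\<Sum>m\<in>V. A n m * u m)" by (intro sum.cong) (auto simp: w_def)
    ultimately show ?thesis using sum.union_disjoint[OF fin dis, of "\<lambda>m. A n m * w m"]
      by (simp add: sum_negf)
  qed
  have "cmod (\<Sum>m\<in>U \<union> V. A n m * w m) \<le> c" if "n \<in> U \<union> V" for n
  proof (cases "n \<in> V")
    case True thus ?thesis using h unfolding sp schur_apply by blast
  next
    case False
    hence "n \<in> U" using that by auto
    thus ?thesis unfolding sp using is_inverse_on_apply(1)[OF fin(1) inv, of n "\<lambda>l. \<Sum>m\<in>V. A l m * u m"] c0 by simp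
  qed
  from bounded_below_onD[OF b this, of k] k show "cmod (u k) \<le> \<beta> * c" by (simp add: w_def)
qed

text \<open>Block elimination in the opposite direction. Solving on \<open>U\<close> first turns the
  equations on \<open>V\<close> into one for the Schur complement, which bounds \<open>u\<close> on
  \<open>V\<close> by \<beta>'; returning to the equations on \<open>U\<close> then bounds the
  rest.\<close>

lemma bounded_below_on_of_schur:
  fixes B \<beta>1 \<beta>2 :: real
  assumes fin: "finite U" "finite V" and dis: "U \<inter> V = {}" and inv: "is_inverse_on U A G"
    and b1: "bounded_below_on U A \<beta>1" and b2: "bounded_below_on V (schur U A G) \<beta>2"
    and B: "\<And>n m. n \<in> U \<union> V \<Longrightarrow> m \<in> U \<union> V \<Longrightarrow> cmod (A n m) \<le> B"
    and nn: "B \<ge> 0" "\<beta>1 \<ge> 0" "\<beta>2 \<ge> 0"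
  defines "\<beta>' \<equiv> \<beta>2 * (1 + card U * B * \<beta>1)"
  shows "bounded_below_on (U \<union> V) A (\<beta>1 * (1 + card V * B * \<beta>') + \<beta>')"
  unfolding bounded_below_on_def
proof (intro allI impI ballI)
  fix u c k assume h: "\<forall>n\<in>U \<union> V. cmod (\<Sum>m\<in>U \<union> V. A n m * u m) \<le> c" and k: "k \<in> U \<union> V"
  have c0: "c \<ge> 0" using h k norm_ge_zero order_trans by blast
  define f where "f = (\<lambda>n. \<Sum>m\<in>U \<union> V. A n m * u m)"
  have f: "cmod (f n) \<le> c" if "n \<in> U \<union> V" for n using h that by (simp add: f_def)
  have sp: "f n = (\<Sum>m\<in>U. A n m * u m) + (\<Sum>m\<in>V. A n m * u m)" for n
    unfolding f_def by (rule sum.union_disjoint[OF fin dis])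
  define w where "w = (\<lambda>k. \<Sum>l\<in>U. G k l * f l)"
  have w: "cmod (w k) \<le> \<beta>1 * c" if "k \<in> U" for k
  proof (rule bounded_below_onD[OF b1 _ that])
    fix n assume "n \<in> U"
    thus "cmod (\<Sum>m\<in>U. A n m * w m) \<le> c"
      using is_inverse_on_apply(1)[OF fin(1) inv, of n f] f by (simp add: w_def)
  qed
  have uU: "(\<Sum>l\<in>U. G k l * (\<Sum>m\<in>V. A l m * u m)) = w k - u k" if "k \<in> U" for k
  proof -
    have "w k = (\<Sum>l\<in>U. G k l * (\<Sum>m\<in>U. A l m * u m)) + (\<Sum>l\<in>U. G k l * (\<Sum>m\<in>V. A l m * u m))"
      unfolding w_def sp by (simp add: distrib_left sum.distrib)
    thus ?thesis using is_inverse_on_apply(2)[OF fin(1) inv that] by simp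
  qed
  have uV: "cmod (u k) \<le> \<beta>' * c" if "k \<in> V" for k
  proof -
    have "cmod (\<Sum>m\<in>V. schur U A G n m * u m) \<le> (1 + card U * B * \<beta>1) * c" if n: "n \<in> V" for n
    proof -
      have "(\<Sum>k\<in>U. A n k * (\<Sum>l\<in>U. G k l * (\<Sum>m\<in>V. A l m * u m))) = (\<Sum>k\<in>U. A n k * (w k - u k))"
        using uU by (intro sum.cong) auto
      hence "(\<Sum>m\<in>V. schur U A G n m * u m) = f n - (\<Sum>k\<in>U. A n k * w k)"
        unfolding schur_apply sp by (simp add: right_diff_distrib sum_subtractf)
      also have "cmod \<dots> \<le> cmod (f n) + cmod (\<Sum>k\<in>U. A n k * w k)" by (rule norm_triangle_ineq4)
      also have "cmod (\<Sum>k\<in>U. A n k * w k) \<le> (\<Sum>k\<in>U. B * (\<beta>1 * c))"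
        using B n w nn by (intro sum_norm_le) (auto simp: norm_mult intro!: mult_mono)
      finally show ?thesis using f[of n] n by (simp add: algebra_simps)
    qed
    from bounded_below_onD[OF b2 this that] show ?thesis unfolding \<beta>'_def by (simp only: mult.assoc)
  qed
  have \<beta>': "\<beta>' \<ge> 0" using nn by (simp add: \<beta>'_def)
  show "cmod (u k) \<le> (\<beta>1 * (1 + card V * B * \<beta>') + \<beta>') * c"
  proof (cases "k \<in> V")
    case True
    have "\<beta>' * c \<le> (\<beta>1 * (1 + card V * B * \<beta>') + \<beta>') * c"
      using nn \<beta>' c0 by (intro mult_right_mono) auto
    thus ?thesis using uV[OF True] by simp
  next
    case False
    hence kU: "k \<in> U" using k by auto
    have "cmod (\<Sum>m\<in>U. A n m * u m) \<le> (1 + card V * B * \<beta>') * c" if n: "n \<in> U" for n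
    proof -
      have "(\<Sum>m\<in>U. A n m * u m) = f n - (\<Sum>m\<in>V. A n m * u m)" by (simp add: sp)
      also have "cmod \<dots> \<le> cmod (f n) + cmod (\<Sum>m\<in>V. A n m * u m)" by (rule norm_triangle_ineq4)
      also have "cmod (\<Sum>m\<in>V. A n m * u m) \<le> (\<Sum>m\<in>V. B * (\<beta>' * c))"
        using B n uV nn by (intro sum_norm_le) (auto simp: norm_mult intro!: mult_mono)
      finally show ?thesis using f[of n] n by (simp add: algebra_simps)
    qed
    from bounded_below_onD[OF b1 this kU]
    have "cmod (u k) \<le> \<beta>1 * (1 + card V * B * \<beta>') * c" by (simp add: mult.assoc)
    also have "\<dots> \<le> (\<beta>1 * (1 + card V * B * \<beta>') + \<beta>') * c"
      using \<beta>' c0 by (intro mult_right_mono) auto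
    finally show ?thesis .
  qed
qed

section \<open>Elementary regions\<close>

lemma normZ_le_iff: "normZ m \<le> c \<longleftrightarrow> (\<forall>i. real_of_int \<bar>m i\<bar> \<le> c)"
  unfolding normZ_def by (subst Max_le_iff) auto

lemma abs_le_normZ: "real_of_int \<bar>m i\<bar> \<le> normZ m"
  using normZ_le_iff[of m "normZ m"] by blast

lemma normZ_nonneg: "normZ m \<ge> 0"
  using abs_le_normZ[of m undefined] by linarith

lemma normZ_triangle: "normZ (\<lambda>i. a i - c i) \<le> normZ (\<lambda>i. a i - b i) + normZ (\<lambda>i. b i - c i)"
  unfolding normZ_le_iff
proof
  fix i
  show "real_of_int \<bar>a i - c i\<bar> \<le> normZ (\<lambda>i. a i - b i) + normZ (\<lambda>i. b i - c i)"
    using abs_le_normZ[of "\<lambda>i. a i - b i" i] abs_le_normZ[of "\<lambda>i. b i - c i" i] by linarith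
qed

lemma cubeZ_eq: "cubeZ N = {n. \<forall>i. n i \<in> {- \<lfloor>N\<rfloor>..\<lfloor>N\<rfloor>}}"
proof -
  have "\<bar>real_of_int a\<bar> \<le> N \<longleftrightarrow> a \<in> {- \<lfloor>N\<rfloor>..\<lfloor>N\<rfloor>}" for a :: int
    by (auto simp: abs_le_iff le_floor_iff) linarith+
  thus ?thesis by (simp add: cubeZ_def)
qed

lemma cubeZ_PiE: "cubeZ N = (UNIV :: 'd::finite set) \<rightarrow>\<^sub>E {- \<lfloor>N\<rfloor>..\<lfloor>N\<rfloor>}"
  unfolding cubeZ_eq by auto

lemma finite_cubeZ: "finite (cubeZ N :: ('d::finite \<Rightarrow> int) set)"
  unfolding cubeZ_PiE by (intro finite_PiE) auto

lemma card_cubeZ: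
  assumes "N \<ge> 0"
  shows "real (card (cubeZ N :: ('d::finite \<Rightarrow> int) set)) \<le> (2 * N + 1) ^ CARD('d)"
proof -
  have "real (card (cubeZ N :: ('d \<Rightarrow> int) set)) = real (nat (2 * \<lfloor>N\<rfloor> + 1)) ^ CARD('d)"
    unfolding cubeZ_PiE by (simp add: card_PiE algebra_simps)
  also have "\<dots> \<le> (2 * N + 1) ^ CARD('d)"
    using assms by (intro power_mono) auto
  finally show ?thesis .
qed

abbreviation translateZ :: "('d \<Rightarrow> int) \<Rightarrow> ('d \<Rightarrow> int) set \<Rightarrow> ('d \<Rightarrow> int) set" where
  "translateZ k Q \<equiv> (\<lambda>n. (\<lambda>i. n i + k i)) ` Q"

lemma mem_translateZ: "n \<in> translateZ k Q \<longleftrightarrow> (\<lambda>i. n i - k i) \<in> Q"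
proof
  assume "(\<lambda>i. n i - k i) \<in> Q"
  thus "n \<in> translateZ k Q" by (rule rev_image_eqI) auto
qed auto

lemma elem0_subset: "Q \<in> elem0 N \<Longrightarrow> Q \<subseteq> cubeZ N"
  by (auto simp: elem0_def)

lemma zero_in_elem0:
  assumes "Q \<in> elem0 N" "N \<ge> 0"
  shows "(\<lambda>_. 0) \<in> Q"
proof -
  have z: "(\<lambda>_. 0) \<in> cubeZ N" using assms by (simp add: cubeZ_def)
  have "\<not> (\<forall>i. cut_holds (\<sigma> i) 0)" if "2 \<le> card {i. \<sigma> i \<noteq> CAny}" for \<sigma> :: "'a \<Rightarrow> cutrel"
  proof
    assume a: "\<forall>i. cut_holds (\<sigma> i) 0"
    have "\<sigma> i = CAny" for i using a[rule_format, of i] by (cases "\<sigma> i") auto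
    with that show False by simp
  qed
  with z assms show ?thesis unfolding elem0_def by auto
qed

lemma finite_elem:
  assumes "W \<in> elem N"
  shows "finite (W :: ('d::finite \<Rightarrow> int) set)"
  using assms finite_subset[OF elem0_subset finite_cubeZ] by (auto simp: elem_def)

lemma card_elem:
  assumes "W \<in> elem N" "N \<ge> 0"
  shows "real (card (W :: ('d::finite \<Rightarrow> int) set)) \<le> (2 * N + 1) ^ CARD('d)"
proof -
  obtain Q k where W: "W = translateZ k Q" and Q: "Q \<in> elem0 N" using assms by (auto simp: elem_def)
  have "card W \<le> card Q" unfolding W using finite_subset[OF elem0_subset[OF Q] finite_cubeZ] by (rule card_image_le)
  also have "\<dots> \<le> card (cubeZ N :: ('d \<Rightarrow> int) set)" using elem0_subset[OF Q] by (intro card_mono finite_cubeZ)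
  finally show ?thesis using card_cubeZ[OF assms(2), where 'd = 'd] by linarith
qed

section \<open>Windows inside an elementary region\<close>

text \<open>Cubes are products, so the centre of a window can be chosen coordinate by coordinate,
  and this is the condition on one coordinate. The factor 2 expresses the distance M / 2 within the
  integers.\<close>

definition window :: "int \<Rightarrow> int \<Rightarrow> int \<Rightarrow> int \<Rightarrow> bool" where
  "window N M k c \<longleftrightarrow> - N \<le> c - M \<and> c + M \<le> N \<and> (\<forall>m. \<bar>m\<bar> \<le> N \<and> \<bar>2 * (m - k)\<bar> \<le> M \<longrightarrow> \<bar>m - c\<bar> \<le> M)"

text \<open>The signed depth of a coordinate inside the removed half line, so that the two cut
  directions can be treated alike.\<close>

definition side :: "cutrel \<Rightarrow> int \<Rightarrow> int" where
  "side \<sigma> k = (if \<sigma> = CLt then - k else k)"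

lemma cut_holds_side: "\<sigma> \<noteq> CAny \<Longrightarrow> cut_holds \<sigma> k \<longleftrightarrow> side \<sigma> k > 0"
  by (cases \<sigma>) (auto simp: side_def)

lemma window_any:
  assumes "\<bar>k\<bar> \<le> N" "0 \<le> M" "2 * M + 1 \<le> N"
  shows "\<exists>c. window N M k c"
  \<comment> \<open>The centre is \<open>k\<close> clamped to the interval of centres for which the
    window fits.\<close>
  using assms by (intro exI[of _ "max (M - N) (min (N - M) k)"]) (auto simp: window_def max_def min_def abs_le_iff)

text \<open>A coordinate at least M / 2 away from the removed half line has its whole M /
  2-neighbourhood on the retained side. Clamping the centre so that the window does not pass 0
  therefore loses none of that neighbourhood.\<close>

lemma window_out:
  assumes "\<bar>k\<bar> \<le> N" "0 \<le> M" "2 * M + 1 \<le> N" "\<sigma> \<noteq> CAny" "2 * side \<sigma> k \<le> - M"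
  shows "\<exists>c. window N M k c \<and> (\<forall>n. \<bar>n - c\<bar> \<le> M \<longrightarrow> \<not> cut_holds \<sigma> n)"
proof (cases \<sigma>)
  case CGt
  thus ?thesis using assms by (intro exI[of _ "max (M - N) (min (- M) k)"]) (auto simp: window_def max_def min_def side_def abs_le_iff)
next
  case CLt
  thus ?thesis using assms by (intro exI[of _ "min (N - M) (max M k)"]) (auto simp: window_def max_def min_def side_def abs_le_iff)
qed (use assms in auto)

text \<open>Close to the face, the window is pushed flush against it on the retained side. It misses
  the part of the neighbourhood of \<open>k\<close> beyond the face, which is why only points
  outside the cut are claimed to be covered.\<close>

lemma window_edge:
  assumes "0 \<le> M" "2 * M + 1 \<le> N" "\<sigma> \<noteq> CAny" "- M < 2 * side \<sigma> k" "side \<sigma> k \<le> 0"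
  shows "\<exists>c. - N \<le> c - M \<and> c + M \<le> N \<and> (\<forall>m. \<bar>2 * (m - k)\<bar> \<le> M \<and> \<not> cut_holds \<sigma> m \<longrightarrow> \<bar>m - c\<bar> \<le> M)
     \<and> (\<forall>n. \<bar>n - c\<bar> \<le> M \<longrightarrow> \<not> cut_holds \<sigma> n) \<and> \<bar>k - c\<bar> \<le> M"
proof (cases \<sigma>)
  case CGt
  thus ?thesis using assms by (intro exI[of _ "- M"]) (auto simp: side_def abs_le_iff)
next
  case CLt
  thus ?thesis using assms by (intro exI[of _ M]) (auto simp: side_def abs_le_iff)
qed (use assms in auto)

text \<open>Near \<open>k\<close> the region looks like a cube, a half space or a corner, and the
  window copies that shape. If some cut coordinate of \<open>k\<close> lies at least M / 2 outside
  its removed half line, a cube fits. Otherwise only the directions whose faces are close to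
  \<open>k\<close> matter: with one such direction a cube flush with the face works, with several a
  smaller elementary region with the same corner.\<close>

lemma elem0_window:
  fixes \<Lambda> :: "('d::finite \<Rightarrow> int) set"
  assumes \<Lambda>: "\<Lambda> \<in> elem0 N" and k: "k \<in> \<Lambda>" and M: "M \<ge> 0" "2 * M + 2 \<le> N"
  shows "\<exists>W\<in>elem M. k \<in> W \<and> W \<subseteq> \<Lambda> \<and> (\<forall>m\<in>\<Lambda> - W. M / 2 \<le> normZ (\<lambda>i. k i - m i))"
proof -
  define N' M' where "N' = \<lfloor>N\<rfloor>" and "M' = \<lfloor>M\<rfloor>"
  have M': "0 \<le> M'" using M by (simp add: M'_def)
  have "real_of_int (2 * M' + 1) \<le> N" using M of_int_floor_le[of M] unfolding M'_def of_int_add of_int_mult of_int_numeral of_int_1 by linarith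
  hence N': "2 * M' + 1 \<le> N'" unfolding N'_def by (simp add: le_floor_iff)
  have cube: "n \<in> cubeZ N \<longleftrightarrow> (\<forall>i. \<bar>n i\<bar> \<le> N')" for n :: "'d \<Rightarrow> int"
    unfolding cubeZ_eq N'_def by (auto simp: abs_le_iff) (metis minus_le_iff)+
  have cubeM: "n \<in> translateZ c (cubeZ M) \<longleftrightarrow> (\<forall>i. \<bar>n i - c i\<bar> \<le> M')" for n c :: "'d \<Rightarrow> int"
    unfolding mem_translateZ unfolding cubeZ_eq M'_def by (auto simp: abs_le_iff) (smt (verit))+
  have near: "\<bar>2 * (m i - k i)\<bar> \<le> M'" if "\<not> M / 2 \<le> normZ (\<lambda>i. k i - m i)" for m i
  proof -
    have "real_of_int \<bar>2 * (m i - k i)\<bar> < M"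
      using that abs_le_normZ[of "\<lambda>i. k i - m i" i] by (simp add: abs_mult abs_minus_commute)
    thus ?thesis unfolding M'_def le_floor_iff by linarith
  qed
  have kc: "\<bar>k i\<bar> \<le> N'" for i using k elem0_subset[OF \<Lambda>] cube by auto
  have cube_case: ?thesis
    if c: "\<And>i. - N' \<le> c i - M' \<and> c i + M' \<le> N'" and kW: "\<And>i. \<bar>k i - c i\<bar> \<le> M'"
      and sub: "\<And>n. (\<And>i. \<bar>n i - c i\<bar> \<le> M') \<Longrightarrow> n \<in> cubeZ N \<Longrightarrow> n \<in> \<Lambda>"
      and cov: "\<And>m i. m \<in> \<Lambda> \<Longrightarrow> (\<And>i. \<bar>2 * (m i - k i)\<bar> \<le> M') \<Longrightarrow> \<bar>m i - c i\<bar> \<le> M'"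
    for c
  proof (intro bexI conjI)
    show "translateZ c (cubeZ M) \<in> elem M" by (auto simp: elem_def elem0_def)
    show "k \<in> translateZ c (cubeZ M)" unfolding cubeM using kW by simp
    show "translateZ c (cubeZ M) \<subseteq> \<Lambda>"
    proof
      fix n assume "n \<in> translateZ c (cubeZ M)"
      hence n: "\<bar>n i - c i\<bar> \<le> M'" for i unfolding cubeM by simp
      have "\<bar>n i\<bar> \<le> N'" for i using n[of i] c[of i] by linarith
      thus "n \<in> \<Lambda>" using sub[OF n] cube by blast
    qed
    show "\<forall>m\<in>\<Lambda> - translateZ c (cubeZ M). M / 2 \<le> normZ (\<lambda>i. k i - m i)"
    proof (intro ballI, rule ccontr)
      fix m assume m: "m \<in> \<Lambda> - translateZ c (cubeZ M)" and f: "\<not> M / 2 \<le> normZ (\<lambda>i. k i - m i)"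
      hence "\<forall>i. \<bar>m i - c i\<bar> \<le> M'" using cov[of m] near[OF f] by auto
      thus False using m cubeM by auto
    qed
  qed
  have win: "\<bar>k i - c\<bar> \<le> M'" if "window N' M' (k i) c" for i c
    using that kc[of i] M' unfolding window_def by simp
  from \<Lambda> consider (cube) "\<Lambda> = cubeZ N"
    | (cut) \<sigma> where "\<Lambda> = cubeZ N - {n. \<forall>i. cut_holds (\<sigma> i) (n i)}" "2 \<le> card {i. \<sigma> i \<noteq> CAny}"
    unfolding elem0_def by auto
  thus ?thesis
  proof cases
    case cube
    have "\<forall>i. \<exists>c. window N' M' (k i) c" using window_any[OF kc M' N'] by blast
    then obtain c where c: "\<And>i. window N' M' (k i) (c i)" by metis
    show ?thesis
    proof (rule cube_case[of c])
      fix m i assume "m \<in> \<Lambda>" "\<And>i. \<bar>2 * (m i - k i)\<bar> \<le> M'"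
      thus "\<bar>m i - c i\<bar> \<le> M'" using c[of i] \<open>\<And>n. n \<in> cubeZ N \<longleftrightarrow> _\<close> unfolding window_def cube by blast
    qed (use c win cube in \<open>auto simp: window_def\<close>)
  next
    case (cut \<sigma>)
    have mem: "n \<in> \<Lambda> \<longleftrightarrow> (\<forall>i. \<bar>n i\<bar> \<le> N') \<and> (\<exists>i. \<not> cut_holds (\<sigma> i) (n i))" for n
      unfolding cut(1) using cube by auto
    have any: "\<sigma> i \<noteq> CAny" if "\<not> cut_holds (\<sigma> i) a" for i a using that by (cases "\<sigma> i") auto
    show ?thesis
    proof (cases "\<exists>i0. \<sigma> i0 \<noteq> CAny \<and> 2 * side (\<sigma> i0) (k i0) \<le> - M'")
      case True
      then obtain i0 where i0: "\<sigma> i0 \<noteq> CAny" "2 * side (\<sigma> i0) (k i0) \<le> - M'" by blast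
      have "\<forall>i. \<exists>c. window N' M' (k i) c \<and> (i = i0 \<longrightarrow> (\<forall>n. \<bar>n - c\<bar> \<le> M' \<longrightarrow> \<not> cut_holds (\<sigma> i) n))"
        using window_any[OF kc M' N'] window_out[OF kc M' N' i0] by metis
      then obtain c where c: "\<And>i. window N' M' (k i) (c i)"
        and c0: "\<And>n. \<bar>n - c i0\<bar> \<le> M' \<Longrightarrow> \<not> cut_holds (\<sigma> i0) n" by metis
      show ?thesis
      proof (rule cube_case[of c])
        fix m i assume "m \<in> \<Lambda>" "\<And>i. \<bar>2 * (m i - k i)\<bar> \<le> M'"
        thus "\<bar>m i - c i\<bar> \<le> M'" using c[of i] unfolding window_def mem by blast
      next
        fix n assume "\<And>i. \<bar>n i - c i\<bar> \<le> M'" "n \<in> cubeZ N"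
        thus "n \<in> \<Lambda>" using c0 cube unfolding mem by blast
      qed (use c win in \<open>auto simp: window_def\<close>)
    next
      case False
      hence nout: "- M' < 2 * side (\<sigma> i) (k i)" if "\<sigma> i \<noteq> CAny" for i using that by force
      \<comment> \<open>The directions whose face is within M / 2 of \<open>k\<close>. In the other
        cut directions every point near \<open>k\<close> satisfies the cut condition, so a nearby
        point of \<Lambda> must violate it in a direction of \<open>J\<close>.\<close>
      define J where "J = {i. \<sigma> i \<noteq> CAny \<and> 2 * side (\<sigma> i) (k i) \<le> M'}"
      have inn: "M' < 2 * side (\<sigma> i) (k i)" if "\<sigma> i \<noteq> CAny" "i \<notin> J" for i using that by (auto simp: J_def)
      have nearin: "cut_holds (\<sigma> i) a" if "\<sigma> i \<noteq> CAny" "i \<notin> J" "\<bar>2 * (a - k i)\<bar> \<le> M'" for i a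
        using inn[OF that(1,2)] that(3) unfolding cut_holds_side[OF that(1)] by (auto simp: side_def split: if_splits)
      have near0: "\<bar>2 * (k i - k i)\<bar> \<le> M'" for i using M' by simp
      obtain j where j: "\<not> cut_holds (\<sigma> j) (k j)" using k mem by blast
      have jJ: "j \<in> J" using j nearin[of j "k j"] any[OF j] near0 by blast
      show ?thesis
      proof (cases "J = {j}")
        case True
        have sj: "side (\<sigma> j) (k j) \<le> 0" using j cut_holds_side[OF any[OF j]] by simp
        have "\<forall>i. \<exists>c. i \<noteq> j \<longrightarrow> window N' M' (k i) c" using window_any[OF kc M' N'] by blast
        then obtain c1 where c1: "\<And>i. i \<noteq> j \<Longrightarrow> window N' M' (k i) (c1 i)" by metis
        obtain cj where cj: "- N' \<le> cj - M'" "cj + M' \<le> N'"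
          "\<And>m. \<bar>2 * (m - k j)\<bar> \<le> M' \<Longrightarrow> \<not> cut_holds (\<sigma> j) m \<Longrightarrow> \<bar>m - cj\<bar> \<le> M'"
          "\<And>n. \<bar>n - cj\<bar> \<le> M' \<Longrightarrow> \<not> cut_holds (\<sigma> j) n" "\<bar>k j - cj\<bar> \<le> M'"
          using window_edge[OF M' N' any[OF j] nout[OF any[OF j]] sj] by blast
        define c where "c = c1(j := cj)"
        show ?thesis
        proof (rule cube_case[of c])
          fix m i assume m: "m \<in> \<Lambda>" and nr: "\<And>i. \<bar>2 * (m i - k i)\<bar> \<le> M'"
          obtain l where l: "\<not> cut_holds (\<sigma> l) (m l)" using m mem by blast
          have "l \<in> J" using l nearin[of l "m l"] any[OF l] nr by blast
          hence "\<not> cut_holds (\<sigma> j) (m j)" using l True by simp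
          thus "\<bar>m i - c i\<bar> \<le> M'"
            using cj(3)[OF nr] c1[of i] nr[of i] m unfolding window_def mem c_def by (cases "i = j") auto
        next
          fix n assume "\<And>i. \<bar>n i - c i\<bar> \<le> M'" "n \<in> cubeZ N"
          thus "n \<in> \<Lambda>" using cj(4)[of "n j"] cube unfolding mem c_def by (metis fun_upd_same)
        next
          fix i show "\<bar>k i - c i\<bar> \<le> M'" using win c1 cj by (cases "i = j") (auto simp: c_def)
        next
          fix i show "- N' \<le> c i - M' \<and> c i + M' \<le> N'" using c1[of i] cj by (cases "i = j") (auto simp: c_def window_def)
        qed
      next
        case False
        \<comment> \<open>An elementary region must have at least two active cuts; this forces the
          separate treatment of a single face above.\<close>
        have "card J \<ge> 2"
        proof -
          obtain l where "l \<in> J" "l \<noteq> j" using False jJ by blast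
          hence "card {l, j} \<le> card J" using jJ by (intro card_mono) auto
          thus ?thesis using \<open>l \<noteq> j\<close> by simp
        qed
        define \<tau> where "\<tau> = (\<lambda>i. if i \<in> J then \<sigma> i else CAny)"
        have "{i. \<tau> i \<noteq> CAny} = J" by (auto simp: \<tau>_def J_def)
        hence el: "cubeZ M - {n. \<forall>i. cut_holds (\<tau> i) (n i)} \<in> elem0 M"
          unfolding elem0_def using \<open>card J \<ge> 2\<close> by auto
        have "\<forall>i. \<exists>c. (i \<notin> J \<longrightarrow> window N' M' (k i) c)" using window_any[OF kc M' N'] by blast
        then obtain c1 where c1: "\<And>i. i \<notin> J \<Longrightarrow> window N' M' (k i) (c1 i)" by metis
        \<comment> \<open>In the directions of \<open>J\<close> the corner of the window has to
          coincide with that of \<Lambda>, hence centre 0; the remaining directions are clamped as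
          before.\<close>
        define c where "c = (\<lambda>i. if i \<in> J then 0 else c1 i)"
        define W where "W = translateZ c (cubeZ M - {n. \<forall>i. cut_holds (\<tau> i) (n i)})"
        have cutc: "(\<exists>i. \<not> cut_holds (\<tau> i) (n i - c i)) \<longleftrightarrow> (\<exists>i\<in>J. \<not> cut_holds (\<sigma> i) (n i))" for n
          by (auto simp: \<tau>_def c_def)
        have W: "n \<in> W \<longleftrightarrow> (\<forall>i. \<bar>n i - c i\<bar> \<le> M') \<and> (\<exists>i\<in>J. \<not> cut_holds (\<sigma> i) (n i))" for n
          using cubeM[of n c] cutc[of n] unfolding W_def mem_translateZ by auto
        have cov: "m \<in> W" if m: "m \<in> \<Lambda>" and nr: "\<And>i. \<bar>2 * (m i - k i)\<bar> \<le> M'" for m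
        proof -
          obtain l where l: "\<not> cut_holds (\<sigma> l) (m l)" using m mem by blast
          have "l \<in> J" using l nearin[of l "m l"] any[OF l] nr by blast
          moreover have "\<bar>m i - c i\<bar> \<le> M'" for i
          proof (cases "i \<in> J")
            case True
            hence "\<sigma> i \<noteq> CAny" "2 * side (\<sigma> i) (k i) \<le> M'" by (auto simp: J_def)
            with nout[of i] have "\<bar>2 * (k i)\<bar> \<le> M'" by (auto simp: side_def split: if_splits)
            thus ?thesis using nr[of i] True by (auto simp: c_def)
          next
            case False
            thus ?thesis using c1[of i] nr[of i] m unfolding window_def mem c_def by simp
          qed
          ultimately show ?thesis unfolding W using l by blast
        qed
        have "W \<subseteq> \<Lambda>"
        proof
          fix n assume "n \<in> W"
          hence n: "\<And>i. \<bar>n i - c i\<bar> \<le> M'" "\<exists>i. \<not> cut_holds (\<sigma> i) (n i)" unfolding W by auto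
          have "\<bar>n i\<bar> \<le> N'" for i
            using n(1)[of i] c1[of i] M' N' unfolding window_def c_def by (cases "i \<in> J") auto
          thus "n \<in> \<Lambda>" using n mem by blast
        qed
        moreover have "W \<in> elem M" unfolding W_def elem_def using el by blast
        moreover have "k \<in> W" by (rule cov[OF k near0])
        moreover have "\<forall>m\<in>\<Lambda> - W. M / 2 \<le> normZ (\<lambda>i. k i - m i)" using cov near by blast
        ultimately show ?thesis by blast
      qed
    qed
  qed
qed

lemma elem_window:
  fixes \<Lambda> :: "('d::finite \<Rightarrow> int) set"
  assumes \<Lambda>: "\<Lambda> \<in> elem N" and k: "k \<in> \<Lambda>" and M: "M \<ge> 0" "2 * M + 2 \<le> N"
  shows "\<exists>W\<in>elem M. k \<in> W \<and> W \<subseteq> \<Lambda> \<and> (\<forall>m\<in>\<Lambda> - W. M / 2 \<le> normZ (\<lambda>i. k i - m i))"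
proof -
  obtain Q t where Q: "Q \<in> elem0 N" and L: "\<Lambda> = translateZ t Q" using \<Lambda> by (auto simp: elem_def)
  have "(\<lambda>i. k i - t i) \<in> Q" using k unfolding L mem_translateZ .
  from elem0_window[OF Q this M] obtain W where W: "W \<in> elem M" "(\<lambda>i. k i - t i) \<in> W" "W \<subseteq> Q"
    "\<forall>m\<in>Q - W. M / 2 \<le> normZ (\<lambda>i. k i - t i - m i)" by blast
  have "translateZ t W \<in> elem M"
  proof -
    obtain Q' t' where "Q' \<in> elem0 M" "W = translateZ t' Q'" using W(1) by (auto simp: elem_def)
    moreover have "translateZ t (translateZ t' Q') = translateZ (\<lambda>i. t' i + t i) Q'"
      by (simp add: image_image add.assoc)
    ultimately show ?thesis unfolding elem_def mem_Collect_eq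
      by (intro exI[of _ Q'] exI[of _ "\<lambda>i. t' i + t i"]) simp
  qed
  moreover have "k \<in> translateZ t W" using W(2) unfolding mem_translateZ .
  moreover have "translateZ t W \<subseteq> \<Lambda>" unfolding L using W(3) by auto
  moreover have "\<forall>m\<in>\<Lambda> - translateZ t W. M / 2 \<le> normZ (\<lambda>i. k i - m i)"
  proof
    fix m assume "m \<in> \<Lambda> - translateZ t W"
    hence "(\<lambda>i. m i - t i) \<in> Q - W" unfolding L Diff_iff mem_translateZ .
    from W(4)[rule_format, OF this] show "M / 2 \<le> normZ (\<lambda>i. k i - m i)" by simp
  qed
  ultimately show ?thesis by (intro bexI[of _ "translateZ t W"] conjI)
qed

section \<open>Holomorphic extension of the potential along lines\<close>

lemma periodic1_tmod: "periodic1 v \<Longrightarrow> v (\<lambda>i. tmod a i + w i) = v (\<lambda>i. a i + w i)"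
proof -
  assume "periodic1 v"
  hence "v (\<lambda>i. (tmod a i + w i) + real_of_int \<lfloor>a i\<rfloor>) = v (\<lambda>i. tmod a i + w i)"
    unfolding periodic1_def by (elim allE)
  moreover have "(\<lambda>i. (tmod a i + w i) + real_of_int \<lfloor>a i\<rfloor>) = (\<lambda>i. a i + w i)"
    by (auto simp: tmod_def frac_def)
  ultimately show ?thesis by simp
qed

text \<open>Continuation is done only in the parameter of one real line, so that no function of
  several complex variables appears. Radius and bound are explicit because they must become uniform
  in base point and direction.\<close>

definition extends_along :: "(('i \<Rightarrow> real) \<Rightarrow> real) \<Rightarrow> real \<Rightarrow> real \<Rightarrow> ('i \<Rightarrow> real) \<Rightarrow> ('i \<Rightarrow> real) \<Rightarrow> bool" where
  "extends_along v r B b w \<longleftrightarrow> (\<exists>g. g holomorphic_on ball 0 r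
     \<and> (\<forall>t. \<bar>t\<bar> < r \<longrightarrow> g (complex_of_real t) = complex_of_real (v (\<lambda>i. b i + t * w i)))
     \<and> (\<forall>z\<in>ball 0 r. cmod (g z) \<le> B))"

definition line_extension :: "(('i \<Rightarrow> real) \<Rightarrow> real) \<Rightarrow> real \<Rightarrow> real \<Rightarrow> bool" where
  "line_extension v r B \<longleftrightarrow> (\<forall>b w. (\<forall>i. \<bar>w i\<bar> \<le> 1) \<longrightarrow> extends_along v r B b w)"

lemma line_extensionE:
  assumes "line_extension v r B" "\<forall>i. \<bar>w i\<bar> \<le> 1"
  obtains g where "g holomorphic_on ball 0 r"
    "\<And>t. \<bar>t\<bar> < r \<Longrightarrow> g (complex_of_real t) = complex_of_real (v (\<lambda>i. b i + t * w i))"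
    "\<And>z. z \<in> ball 0 r \<Longrightarrow> cmod (g z) \<le> B"
proof -
  have "extends_along v r B b w" using assms unfolding line_extension_def by blast
  thus ?thesis unfolding extends_along_def using that by (elim exE conjE) auto
qed

text \<open>Convergence of the power series at the single point with all coordinates displaced by q
  = R / 2 is unconditional, hence absolute, and supplies the majorant of the Weierstrass test. The
  radius R / 4 leaves a quarter for moving the base point and a quarter for the complex
  parameter.\<close>

lemma real_analytic_local_extension:
  fixes v :: "('i::finite \<Rightarrow> real) \<Rightarrow> real"
  assumes "real_analytic v"
  shows "\<exists>r>0. \<exists>B. \<forall>b w. (\<forall>i. \<bar>b i - a i\<bar> < r) \<and> (\<forall>i. \<bar>w i\<bar> \<le> 1) \<longrightarrow> extends_along v r B b w"
proof -
  from assms obtain R c where R: "R > 0" and hs: "\<And>y. (\<forall>i. \<bar>y i - a i\<bar> < R) \<Longrightarrow>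
      ((\<lambda>\<alpha>. c \<alpha> * (\<Prod>i\<in>UNIV. (y i - a i) ^ \<alpha> i)) has_sum v y) UNIV"
    unfolding real_analytic_def by meson
  define q where "q = R / 2"
  define r where "r = R / 4"
  have r: "r > 0" "q > 0" "r + r = q" "q < R" using R by (auto simp: r_def q_def)
  define m where "m = (\<lambda>\<alpha>. \<bar>c \<alpha>\<bar> * (\<Prod>i\<in>(UNIV::'i set). q ^ \<alpha> i))"
  have "(\<lambda>\<alpha>. c \<alpha> * (\<Prod>i\<in>UNIV. q ^ \<alpha> i)) summable_on UNIV"
    using hs[of "\<lambda>i. a i + q"] r by (auto simp: summable_on_def)
  hence "(\<lambda>\<alpha>. norm (c \<alpha> * (\<Prod>i\<in>UNIV. q ^ \<alpha> i))) summable_on UNIV"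
    by (rule summable_on_iff_abs_summable_on_real[THEN iffD1])
  hence msum: "m summable_on UNIV"
    using r by (simp add: m_def abs_mult abs_prod)
  define B where "B = infsum m UNIV"
  show ?thesis
  proof (rule exI[of _ r], rule conjI[OF r(1)], rule exI[of _ B], intro allI impI)
    fix b w :: "'i \<Rightarrow> real" assume bw: "(\<forall>i. \<bar>b i - a i\<bar> < r) \<and> (\<forall>i. \<bar>w i\<bar> \<le> 1)"
    define F where "F = (\<lambda>\<alpha> z. of_real (c \<alpha>) * (\<Prod>i\<in>(UNIV::'i set). (of_real (b i - a i) + z * of_real (w i)) ^ \<alpha> i) :: complex)"
    define g where "g = (\<lambda>z. \<Sum>\<^sub>\<infinity>\<alpha>\<in>UNIV. F \<alpha> z)"
    have Fm: "cmod (F \<alpha> z) \<le> m \<alpha>" if z: "z \<in> cball 0 r" for \<alpha> z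
    proof -
      have "cmod (of_real (b i - a i) + z * of_real (w i)) \<le> q" for i
      proof -
        have "cmod (of_real (b i - a i) + z * of_real (w i)) \<le> cmod (of_real (b i - a i)) + cmod (z * of_real (w i))"
          by (rule norm_triangle_ineq)
        also have "\<dots> \<le> r + r * 1"
          using bw z unfolding norm_mult norm_of_real by (intro add_mono mult_mono) (auto intro: less_imp_le)
        finally show ?thesis using r by simp
      qed
      hence "(\<Prod>i\<in>UNIV. cmod ((of_real (b i - a i) + z * of_real (w i)) ^ \<alpha> i)) \<le> (\<Prod>i\<in>UNIV. q ^ \<alpha> i)"
        by (intro prod_mono) (auto simp: norm_power intro!: power_mono)
      thus ?thesis unfolding F_def m_def norm_mult norm_of_real prod_norm[symmetric]
        by (intro mult_left_mono) auto
    qed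
    have ul: "uniform_limit (cball 0 r) (\<lambda>X z. \<Sum>\<alpha>\<in>X. F \<alpha> z) g (finite_subsets_at_top UNIV)"
      unfolding g_def using Fm msum by (intro Weierstrass_m_test_general) auto
    have hol: "g holomorphic_on ball 0 r"
    proof (rule holomorphic_uniform_limit[OF _ ul])
      show "\<forall>\<^sub>F X in finite_subsets_at_top UNIV. continuous_on (cball 0 r) (\<lambda>z. \<Sum>\<alpha>\<in>X. F \<alpha> z)
          \<and> (\<lambda>z. \<Sum>\<alpha>\<in>X. F \<alpha> z) holomorphic_on ball 0 r"
        unfolding F_def by (intro always_eventually allI conjI continuous_intros holomorphic_intros)
    qed auto
    have real: "g (of_real t) = of_real (v (\<lambda>i. b i + t * w i))" if t: "\<bar>t\<bar> < r" for t
    proof -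
      have "\<bar>b i + t * w i - a i\<bar> < R" for i
      proof -
        have "\<bar>t * w i\<bar> \<le> r * 1" using t bw unfolding abs_mult by (intro mult_mono) auto
        moreover have "\<bar>b i - a i\<bar> < r" using bw by blast
        ultimately show ?thesis using r by linarith
      qed
      hence "((\<lambda>\<alpha>. of_real (c \<alpha> * (\<Prod>i\<in>UNIV. (b i + t * w i - a i) ^ \<alpha> i))) has_sum (of_real (v (\<lambda>i. b i + t * w i)) :: complex)) UNIV"
        using hs[of "\<lambda>i. b i + t * w i"] by (intro has_sum_of_real) auto
      moreover have "of_real (c \<alpha> * (\<Prod>i\<in>UNIV. (b i + t * w i - a i) ^ \<alpha> i)) = F \<alpha> (of_real t)" for \<alpha>
        unfolding F_def by (simp add: algebra_simps)
      ultimately show ?thesis unfolding g_def by (simp add: infsumI)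
    qed
    have bd: "cmod (g z) \<le> B" if z: "z \<in> ball 0 r" for z
    proof -
      have "cmod (g z) \<le> (\<Sum>\<^sub>\<infinity>\<alpha>\<in>UNIV. cmod (F \<alpha> z))"
        unfolding g_def by (rule norm_infsum_bound)
          (use Fm z in \<open>auto intro!: summable_on_comparison_test[OF msum]\<close>)
      also have "\<dots> \<le> B" unfolding B_def
        using Fm z by (intro infsum_mono msum) (auto intro!: summable_on_comparison_test[OF msum])
      finally show ?thesis .
    qed
    show "extends_along v r B b w" unfolding extends_along_def using hol real bd by blast
  qed
qed

text \<open>Periodicity brings the base point into the closed unit cube, and compactness reduces the
  local radii and bounds to finitely many.\<close>

lemma real_analytic_line_extension:
  fixes v :: "('i::finite \<Rightarrow> real) \<Rightarrow> real"
  assumes an: "real_analytic v" and per: "periodic1 v"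
  obtains r B where "r > 0" "line_extension v r B"
proof -
  have mono: "extends_along v r' B' b w" if "extends_along v r B b w" "r' \<le> r" "B \<le> B'" for r r' B B' b w
  proof -
    from that(1) obtain g where g: "g holomorphic_on ball 0 r" "\<And>t. \<bar>t\<bar> < r \<Longrightarrow> g (of_real t) = of_real (v (\<lambda>i. b i + t * w i))"
      "\<And>z. z \<in> ball 0 r \<Longrightarrow> cmod (g z) \<le> B" unfolding extends_along_def by blast
    have sub: "ball (0::complex) r' \<subseteq> ball 0 r" using that(2) by auto
    show ?thesis unfolding extends_along_def
    proof (intro exI[of _ g] conjI allI impI ballI)
      show "g holomorphic_on ball 0 r'" using g(1) sub by (rule holomorphic_on_subset)
      show "cmod (g z) \<le> B'" if "z \<in> ball 0 r'" for z
        using g(3)[of z] sub that \<open>B \<le> B'\<close> by fastforce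
    qed (use g(2) that(2) in auto)
  qed
  define K :: "(real^'i) set" where "K = cbox 0 1"
  have "\<forall>a::real^'i. \<exists>r>0. \<exists>B. \<forall>b w. (\<forall>i. \<bar>b i - a $ i\<bar> < r) \<and> (\<forall>i. \<bar>w i\<bar> \<le> 1) \<longrightarrow> extends_along v r B b w"
    using real_analytic_local_extension[OF an] by blast
  then obtain r B where r: "\<And>a::real^'i. r a > 0"
    and ext: "\<And>(a::real^'i) b w. (\<forall>i. \<bar>b i - a $ i\<bar> < r a) \<Longrightarrow> (\<forall>i. \<bar>w i\<bar> \<le> 1) \<Longrightarrow> extends_along v (r a) (B a) b w"
    by metis
  have "K \<subseteq> (\<Union>a\<in>K. ball a (r a))" using r by force
  moreover have "compact K" by (simp add: K_def)
  ultimately obtain D where D: "D \<subseteq> K" "finite D" "K \<subseteq> (\<Union>a\<in>D. ball a (r a))"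
    using compactE_image[of K K "\<lambda>a. ball a (r a)"] by (metis open_ball)
  have "0 \<in> K" by (simp add: K_def mem_box_cart)
  hence Dne: "D \<noteq> {}" using D by auto
  define r0 B0 where "r0 = Min (r ` D)" and "B0 = Max (B ` D)"
  have "r0 > 0" unfolding r0_def using D(2) Dne r by simp
  moreover have "line_extension v r0 B0"
    unfolding line_extension_def
  proof (intro allI impI)
    fix b w :: "'i \<Rightarrow> real" assume w: "\<forall>i. \<bar>w i\<bar> \<le> 1"
    define x :: "real^'i" where "x = (\<chi> i. tmod b i)"
    have "x \<in> K" unfolding K_def mem_box_cart x_def
      by (auto simp: tmod_def less_imp_le[OF frac_lt_1])
    then obtain a where a: "a \<in> D" "x \<in> ball a (r a)" using D by blast
    have "\<bar>tmod b i - a $ i\<bar> < r a" for i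
    proof -
      have "\<bar>(x - a) $ i\<bar> \<le> norm (x - a)" by (rule component_le_norm_cart)
      also have "\<dots> < r a" using a(2) by (simp add: dist_norm norm_minus_commute)
      finally show ?thesis by (simp add: x_def)
    qed
    hence "extends_along v (r a) (B a) (tmod b) w" using ext w by blast
    hence "extends_along v r0 B0 (tmod b) w"
      by (rule mono) (use a D in \<open>auto simp: r0_def B0_def\<close>)
    thus "extends_along v r0 B0 b w" unfolding extends_along_def periodic1_tmod[OF per] .
  qed
  ultimately show ?thesis by (rule that)
qed

text \<open>The Schwarz lemma applied to the rescaled increment of \<open>g\<close>. The extra 1 in
  \<open>2 * B + 1\<close> makes the normalised function strictly smaller than 1, also when
  \<open>B\<close> is 0.\<close>

lemma holomorphic_lipschitz_at_center:
  fixes g :: "complex \<Rightarrow> complex"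
  assumes hol: "g holomorphic_on ball 0 r" and r: "r > 0" and bd: "\<And>z. z \<in> ball 0 r \<Longrightarrow> cmod (g z) \<le> B"
    and z: "z \<in> ball 0 r"
  shows "cmod (g z - g 0) \<le> (2 * B + 1) / r * cmod z"
proof -
  have B: "B \<ge> 0" using bd[of 0] r norm_ge_zero[of "g 0"] by simp (meson norm_ge_zero order_trans)
  define \<phi> where "\<phi> = (\<lambda>w. (g (of_real r * w) - g 0) / of_real (2 * B + 1))"
  have sc: "of_real r * w \<in> ball 0 r" if "cmod w < 1" for w :: complex
    using that r by (simp add: norm_mult)
  have "\<phi> holomorphic_on ball 0 1"
  proof -
    have "(g \<circ> (\<lambda>w. of_real r * w)) holomorphic_on ball 0 1"
      by (rule holomorphic_on_compose_gen[OF _ hol]) (use sc in \<open>auto intro!: holomorphic_intros\<close>)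
    thus ?thesis unfolding \<phi>_def o_def using B by (intro holomorphic_intros) (auto simp flip: of_real_add of_real_mult)
  qed
  moreover have "cmod (\<phi> w) < 1" if "cmod w < 1" for w
  proof -
    have "cmod (g (of_real r * w) - g 0) \<le> cmod (g (of_real r * w)) + cmod (g 0)" by (rule norm_triangle_ineq4)
    also have "\<dots> \<le> B + B" using bd[OF sc[OF that]] bd[of 0] r by (intro add_mono) auto
    also have "\<dots> < 2 * B + 1" by simp
    finally show ?thesis unfolding \<phi>_def norm_divide norm_of_real using B by simp
  qed
  moreover have "\<phi> 0 = 0" by (simp add: \<phi>_def)
  moreover have z1: "cmod (z / of_real r) < 1" using z r by (simp add: norm_divide)
  ultimately have "cmod (\<phi> (z / of_real r)) \<le> cmod (z / of_real r)"
    using Schwarz_Lemma(1)[of \<phi> "z / of_real r"] by blast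
  hence "cmod (g z - g 0) / (2 * B + 1) \<le> cmod z / r"
    unfolding \<phi>_def norm_divide norm_of_real using B r by simp
  thus ?thesis using B r by (simp add: field_simps)
qed

section \<open>Resolvent expansion over windows\<close>

text \<open>Covariance: the Toeplitz part is translation invariant, and moving the region by
  \<open>k\<close> moves the phase by \<open>k\<close> times the frequency, reduced modulo 1 by
  periodicity. Goodness, which concerns regions centred at 0, thereby applies to all
  windows.\<close>

lemma hmat_translate:
  assumes per: "periodic1 v"
  shows "hmat blk s v lam \<omega> E x (\<lambda>i. n i + k i) (\<lambda>i. m i + k i) = hmat blk s v lam \<omega> E (tmod (shift blk \<omega> k x)) n m"
proof -
  have "v (shift blk \<omega> n (tmod (shift blk \<omega> k x))) = v (shift blk \<omega> (\<lambda>i. n i + k i) x)"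
  proof -
    let ?y = "shift blk \<omega> n (tmod (shift blk \<omega> k x))"
    have "v (\<lambda>i. ?y i + real_of_int \<lfloor>shift blk \<omega> k x i\<rfloor>) = v ?y"
      using per unfolding periodic1_def by (elim allE)
    moreover have "(\<lambda>i. ?y i + real_of_int \<lfloor>shift blk \<omega> k x i\<rfloor>) = shift blk \<omega> (\<lambda>i. n i + k i) x"
      by (auto simp: shift_def tmod_def frac_def algebra_simps)
    ultimately show ?thesis by simp
  qed
  moreover have "(\<lambda>i. n i + k i) = (\<lambda>i. m i + k i) \<longleftrightarrow> n = m"
    by (auto simp: fun_eq_iff)
  ultimately show ?thesis unfolding hmat_def by auto
qed

lemma is_inverse_on_translateZ:
  assumes "is_inverse_on Q A G"
    and A: "\<And>n m. A' (\<lambda>i. n i + k i) (\<lambda>i. m i + k i) = A n m"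
  shows "is_inverse_on (translateZ k Q) A' (\<lambda>n m. G (\<lambda>i. n i - k i) (\<lambda>i. m i - k i))"
proof -
  have inj: "inj_on (\<lambda>n i. n i + k i) Q" by (auto simp: inj_on_def fun_eq_iff)
  have "(\<lambda>i. n i + k i) = (\<lambda>i. m i + k i) \<longleftrightarrow> n = m" for n m :: "'a \<Rightarrow> int"
    by (auto simp: fun_eq_iff)
  thus ?thesis
    using assms(1) unfolding is_inverse_on_def by (auto simp: sum.reindex[OF inj] A)
qed

text \<open>Summing the resolvent identity over windows: the exponential decay inside a window beats the
  crude count of lattice points because the windows have at least logarithmic size.\<close>

lemma bounded_below_on_hmat_cover:
  fixes U :: "('d::finite \<Rightarrow> int) set" and N K \<rho> :: real
  assumes U: "finite U" "real (card U) \<le> K" and N: "N \<ge> 0" and rho: "\<rho> > 0" and rb: "\<rho> / 2 \<le> rb" "rb \<le> \<rho>"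
    and lam: "lam > 1" and per: "periodic1 v"
    and s_decay: "\<And>m. cmod (s m) \<le> exp (- \<rho> * normZ m)"
    and cov: "\<And>k. k \<in> U \<Longrightarrow> \<exists>W\<in>elem N. k \<in> W \<and> W \<subseteq> U \<and> (\<forall>m\<in>U - W. N / 2 \<le> normZ (\<lambda>i. k i - m i))"
    and gd: "\<And>k. k \<in> U \<Longrightarrow> good blk s v lam \<omega> rb N E (tmod (shift blk \<omega> k x))"
    and small: "K * (2 * N + 1) ^ CARD('d) * exp (sqrt N - \<rho> * N / 4) \<le> 1/2"
  shows "bounded_below_on U (hmat blk s v lam \<omega> E x) (2 * ((2 * N + 1) ^ CARD('d) * exp (sqrt N)))"
proof (rule bounded_below_on_cover[OF U(1)])
  fix k assume k: "k \<in> U"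
  obtain W where W: "W \<in> elem N" "k \<in> W" "W \<subseteq> U" "\<And>m. m \<in> U - W \<Longrightarrow> N / 2 \<le> normZ (\<lambda>i. k i - m i)"
    using cov[OF k] by blast
  obtain Q k0 where Q: "Q \<in> elem0 N" and WQ: "W = translateZ k0 Q" using W(1) by (auto simp: elem_def)
  \<comment> \<open>Goodness is needed at the centre of the window, not at \<open>k\<close>. Every
    elementary region contains its centre, so \<open>k0\<close> lies in \<open>U\<close> and the
    hypothesis covers it.\<close>
  have "k0 \<in> W" unfolding WQ mem_translateZ using zero_in_elem0[OF Q N] by simp
  define x0 where "x0 = tmod (shift blk \<omega> k0 x)"
  have gd0: "good blk s v lam \<omega> rb N E x0" unfolding x0_def using gd \<open>k0 \<in> W\<close> W by blast
  define G0 where "G0 = greens blk s v lam \<omega> E x0 Q"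
  have gn: "gnorm blk s v lam \<omega> E x0 Q \<le> ereal (exp (sqrt N))" using gd0 Q unfolding good_def by blast
  have invb: "invertible_on Q (hmat blk s v lam \<omega> E x0)"
  proof (rule ccontr)
    assume "\<not> ?thesis"
    hence "gnorm blk s v lam \<omega> E x0 Q = \<infinity>" by (simp add: gnorm_def)
    with gn show False by simp
  qed
  hence inv0: "is_inverse_on Q (hmat blk s v lam \<omega> E x0) G0"
    unfolding G0_def greens_def by (rule is_inverse_on_inv_on)
  have finQ: "finite Q" using finite_subset[OF elem0_subset[OF Q] finite_cubeZ] .
  have G0n: "cmod (G0 n m) \<le> exp (sqrt N)" if "n \<in> Q" "m \<in> Q" for n m
  proof -
    have "cmod (G0 n m) \<le> opnorm_on Q G0" using finQ that by (rule cmod_entry_le_opnorm_on)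
    also have "\<dots> \<le> exp (sqrt N)" using gn invb by (simp add: gnorm_def G0_def)
    finally show ?thesis .
  qed
  have G0d: "cmod (G0 n m) \<le> exp (- rb * normZ (\<lambda>i. n i - m i))" if "n \<in> Q" "m \<in> Q" "normZ (\<lambda>i. n i - m i) \<ge> N / 10" for n m
    using gd0 Q that unfolding good_def G0_def by blast
  define G where "G = (\<lambda>n m. G0 (\<lambda>i. n i - k0 i) (\<lambda>i. m i - k0 i))"
  have inv: "is_inverse_on W (hmat blk s v lam \<omega> E x) G"
    unfolding WQ G_def by (rule is_inverse_on_translateZ[OF inv0]) (simp add: hmat_translate[OF per] x0_def)
  have Gn: "cmod (G n m) \<le> exp (sqrt N)" if "n \<in> W" "m \<in> W" for n m
    using that unfolding WQ mem_translateZ G_def by (rule G0n)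
  have Gd: "cmod (G n m) \<le> exp (- rb * normZ (\<lambda>i. n i - m i))" if "n \<in> W" "m \<in> W" "normZ (\<lambda>i. n i - m i) \<ge> N / 10" for n m
    using G0d[of "\<lambda>i. n i - k0 i" "\<lambda>i. m i - k0 i"] that unfolding WQ mem_translateZ G_def by simp
  have cW: "real (card W) \<le> (2 * N + 1) ^ CARD('d)" by (rule card_elem[OF W(1) N])
  have "(\<Sum>n\<in>W. cmod (G k n)) \<le> (\<Sum>n\<in>W. exp (sqrt N))" using Gn W by (intro sum_mono) auto
  also have "\<dots> \<le> (2 * N + 1) ^ CARD('d) * exp (sqrt N)" using cW by simp
  finally have c1: "(\<Sum>n\<in>W. cmod (G k n)) \<le> (2 * N + 1) ^ CARD('d) * exp (sqrt N)" .
  have tm: "cmod (G k n) * cmod (hmat blk s v lam \<omega> E x n m) \<le> exp (sqrt N - \<rho> * N / 4)"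
    if n: "n \<in> W" and m: "m \<in> U - W" for n m
  proof -
    have "n \<noteq> m" using n m by auto
    hence "cmod (hmat blk s v lam \<omega> E x n m) = cmod (s (\<lambda>i. n i - m i)) / lam"
      using lam by (simp add: hmat_def norm_divide)
    also have "\<dots> \<le> cmod (s (\<lambda>i. n i - m i))" using lam divide_left_mono[of 1 lam "cmod (s (\<lambda>i. n i - m i))"] by simp
    also have "\<dots> \<le> exp (- \<rho> * normZ (\<lambda>i. n i - m i))" by (rule s_decay)
    finally have A: "cmod (hmat blk s v lam \<omega> E x n m) \<le> exp (- \<rho> * normZ (\<lambda>i. n i - m i))" .
    define p q where "p = normZ (\<lambda>i. k i - n i)" and "q = normZ (\<lambda>i. n i - m i)"
    have pq: "N / 2 \<le> p + q" "p \<ge> 0" "q \<ge> 0"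
      using W(4)[OF m] normZ_triangle[of k m n] normZ_nonneg unfolding p_def q_def by (auto intro: order_trans)
    show ?thesis
    proof (cases "N / 10 \<le> p")
      case True
      have "cmod (G k n) * cmod (hmat blk s v lam \<omega> E x n m) \<le> exp (- rb * p) * exp (- \<rho> * q)"
        using Gd[of k n] A W(2) n True unfolding p_def q_def by (intro mult_mono) auto
      also have "\<dots> = exp (- (rb * p + \<rho> * q))" by (simp add: exp_add[symmetric])
      also have "\<dots> \<le> exp (sqrt N - \<rho> * N / 4)"
      proof -
        have "\<rho> / 2 * p \<le> rb * p" using rb pq by (intro mult_right_mono)
        moreover have "\<rho> / 2 * q \<le> \<rho> * q" using rho pq by (intro mult_right_mono) auto
        moreover have "\<rho> / 2 * (N / 2) \<le> \<rho> / 2 * (p + q)" using pq rho by (intro mult_left_mono) auto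
        ultimately have "\<rho> * N / 4 \<le> rb * p + \<rho> * q" by (simp add: algebra_simps)
        moreover have "sqrt N \<ge> 0" using N by simp
        ultimately show ?thesis unfolding exp_le_cancel_iff by linarith
      qed
      finally show ?thesis .
    next
      \<comment> \<open>Within N / 10 of \<open>k\<close> only the norm of the window inverse is
        under control. But then \<open>m\<close> is at distance at least 2 N / 5 from
        \<open>n\<close>, and the decay of the Toeplitz part suffices.\<close>
      case False
      have "cmod (G k n) * cmod (hmat blk s v lam \<omega> E x n m) \<le> exp (sqrt N) * exp (- \<rho> * q)"
        using Gn[of k n] A W(2) n unfolding q_def by (intro mult_mono) auto
      also have "\<dots> = exp (sqrt N - \<rho> * q)" by (simp add: exp_add[symmetric])
      also have "\<dots> \<le> exp (sqrt N - \<rho> * N / 4)"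
      proof -
        have "N / 4 \<le> q" using False pq N by simp
        hence "\<rho> * (N / 4) \<le> \<rho> * q" using rho by (intro mult_left_mono) auto
        thus ?thesis by simp
      qed
      finally show ?thesis .
    qed
  qed
  have "(\<Sum>n\<in>W. \<Sum>m\<in>U - W. cmod (G k n) * cmod (hmat blk s v lam \<omega> E x n m))
     \<le> (\<Sum>n\<in>W. \<Sum>m\<in>U - W. exp (sqrt N - \<rho> * N / 4))"
    using tm by (intro sum_mono) auto
  also have "\<dots> = real (card (U - W)) * real (card W) * exp (sqrt N - \<rho> * N / 4)" by simp
  also have "\<dots> \<le> K * (2 * N + 1) ^ CARD('d) * exp (sqrt N - \<rho> * N / 4)"
  proof (intro mult_right_mono mult_mono cW)
    have "real (card (U - W)) \<le> real (card U)" using U by (simp add: card_mono)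
    thus "real (card (U - W)) \<le> K" using U(2) by simp
    show "K \<ge> 0" using U(2) of_nat_0_le_iff[of "card U"] by linarith
  qed (use N in auto)
  also have "\<dots> \<le> 1/2" by (rule small)
  finally show "\<exists>W G. k \<in> W \<and> W \<subseteq> U \<and> is_inverse_on W (hmat blk s v lam \<omega> E x) G
       \<and> (\<Sum>n\<in>W. cmod (G k n)) \<le> (2 * N + 1) ^ CARD('d) * exp (sqrt N)
       \<and> (\<Sum>n\<in>W. \<Sum>m\<in>U - W. cmod (G k n) * cmod (hmat blk s v lam \<omega> E x n m)) \<le> 1/2"
    using W inv c1 by blast
qed

section \<open>The matrix-valued Cartan estimate\<close>

text \<open>The inverse on \<open>U\<close> is written as adjugate over determinant, not as the
  chosen inverse \<open>inv_on\<close>, so that the value is visibly a rational function of the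
  entries.\<close>

definition schur_det :: "'a set \<Rightarrow> 'a set \<Rightarrow> ('a \<Rightarrow> 'a \<Rightarrow> complex) \<Rightarrow> complex" where
  "schur_det U V A = det_on V (schur U A (\<lambda>k l. adj_on U A k l / det_on U A))"

lemma schur_det_closure:
  assumes fin: "finite U" "finite V" and const: "\<And>c. P (\<lambda>_. c)"
    and add: "\<And>f g. P f \<Longrightarrow> P g \<Longrightarrow> P (\<lambda>t. f t + g t)"
    and mult: "\<And>f g. P f \<Longrightarrow> P g \<Longrightarrow> P (\<lambda>t. f t * g t)"
    and div: "\<And>f. P f \<Longrightarrow> P (\<lambda>t. f t / det_on U (A t))"
    and ent: "\<And>n m. n \<in> U \<union> V \<Longrightarrow> m \<in> U \<union> V \<Longrightarrow> P (\<lambda>t. A t n m)"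
  shows "P (\<lambda>t. schur_det U V (A t))"
proof -
  have sum: "P (\<lambda>t. \<Sum>x\<in>X. f x t)" if "finite X" "\<And>x. x \<in> X \<Longrightarrow> P (f x)" for X and f :: "_ \<Rightarrow> _ \<Rightarrow> complex"
    using that
  proof (induction X rule: finite_induct)
    case empty thus ?case using const[of 0] by simp
  next
    case (insert x X)
    have "P (\<lambda>t. f x t + (\<Sum>x\<in>X. f x t))" by (rule add) (use insert in auto)
    thus ?case using insert.hyps by simp
  qed
  have sch: "P (\<lambda>t. schur U (A t) (\<lambda>k l. adj_on U (A t) k l / det_on U (A t)) n m)" if nm: "n \<in> V" "m \<in> V" for n m
  proof -
    have "P (\<lambda>t. A t n m + (-1) * (\<Sum>k\<in>U. \<Sum>l\<in>U. A t n k * (adj_on U (A t) k l / det_on U (A t)) * A t l m))"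
    proof (rule add[OF _ mult[OF const sum[OF fin(1) sum[OF fin(1)]]]])
      show "P (\<lambda>t. A t n m)" using ent nm by auto
      fix k l assume kl: "k \<in> U" "l \<in> U"
      show "P (\<lambda>t. A t n k * (adj_on U (A t) k l / det_on U (A t)) * A t l m)"
      proof (rule mult[OF mult[OF _ div[OF adj_on_closure[OF fin(1) const add mult]]]])
        show "P (\<lambda>t. A t n k)" "P (\<lambda>t. A t l m)" using ent nm kl by auto
      qed (use ent kl in auto)
    qed
    thus ?thesis by (simp add: schur_def)
  qed
  show ?thesis unfolding schur_det_def
    by (rule det_on_closure[OF fin(2) const add mult]) (auto intro: sch)
qed

lemma cmod_schur_le:
  fixes B \<beta> :: real
  assumes U: "finite U" and inv: "is_inverse_on U A G" and b: "bounded_below_on U A \<beta>"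
    and B: "\<And>n m. n \<in> U \<union> V \<Longrightarrow> m \<in> U \<union> V \<Longrightarrow> cmod (A n m) \<le> B" and B0: "B \<ge> 0" "\<beta> \<ge> 0"
    and nm: "n \<in> V" "m \<in> V"
  shows "cmod (schur U A G n m) \<le> B + real (card U) ^ 2 * (B * \<beta> * B)"
proof -
  have "cmod (schur U A G n m) \<le> cmod (A n m) + cmod (\<Sum>k\<in>U. \<Sum>l\<in>U. A n k * G k l * A l m)"
    unfolding schur_def by (rule norm_triangle_ineq4)
  also have "cmod (\<Sum>k\<in>U. \<Sum>l\<in>U. A n k * G k l * A l m) \<le> (\<Sum>k\<in>U. \<Sum>l\<in>U. B * \<beta> * B)"
    using B nm B0 bounded_below_on_inverse_entry[OF U inv b]
    by (intro sum_norm_le) (auto simp: norm_mult intro!: mult_mono)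
  also have "\<dots> = real (card U) ^ 2 * (B * \<beta> * B)" by (simp add: power2_eq_square)
  finally show ?thesis using B[of n m] nm by simp
qed

text \<open>The radius 9 contains the closed disc of radius 8 that the ray estimate asks for. The
  lower bound on \<open>U\<close> is required at complex parameters too: it keeps the Schur
  complement free of poles.\<close>

definition extends_on_line :: "'a set \<Rightarrow> 'a set \<Rightarrow> real \<Rightarrow> real \<Rightarrow> (real \<Rightarrow> 'a \<Rightarrow> 'a \<Rightarrow> complex) \<Rightarrow> bool" where
  "extends_on_line L U B \<beta> A \<longleftrightarrow> (\<exists>Ac. (\<forall>n\<in>L. \<forall>m\<in>L. (\<lambda>z. Ac z n m) holomorphic_on ball 0 9
        \<and> (\<forall>t. \<bar>t\<bar> < 9 \<longrightarrow> Ac (complex_of_real t) n m = A t n m))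
      \<and> (\<forall>z\<in>ball 0 9. bounded_below_on U (Ac z) \<beta> \<and> (\<forall>n\<in>L. \<forall>m\<in>L. cmod (Ac z n m) \<le> B)))"

lemma extends_on_lineE:
  assumes "extends_on_line L U B \<beta> A"
  obtains Ac where "\<And>n m. n \<in> L \<Longrightarrow> m \<in> L \<Longrightarrow> (\<lambda>z. Ac z n m) holomorphic_on ball 0 9"
    "\<And>n m t. n \<in> L \<Longrightarrow> m \<in> L \<Longrightarrow> \<bar>t\<bar> < 9 \<Longrightarrow> Ac (complex_of_real t) n m = A t n m"
    "\<And>z. z \<in> ball 0 9 \<Longrightarrow> bounded_below_on U (Ac z) \<beta>"
    "\<And>z. z \<in> ball 0 9 \<Longrightarrow> \<forall>n\<in>L. \<forall>m\<in>L. cmod (Ac z n m) \<le> B"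
proof -
  from assms obtain Ac where Ac: "\<forall>n\<in>L. \<forall>m\<in>L. (\<lambda>z. Ac z n m) holomorphic_on ball 0 9
        \<and> (\<forall>t. \<bar>t\<bar> < 9 \<longrightarrow> Ac (complex_of_real t) n m = A t n m)"
      "\<forall>z\<in>ball 0 9. bounded_below_on U (Ac z) \<beta> \<and> (\<forall>n\<in>L. \<forall>m\<in>L. cmod (Ac z n m) \<le> B)"
    unfolding extends_on_line_def by (elim exE conjE)
  show ?thesis by (rule that[of Ac]) (use Ac in auto)
qed

text \<open>The ray estimate is applied to the determinant of the Schur complement, normalised at
  \<open>y0\<close>. Its upper bound \<open>p\<close> is the Leibniz formula; its lower bound at
  \<open>y0\<close> comes from det S * det S^(-1) = 1, since the entries of S^(-1) are at most
  \<beta>3 there. Off the exceptional set Cramer's rule bounds the inverse of the Schur complement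
  by \<open>p\<close> over the determinant, and block elimination returns to U \<union> V.\<close>

lemma cartan_matrix:
  fixes A :: "('i \<Rightarrow> real) \<Rightarrow> 'a \<Rightarrow> 'a \<Rightarrow> complex" and B \<beta>1 \<beta>3 H \<sigma> r :: real
  assumes I: "finite I" and fin: "finite U" "finite V" and dis: "U \<inter> V = {}"
    and r: "r \<ge> 0" and y0: "y0 \<in> I \<rightarrow>\<^sub>E UNIV"
    and meas: "\<And>n m. n \<in> U \<union> V \<Longrightarrow> m \<in> U \<union> V \<Longrightarrow> (\<lambda>y. A y n m) \<in> borel_measurable (PiM I (\<lambda>_. lborel))"
    and ext: "\<And>w. w \<in> I \<rightarrow>\<^sub>E UNIV \<Longrightarrow> \<forall>i\<in>I. \<bar>w i\<bar> \<le> r \<Longrightarrow>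
        extends_on_line (U \<union> V) U B \<beta>1 (\<lambda>t. A (\<lambda>i\<in>I. y0 i + t * w i))"
    and b3: "bounded_below_on (U \<union> V) (A y0) \<beta>3"
    and B: "B \<ge> 1" and \<beta>1: "\<beta>1 \<ge> 1" and \<beta>3: "\<beta>3 \<ge> 1" and H: "H \<ge> 1" and \<sigma>: "\<sigma> > 5"
    and HH: "(fact (card V))\<^sup>2 * ((B + real (card U) ^ 2 * (B * \<beta>1 * B)) * \<beta>3) ^ card V \<le> exp H"
  defines "\<beta>' \<equiv> card V * exp ((\<sigma> + 1) * H) * (1 + card U * B * \<beta>1)"
  shows "\<exists>Z\<in>sets (PiM I (\<lambda>_. lborel)).
     {y \<in> I \<rightarrow>\<^sub>E UNIV. (\<forall>i\<in>I. \<bar>y i - y0 i\<bar> \<le> r) \<and> \<not> bounded_below_on (U \<union> V) (A y) (\<beta>1 * (1 + card V * B * \<beta>') + \<beta>')} \<subseteq> Z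
     \<and> emeasure (PiM I (\<lambda>_. lborel)) Z \<le> ennreal (48 * sqrt (2 powr (5 - \<sigma>)) * (4 * r) ^ card I)"
proof -
  define M where "M = PiM I (\<lambda>_. lborel :: real measure)"
  define a where "a = B + real (card U) ^ 2 * (B * \<beta>1 * B)"
  define f where "f = (\<lambda>y. schur_det U V (A y))"
  define Z where "Z = {y \<in> space M. (\<forall>i\<in>I. \<bar>y i - y0 i\<bar> \<le> r) \<and> cmod (f y) \<le> exp (- \<sigma> * H) * cmod (f y0)}"
  have a1: "a \<ge> 1" unfolding a_def using B \<beta>1 by (intro order_trans[OF B]) auto
  define p where "p = fact (card V) * a ^ card V"
  have p1: "p \<ge> 1" unfolding p_def using a1 mult_mono[of 1 "fact (card V) :: real" 1 "a ^ card V"]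
    by (simp add: fact_ge_1)
  \<comment> \<open>Every real point of the cube is the point with parameter \<open>t = 1\<close> on
    some admissible line, so the hypothesis on lines also gives the bounds for the real
    matrices.\<close>
  have line: "bounded_below_on U (A y) \<beta>1 \<and> (\<forall>n\<in>U \<union> V. \<forall>m\<in>U \<union> V. cmod (A y n m) \<le> B)"
    if y: "y \<in> I \<rightarrow>\<^sub>E UNIV" "\<forall>i\<in>I. \<bar>y i - y0 i\<bar> \<le> r" for y
  proof -
    define w where "w = (\<lambda>i\<in>I. y i - y0 i)"
    have w: "w \<in> I \<rightarrow>\<^sub>E UNIV" "\<forall>i\<in>I. \<bar>w i\<bar> \<le> r" using y by (auto simp: w_def)
    have yw: "(\<lambda>i\<in>I. y0 i + 1 * w i) = y" using y by (auto simp: w_def fun_eq_iff PiE_def extensional_def)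
    from ext[OF w] obtain Ac where
      "\<And>n m. n \<in> U \<union> V \<Longrightarrow> m \<in> U \<union> V \<Longrightarrow> (\<lambda>z. Ac z n m) holomorphic_on ball 0 9"
      and e: "\<And>n m t. n \<in> U \<union> V \<Longrightarrow> m \<in> U \<union> V \<Longrightarrow> \<bar>t\<bar> < 9 \<Longrightarrow> Ac (complex_of_real t) n m = A (\<lambda>i\<in>I. y0 i + t * w i) n m"
      and b: "\<And>z. z \<in> ball 0 9 \<Longrightarrow> bounded_below_on U (Ac z) \<beta>1"
        "\<And>z. z \<in> ball 0 9 \<Longrightarrow> \<forall>n\<in>U \<union> V. \<forall>m\<in>U \<union> V. cmod (Ac z n m) \<le> B"
      by (rule extends_on_lineE) (rule that)
    have eq: "Ac 1 n m = A y n m" if "n \<in> U \<union> V" "m \<in> U \<union> V" for n m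
      using e[OF that, of 1] yw by simp
    have "bounded_below_on U (Ac 1) \<beta>1" "\<forall>n\<in>U \<union> V. \<forall>m\<in>U \<union> V. cmod (Ac 1 n m) \<le> B" using b[of 1] by auto
    moreover have "bounded_below_on U (Ac 1) \<beta>1 \<longleftrightarrow> bounded_below_on U (A y) \<beta>1"
      unfolding bounded_below_on_def using eq by (simp cong: sum.cong)
    ultimately show ?thesis using eq by simp
  qed
  have sd: "is_inverse_on U X (\<lambda>k l. adj_on U X k l / det_on U X)" "cmod (schur_det U V X) \<le> p"
    "\<And>n m. n \<in> V \<Longrightarrow> m \<in> V \<Longrightarrow> cmod (schur U X (\<lambda>k l. adj_on U X k l / det_on U X) n m) \<le> a"
    if X: "bounded_below_on U X \<beta>1" "\<forall>n\<in>U \<union> V. \<forall>m\<in>U \<union> V. cmod (X n m) \<le> B" for X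
  proof -
    show inv: "is_inverse_on U X (\<lambda>k l. adj_on U X k l / det_on U X)"
      by (rule is_inverse_on_adj[OF fin(1) bounded_below_on_det[OF fin(1) X(1)]])
    show s: "cmod (schur U X (\<lambda>k l. adj_on U X k l / det_on U X) n m) \<le> a" if "n \<in> V" "m \<in> V" for n m
      unfolding a_def by (rule cmod_schur_le[OF fin(1) inv X(1)]) (use X(2) B \<beta>1 that in auto)
    show "cmod (schur_det U V X) \<le> p" unfolding schur_det_def p_def by (rule cmod_det_on_le[OF fin(2) s])
  qed
  have y0r: "\<forall>i\<in>I. \<bar>y0 i - y0 i\<bar> \<le> r" using r by simp
  note l0 = line[OF y0 y0r]
  define q where "q = fact (card V) * \<beta>3 ^ card V"
  have q1: "q > 0" unfolding q_def using \<beta>3 by simp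
  have f0: "cmod (f y0) * q \<ge> 1"
  proof -
    let ?S = "schur U (A y0) (\<lambda>k l. adj_on U (A y0) k l / det_on U (A y0))"
    have bs: "bounded_below_on V ?S \<beta>3"
      by (rule bounded_below_on_schur[OF fin dis sd(1)[OF l0[THEN conjunct1] l0[THEN conjunct2]] b3])
    have inv: "is_inverse_on V ?S (\<lambda>k l. adj_on V ?S k l / det_on V ?S)"
      by (rule is_inverse_on_adj[OF fin(2) bounded_below_on_det[OF fin(2) bs]])
    have "cmod (det_on V (\<lambda>k l. adj_on V ?S k l / det_on V ?S)) \<le> q"
      unfolding q_def by (rule cmod_det_on_le[OF fin(2) bounded_below_on_inverse_entry[OF fin(2) inv bs]])
    hence "cmod (f y0) * cmod (det_on V (\<lambda>k l. adj_on V ?S k l / det_on V ?S)) \<le> cmod (f y0) * q"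
      by (rule mult_left_mono) simp
    moreover have "cmod (f y0) * cmod (det_on V (\<lambda>k l. adj_on V ?S k l / det_on V ?S)) = 1"
      unfolding f_def schur_det_def norm_mult[symmetric] det_on_inverse[OF fin(2) inv] by simp
    ultimately show ?thesis by simp
  qed
  hence f0pos: "cmod (f y0) > 0" by (cases "f y0 = 0") auto
  have pq: "p * q \<le> exp H"
    using HH unfolding p_def q_def a_def power_mult_distrib power2_eq_square by (simp add: mult_ac)
  have fm[measurable]: "f \<in> borel_measurable M"
    unfolding f_def
  proof (rule schur_det_closure[OF fin, where P = "\<lambda>f. f \<in> borel_measurable M"])
    fix g :: "('i \<Rightarrow> real) \<Rightarrow> complex" assume g: "g \<in> borel_measurable M"
    have "(\<lambda>y. det_on U (A y)) \<in> borel_measurable M"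
      by (rule det_on_closure[OF fin(1), where P = "\<lambda>f. f \<in> borel_measurable M"])
        (use meas in \<open>auto simp: M_def\<close>)
    thus "(\<lambda>y. g y / det_on U (A y)) \<in> borel_measurable M" using g by simp
  qed (use meas in \<open>auto simp: M_def\<close>)
  have Zs: "Z \<in> sets M"
  proof -
    have "(\<lambda>y. y i) \<in> borel_measurable M" if "i \<in> I" for i
      unfolding M_def using that by measurable
    thus ?thesis unfolding Z_def using I by measurable
  qed
  have "emeasure M Z \<le> ennreal (48 * sqrt (2 powr (5 - \<sigma>)) * (4 * r) ^ card I)"
    unfolding M_def
  proof (rule emeasure_le_of_rays[OF I _ r])
    show "Z \<in> sets (PiM I (\<lambda>_. lborel))" using Zs by (simp add: M_def)
    show "\<forall>i\<in>I. \<bar>y i - y0 i\<bar> \<le> r" if "y \<in> Z" for y using that by (auto simp: Z_def)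
    fix w assume w: "w \<in> I \<rightarrow>\<^sub>E UNIV" "\<forall>i\<in>I. \<bar>w i\<bar> \<le> r"
    from ext[OF w] obtain Ac where
      hol: "\<And>n m. n \<in> U \<union> V \<Longrightarrow> m \<in> U \<union> V \<Longrightarrow> (\<lambda>z. Ac z n m) holomorphic_on ball 0 9"
      and e: "\<And>n m t. n \<in> U \<union> V \<Longrightarrow> m \<in> U \<union> V \<Longrightarrow> \<bar>t\<bar> < 9 \<Longrightarrow> Ac (complex_of_real t) n m = A (\<lambda>i\<in>I. y0 i + t * w i) n m"
      and b: "\<And>z. z \<in> ball 0 9 \<Longrightarrow> bounded_below_on U (Ac z) \<beta>1"
        "\<And>z. z \<in> ball 0 9 \<Longrightarrow> \<forall>n\<in>U \<union> V. \<forall>m\<in>U \<union> V. cmod (Ac z n m) \<le> B"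
      by (rule extends_on_lineE) (rule that)
    define F where "F = (\<lambda>z. schur_det U V (Ac z) / f y0)"
    have Fr: "F (of_real t) = f (\<lambda>i\<in>I. y0 i + t * w i) / f y0" if "\<bar>t\<bar> < 9" for t
    proof -
      have "mat_on U (Ac (complex_of_real t)) = mat_on U (A (\<lambda>i\<in>I. y0 i + t * w i))"
        using e[OF _ _ that] enum_of_in[OF fin(1)] by (intro eq_matI) (auto simp: mat_on_def)
      hence 1: "det_on U (Ac (complex_of_real t)) = det_on U (A (\<lambda>i\<in>I. y0 i + t * w i))"
        "adj_on U (Ac (complex_of_real t)) = adj_on U (A (\<lambda>i\<in>I. y0 i + t * w i))"
        by (auto simp: det_on_def adj_on_def fun_eq_iff)
      have "mat_on V (schur U (Ac (complex_of_real t)) G) = mat_on V (schur U (A (\<lambda>i\<in>I. y0 i + t * w i)) G)" for G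
        using e[OF _ _ that] enum_of_in[OF fin(2)]
        by (intro eq_matI) (auto simp: mat_on_def schur_def intro!: sum.cong)
      thus ?thesis unfolding F_def f_def schur_det_def 1 det_on_def[of V] by simp
    qed
    have holF: "F holomorphic_on ball 0 9"
    proof -
      have "(\<lambda>z. schur_det U V (Ac z)) holomorphic_on ball 0 9"
      proof (rule schur_det_closure[OF fin, where P = "\<lambda>f. f holomorphic_on ball 0 9"])
        fix g :: "complex \<Rightarrow> complex" assume g: "g holomorphic_on ball 0 9"
        have "(\<lambda>z. det_on U (Ac z)) holomorphic_on ball 0 9"
          by (rule det_on_closure[OF fin(1), where P = "\<lambda>f. f holomorphic_on ball 0 9"])
            (use hol in \<open>auto intro: holomorphic_intros\<close>)
        thus "(\<lambda>z. g z / det_on U (Ac z)) holomorphic_on ball 0 9"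
          using bounded_below_on_det[OF fin(1) b(1)] g by (intro holomorphic_intros) auto
      qed (use hol in \<open>auto intro: holomorphic_intros\<close>)
      thus ?thesis unfolding F_def using f0pos by (intro holomorphic_intros) auto
    qed
    have Fb: "cmod (F z) \<le> exp H" if "z \<in> cball 0 8" for z
    proof -
      have z: "z \<in> ball 0 9" using that by auto
      have "cmod (F z) = cmod (schur_det U V (Ac z)) / cmod (f y0)" by (simp add: F_def norm_divide)
      also have "\<dots> \<le> p / cmod (f y0)" using sd(2)[OF b[OF z]] by (rule divide_right_mono) simp
      also have "\<dots> \<le> p * q"
        using f0 f0pos p1 mult_left_mono[OF f0, of p] by (simp add: field_simps)
      finally show ?thesis using pq by simp
    qed
    have F0: "cmod (F 0) \<ge> 1"
    proof -
      have "(\<lambda>i\<in>I. y0 i + 0 * w i) = y0" using y0 by (auto simp: fun_eq_iff PiE_def extensional_def)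
      thus ?thesis using Fr[of 0] f0pos by (simp add: norm_divide)
    qed
    have C: "{t\<in>{1..2}. cmod (F (of_real t)) \<le> exp (- \<sigma> * H)} \<in> sets lborel"
      "emeasure lborel {t\<in>{1..2}. cmod (F (of_real t)) \<le> exp (- \<sigma> * H)} \<le> ennreal (48 * sqrt (2 powr (5 - \<sigma>)))"
      by (rule cartan_estimate_ray[OF holF _ _ F0 H \<sigma>]; (rule Fb)?; simp)+
    have "emeasure lborel {t\<in>{1..2}. (\<lambda>i\<in>I. y0 i + t * w i) \<in> Z} \<le> emeasure lborel {t\<in>{1..2}. cmod (F (of_real t)) \<le> exp (- \<sigma> * H)}"
    proof (rule emeasure_mono)
      show "{t\<in>{1..2}. (\<lambda>i\<in>I. y0 i + t * w i) \<in> Z} \<subseteq> {t\<in>{1..2}. cmod (F (of_real t)) \<le> exp (- \<sigma> * H)}"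
        using f0pos by (auto simp: Z_def Fr norm_divide divide_le_eq)
    qed (rule C(1))
    also have "\<dots> \<le> ennreal (48 * sqrt (2 powr (5 - \<sigma>)))" by (rule C(2))
    finally show "emeasure lborel {t\<in>{1..2}. (\<lambda>i\<in>I. y0 i + t * w i) \<in> Z} \<le> ennreal (48 * sqrt (2 powr (5 - \<sigma>)))" .
  next
    show "0 \<le> 48 * sqrt (2 powr (5 - \<sigma>))" by simp
  qed
  moreover have "{y \<in> I \<rightarrow>\<^sub>E UNIV. (\<forall>i\<in>I. \<bar>y i - y0 i\<bar> \<le> r) \<and> \<not> bounded_below_on (U \<union> V) (A y) (\<beta>1 * (1 + card V * B * \<beta>') + \<beta>')} \<subseteq> Z"
  proof (rule subsetI, rule ccontr)
    fix y assume "y \<in> {y \<in> I \<rightarrow>\<^sub>E UNIV. (\<forall>i\<in>I. \<bar>y i - y0 i\<bar> \<le> r) \<and> \<not> bounded_below_on (U \<union> V) (A y) (\<beta>1 * (1 + card V * B * \<beta>') + \<beta>')}"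
    hence y: "y \<in> I \<rightarrow>\<^sub>E UNIV" "\<forall>i\<in>I. \<bar>y i - y0 i\<bar> \<le> r" and nb: "\<not> bounded_below_on (U \<union> V) (A y) (\<beta>1 * (1 + card V * B * \<beta>') + \<beta>')" by auto
    assume "y \<notin> Z"
    hence fy: "cmod (f y) > exp (- \<sigma> * H) * cmod (f y0)" using y by (auto simp: Z_def M_def space_PiM)
    note l = line[OF y]
    let ?S = "schur U (A y) (\<lambda>k l. adj_on U (A y) k l / det_on U (A y))"
    have inv: "is_inverse_on U (A y) (\<lambda>k l. adj_on U (A y) k l / det_on U (A y))" by (rule sd(1)[OF l[THEN conjunct1] l[THEN conjunct2]])
    have fyp: "cmod (f y) > 0" using fy f0pos by (smt (verit) exp_gt_zero mult_pos_pos)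
    hence dn: "det_on V ?S \<noteq> 0" by (auto simp: f_def schur_det_def)
    note invS = is_inverse_on_adj[OF fin(2) dn]
    have "cmod (adj_on V ?S n m / det_on V ?S) \<le> exp ((\<sigma> + 1) * H)" if "n \<in> V" "m \<in> V" for n m
    proof -
      have "cmod (adj_on V ?S n m) \<le> p"
        unfolding p_def by (rule cmod_adj_on_le[OF fin(2) sd(3)[OF l[THEN conjunct1] l[THEN conjunct2]] a1 that])
      hence "cmod (adj_on V ?S n m / det_on V ?S) \<le> p / cmod (f y)"
        unfolding norm_divide f_def schur_det_def by (rule divide_right_mono) simp
      also have "\<dots> \<le> p / (exp (- \<sigma> * H) * cmod (f y0))"
        using fy fyp f0pos p1 by (intro divide_left_mono) auto
      also have "\<dots> = exp (\<sigma> * H) * (p / cmod (f y0))" by (simp add: exp_minus field_simps)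
      also have "\<dots> \<le> exp (\<sigma> * H) * exp H"
      proof (rule mult_left_mono)
        have "p / cmod (f y0) \<le> p * q"
          using f0 f0pos p1 mult_left_mono[OF f0, of p] by (simp add: field_simps)
        thus "p / cmod (f y0) \<le> exp H" using pq by simp
      qed simp
      also have "\<dots> = exp ((\<sigma> + 1) * H)" by (simp add: exp_add[symmetric] algebra_simps)
      finally show ?thesis .
    qed
    from bounded_below_on_of_inverse[OF fin(2) invS this]
    have "bounded_below_on V ?S (card V * exp ((\<sigma> + 1) * H))" .
    from bounded_below_on_of_schur[OF fin dis inv _ this, of \<beta>1 B]
    have "bounded_below_on (U \<union> V) (A y) (\<beta>1 * (1 + card V * B * \<beta>') + \<beta>')"
      unfolding \<beta>'_def using l B \<beta>1 by auto
    with nb show False by simp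
  qed
  ultimately show ?thesis using Zs unfolding M_def by blast
qed

section \<open>Perturbation along a block of coordinates\<close>

definition insert_block :: "('i \<Rightarrow> 'd) \<Rightarrow> 'd \<Rightarrow> ('i \<Rightarrow> real) \<Rightarrow> ('i \<Rightarrow> real) \<Rightarrow> 'i \<Rightarrow> real" where
  "insert_block blk j x y = (\<lambda>i. if blk i = j then y i else x i)"

text \<open>A union bound over the sites, with care for the reduction modulo 1. On a cube of side 2
  r < 1 each shifted coordinate has at most two possible integer parts, so the reduction agrees
  pointwise with one of 2 ^ bsize translations. The bad points of a site are thus covered by that
  many translates of one section.\<close>

lemma exists_point_avoiding:
  fixes blk :: "'i::finite \<Rightarrow> 'd::finite" and L :: "('d \<Rightarrow> int) set"
  assumes L: "finite L" and \<epsilon>: "\<epsilon> \<ge> 0" and r: "0 < r" "2 * r < 1"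
    and sec: "\<And>x. mes_le (blockM blk j) (xsection blk X j x) \<epsilon>"
    and small: "real (card L) * 2 ^ bsize blk j * \<epsilon> < (2 * r) ^ bsize blk j"
  shows "\<exists>y\<in>{i. blk i = j} \<rightarrow>\<^sub>E UNIV. (\<forall>i. blk i = j \<longrightarrow> \<bar>y i - x i\<bar> \<le> r)
     \<and> (\<forall>k\<in>L. tmod (shift blk \<omega> k (insert_block blk j x y)) \<notin> X)"
proof (rule ccontr)
  assume neg: "\<not> ?thesis"
  define I where "I = {i. blk i = j}"
  define M where "M = PiM I (\<lambda>_. lborel :: real measure)"
  have fI: "finite I" by simp
  define Q where "Q = {y \<in> I \<rightarrow>\<^sub>E UNIV. \<forall>i\<in>I. \<bar>y i - x i\<bar> \<le> r}"
  have Q: "Q \<in> sets M" "emeasure M Q = ennreal ((2 * r) ^ card I)"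
    unfolding Q_def M_def using emeasure_PiM_lborel_cube[OF fI, of r x] r by auto
  have "\<forall>k. \<exists>Z. Z \<in> sets M \<and> xsection blk X j (tmod (shift blk \<omega> k x)) \<subseteq> Z \<and> emeasure M Z \<le> ennreal \<epsilon>"
    using sec unfolding mes_le_def blockM_def M_def I_def by blast
  then obtain Z where Z: "\<And>k. Z k \<in> sets M" "\<And>k. xsection blk X j (tmod (shift blk \<omega> k x)) \<subseteq> Z k"
    "\<And>k. emeasure M (Z k) \<le> ennreal \<epsilon>" by metis
  define fl where "fl = (\<lambda>k i. \<lfloor>x i - r + real_of_int (k j) * \<omega> i\<rfloor>)"
  define P where "P = (\<lambda>k. PiE I (\<lambda>i. {fl k i, fl k i + 1}))"
  define \<phi> where "\<phi> = (\<lambda>k m w. \<lambda>i\<in>I. (real_of_int (k j) * \<omega> i - real_of_int (m i)) + 1 * w i)"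
  define B where "B = (\<lambda>k m. \<phi> k m -` Z k \<inter> space M)"
  have Bs: "B k m \<in> sets M" for k m
    unfolding B_def \<phi>_def M_def using emeasure_PiM_lborel_affine(1)[OF fI, of 1] Z(1)[of k]
    by (intro measurable_sets) (auto simp: M_def)
  have Be: "emeasure M (B k m) \<le> ennreal \<epsilon>" for k m
  proof -
    have "emeasure M (B k m) = emeasure M (Z k)"
      using emeasure_PiM_lborel_affine(2)[OF fI, of 1 "Z k" "\<lambda>i. real_of_int (k j) * \<omega> i - real_of_int (m i)"] Z(1)[of k]
      unfolding B_def \<phi>_def M_def by simp
    thus ?thesis using Z(3) by simp
  qed
  have fP: "finite (P k)" for k unfolding P_def using fI by (intro finite_PiE) auto
  have cP: "card (P k) = 2 ^ card I" for k
    unfolding P_def using fI by (subst card_PiE) (auto simp: numeral_2_eq_2)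
  have "Q \<subseteq> (\<Union>k\<in>L. \<Union>m\<in>P k. B k m)"
  proof
    fix y assume y: "y \<in> Q"
    then obtain k where k: "k \<in> L" and bad: "tmod (shift blk \<omega> k (insert_block blk j x y)) \<in> X"
      using neg unfolding Q_def I_def by auto
    define m where "m = (\<lambda>i\<in>I. \<lfloor>y i + real_of_int (k j) * \<omega> i\<rfloor>)"
    define \<theta> where "\<theta> = (\<lambda>i\<in>I. frac (y i + real_of_int (k j) * \<omega> i))"
    \<comment> \<open>The coordinates outside block \<open>j\<close> do not depend on
      \<open>y\<close>, so one section per site serves for the whole cube.\<close>
    have "(\<lambda>i. if blk i = j then \<theta> i else tmod (shift blk \<omega> k x) i) = tmod (shift blk \<omega> k (insert_block blk j x y))"
      by (auto simp: fun_eq_iff \<theta>_def I_def tmod_def shift_def insert_block_def)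
    moreover have "\<theta> \<in> {i. blk i = j} \<rightarrow>\<^sub>E UNIV" by (simp add: \<theta>_def I_def)
    ultimately have "\<theta> \<in> xsection blk X j (tmod (shift blk \<omega> k x))"
      unfolding xsection_def using bad by simp
    hence "\<theta> \<in> Z k" using Z(2) by blast
    moreover have "\<theta> = \<phi> k m y" by (auto simp: fun_eq_iff \<theta>_def \<phi>_def m_def frac_def)
    ultimately have "y \<in> B k m" using y unfolding B_def by (auto simp: Q_def M_def space_PiM)
    moreover have "m \<in> P k" unfolding P_def
    proof (rule PiE_I)
      fix i assume i: "i \<in> I"
      have "\<bar>y i - x i\<bar> \<le> r" using y i by (auto simp: Q_def)
      hence h: "x i - r + real_of_int (k j) * \<omega> i \<le> y i + real_of_int (k j) * \<omega> i"
        "y i + real_of_int (k j) * \<omega> i < x i - r + real_of_int (k j) * \<omega> i + 1" using r by auto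
      have "fl k i \<le> m i" unfolding fl_def m_def using h(1) i by (simp add: floor_mono)
      moreover have "m i \<le> fl k i + 1"
      proof -
        have "\<lfloor>y i + real_of_int (k j) * \<omega> i\<rfloor> \<le> \<lfloor>x i - r + real_of_int (k j) * \<omega> i + 1\<rfloor>"
          using h(2) by (intro floor_mono) simp
        thus ?thesis unfolding fl_def m_def using i by simp
      qed
      ultimately show "m i \<in> {fl k i, fl k i + 1}" by auto
    qed (auto simp: m_def)
    ultimately show "y \<in> (\<Union>k\<in>L. \<Union>m\<in>P k. B k m)" using k by blast
  qed
  hence "emeasure M Q \<le> emeasure M (\<Union>k\<in>L. \<Union>m\<in>P k. B k m)"
    using L fP Bs by (intro emeasure_mono) auto
  also have "\<dots> \<le> (\<Sum>k\<in>L. emeasure M (\<Union>m\<in>P k. B k m))"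
    using L fP Bs by (intro emeasure_subadditive_finite) auto
  also have "\<dots> \<le> (\<Sum>k\<in>L. \<Sum>m\<in>P k. emeasure M (B k m))"
    using fP Bs by (intro sum_mono emeasure_subadditive_finite) auto
  also have "\<dots> \<le> (\<Sum>k\<in>L. \<Sum>m\<in>P k. ennreal \<epsilon>)"
    by (intro sum_mono Be)
  also have "\<dots> = ennreal (real (card L) * 2 ^ card I * \<epsilon>)"
    using \<epsilon> by (simp add: cP ennreal_mult ennreal_power ennreal_of_nat_eq_real_of_nat[symmetric] mult.assoc flip: ennreal_numeral)
  finally have "(2 * r) ^ card I \<le> real (card L) * 2 ^ card I * \<epsilon>"
    unfolding Q(2) using \<epsilon> by (subst (asm) ennreal_le_iff) auto
  thus False using small unfolding bsize_def I_def by simp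
qed

section \<open>Continuity, measurability and complexification of the matrix entries\<close>

lemma line_extension_bound:
  assumes "line_extension v r B" "r > 0"
  shows "\<bar>v x\<bar> \<le> B"
proof -
  obtain g where "\<And>t. \<bar>t\<bar> < r \<Longrightarrow> g (complex_of_real t) = complex_of_real (v (\<lambda>i. x i + t * 0))"
    "\<And>z. z \<in> ball 0 r \<Longrightarrow> cmod (g z) \<le> B"
    by (rule line_extensionE[OF assms(1), of "\<lambda>_. 0" x]) auto
  from this(1)[of 0] this(2)[of 0] show ?thesis using assms(2) by simp
qed

lemma line_extension_lipschitz:
  assumes ext: "line_extension v r B" and r: "r > 0" and \<delta>: "0 \<le> \<delta>" "\<delta> < r"
    and d: "\<And>i. \<bar>y i - x i\<bar> \<le> \<delta>"
  shows "\<bar>v y - v x\<bar> \<le> (2 * B + 1) / r * \<delta>"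
proof (cases "\<delta> = 0")
  case True
  hence "y = x" using d by (auto simp: fun_eq_iff)
  thus ?thesis using True by simp
next
  case False
  hence dp: "\<delta> > 0" using \<delta> by simp
  have "\<forall>i. \<bar>(y i - x i) / \<delta>\<bar> \<le> 1" using d dp by simp
  then obtain g where g: "g holomorphic_on ball 0 r"
    "\<And>t. \<bar>t\<bar> < r \<Longrightarrow> g (complex_of_real t) = complex_of_real (v (\<lambda>i. x i + t * ((y i - x i) / \<delta>)))"
    "\<And>z. z \<in> ball 0 r \<Longrightarrow> cmod (g z) \<le> B"
    by (rule line_extensionE[OF ext, where b = x]) (rule that)
  have "cmod (g (of_real \<delta>) - g 0) \<le> (2 * B + 1) / r * cmod (of_real \<delta>)"
    by (rule holomorphic_lipschitz_at_center[OF g(1) r g(3)]) (use \<delta> in auto)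
  moreover have "g (of_real \<delta>) = complex_of_real (v y)" using g(2)[of \<delta>] \<delta> dp by simp
  moreover have "g 0 = complex_of_real (v x)" using g(2)[of 0] r by simp
  ultimately show ?thesis using \<delta> by (simp flip: of_real_diff)
qed

lemma line_extension_measurable:
  fixes v :: "('i::finite \<Rightarrow> real) \<Rightarrow> real"
  assumes ext: "line_extension v r B" and r: "r > 0"
    and h: "\<And>i. (\<lambda>y. h y i) \<in> borel_measurable M"
  shows "(\<lambda>y. v (h y)) \<in> borel_measurable M"
proof -
  have B: "B \<ge> 0" using line_extension_bound[OF ext r, of "\<lambda>_. 0"] by linarith
  define C where "C = (2 * B + 1) / r"
  have C: "C > 0" using B r by (simp add: C_def)
  have "continuous_on UNIV (\<lambda>x::real^'i. v (\<lambda>i. x $ i))"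
    unfolding continuous_on_iff
  proof (intro ballI allI impI)
    fix x :: "real^'i" and e :: real assume e: "e > 0"
    show "\<exists>d>0. \<forall>x'\<in>UNIV. dist x' x < d \<longrightarrow> dist (v (\<lambda>i. x' $ i)) (v (\<lambda>i. x $ i)) < e"
    proof (intro exI[of _ "min r (e / C)"] conjI ballI impI)
      show "min r (e / C) > 0" using e r C by simp
      fix x' assume d: "dist x' x < min r (e / C)"
      have "\<bar>v (\<lambda>i. x' $ i) - v (\<lambda>i. x $ i)\<bar> \<le> C * norm (x' - x)"
        unfolding C_def
      proof (rule line_extension_lipschitz[OF ext r])
        show "norm (x' - x) < r" using d by (simp add: dist_norm)
        show "\<bar>x' $ i - x $ i\<bar> \<le> norm (x' - x)" for i
          using component_le_norm_cart[of "x' - x" i] by simp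
      qed simp
      also have "\<dots> < e" using d C by (simp add: dist_norm field_simps)
      finally show "dist (v (\<lambda>i. x' $ i)) (v (\<lambda>i. x $ i)) < e" by (simp add: dist_real_def)
    qed
  qed
  hence 1: "(\<lambda>x::real^'i. v (\<lambda>i. x $ i)) \<in> borel_measurable borel"
    by (rule borel_measurable_continuous_onI)
  have "(\<lambda>y. (\<chi> i. h y i) :: real^'i) \<in> borel_measurable M"
    unfolding borel_measurable_euclidean_space[where 'c = "real^'i"]
    by (auto simp: Basis_vec_def inner_axis h)
  from measurable_compose[OF this 1] show ?thesis by simp
qed

lemma hmat_measurable:
  fixes v :: "('i::finite \<Rightarrow> real) \<Rightarrow> real"
  assumes ext: "line_extension v r B" and r: "r > 0"
  shows "(\<lambda>y. hmat blk s v lam \<omega> E (insert_block blk j x y) n m) \<in> borel_measurable (PiM {i. blk i = j} (\<lambda>_. lborel))"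
proof -
  have "(\<lambda>y. v (shift blk \<omega> n (insert_block blk j x y))) \<in> borel_measurable (PiM {i. blk i = j} (\<lambda>_. lborel))"
  proof (rule line_extension_measurable[OF ext r])
    fix i
    show "(\<lambda>y. shift blk \<omega> n (insert_block blk j x y) i) \<in> borel_measurable (PiM {i. blk i = j} (\<lambda>_. lborel))"
      by (cases "blk i = j") (auto simp: shift_def insert_block_def)
  qed
  thus ?thesis unfolding hmat_def by (cases "n = m") auto
qed

lemma cmod_toeplitz_le:
  assumes lam: "lam > 1" and s_decay: "\<And>m. cmod (s m) \<le> exp (- \<rho> * normZ m)" and rho: "\<rho> > 0"
  shows "cmod (s m / complex_of_real lam) \<le> 1"
proof -
  have "cmod (s m) \<le> exp (- \<rho> * normZ m)" by (rule s_decay)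
  also have "\<dots> \<le> 1" using rho normZ_nonneg[of m] by simp
  finally show ?thesis using lam by (simp add: norm_divide field_simps)
qed

text \<open>Dividing \<open>w\<close> by \<open>r\<close> gives a direction admissible for the
  potential, the complex parameter being scaled by \<open>r\<close> in exchange. The Toeplitz
  entries stay constant, so the perturbation is diagonal and its row sums do not grow with the
  volume.\<close>

lemma hmat_line_extension:
  fixes blk :: "'i::finite \<Rightarrow> 'd::finite"
  assumes ext: "line_extension v r0 B0" and r0: "r0 > 0" and r: "0 < r" "9 * r < r0"
    and lam: "lam > 1" and s_decay: "\<And>m. cmod (s m) \<le> exp (- \<rho> * normZ m)" and rho: "\<rho> > 0"
    and w: "\<forall>i\<in>{i. blk i = j}. \<bar>w i\<bar> \<le> r"
  shows "\<exists>Ac. (\<forall>n m. (\<lambda>z. Ac z n m) holomorphic_on ball 0 9) \<and>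
        (\<forall>n m. \<forall>t. \<bar>t\<bar> < 9 \<longrightarrow> Ac (complex_of_real t) n m
           = hmat blk s v lam \<omega> E (insert_block blk j x (\<lambda>i\<in>{i. blk i = j}. y0 i + t * w i)) n m) \<and>
        (\<forall>z\<in>ball 0 9. \<forall>n m. cmod (Ac z n m) \<le> 1 + B0 + \<bar>E\<bar> \<and>
           cmod (Ac z n m - hmat blk s v lam \<omega> E (insert_block blk j x y0) n m)
             \<le> (if n = m then (2 * B0 + 1) / r0 * (9 * r) else 0))"
proof -
  define w' where "w' = (\<lambda>i. if blk i = j then w i / r else 0)"
  have w': "\<forall>i. \<bar>w' i\<bar> \<le> 1" using w r by (auto simp: w'_def)
  define b where "b = (\<lambda>n. shift blk \<omega> n (insert_block blk j x y0))"
  have "\<forall>n. extends_along v r0 B0 (b n) w'" using ext w' unfolding line_extension_def by blast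
  then obtain g where g: "\<And>n. g n holomorphic_on ball 0 r0"
    "\<And>n t. \<bar>t\<bar> < r0 \<Longrightarrow> g n (complex_of_real t) = complex_of_real (v (\<lambda>i. b n i + t * w' i))"
    "\<And>n z. z \<in> ball 0 r0 \<Longrightarrow> cmod (g n z) \<le> B0" unfolding extends_along_def by metis
  define Ac where "Ac = (\<lambda>z n m. s (\<lambda>i. n i - m i) / complex_of_real lam
      + (if n = m then g n (of_real r * z) - of_real E else 0))"
  have B0: "B0 \<ge> 0" using line_extension_bound[OF ext r0, of "\<lambda>_. 0"] by linarith
  have ball: "of_real r * z \<in> ball 0 r0" "cmod (of_real r * z) \<le> 9 * r" if "z \<in> ball 0 9" for z :: complex
  proof -
    have "r * cmod z \<le> r * 9" using that r by (intro mult_left_mono) auto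
    hence "cmod (of_real r * z) \<le> 9 * r" using r by (simp add: norm_mult mult.commute)
    thus "of_real r * z \<in> ball 0 r0" "cmod (of_real r * z) \<le> 9 * r" using r by auto
  qed
  have "(\<lambda>z. Ac z n m) holomorphic_on ball 0 9" for n m
  proof -
    have "(g n \<circ> (\<lambda>z. of_real r * z)) holomorphic_on ball 0 9"
      by (rule holomorphic_on_compose_gen[OF _ g(1)]) (use ball in \<open>auto intro!: holomorphic_intros\<close>)
    hence "(\<lambda>z. g n (of_real r * z)) holomorphic_on ball 0 9" by (simp add: o_def)
    thus ?thesis unfolding Ac_def by (cases "n = m") (auto intro!: holomorphic_intros)
  qed
  moreover have eq: "Ac (complex_of_real t) n m
      = hmat blk s v lam \<omega> E (insert_block blk j x (\<lambda>i\<in>{i. blk i = j}. y0 i + t * w i)) n m" if t: "\<bar>t\<bar> < 9" for t n m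
  proof -
    have "\<bar>r * t\<bar> < r0"
    proof -
      have "\<bar>r * t\<bar> \<le> r * 9" using t r unfolding abs_mult by (intro mult_mono) auto
      thus ?thesis using r by linarith
    qed
    hence "g n (complex_of_real (r * t)) = complex_of_real (v (\<lambda>i. b n i + r * t * w' i))" by (rule g(2))
    moreover have "(\<lambda>i. b n i + r * t * w' i) = shift blk \<omega> n (insert_block blk j x (\<lambda>i\<in>{i. blk i = j}. y0 i + t * w i))"
      using r by (auto simp: fun_eq_iff b_def w'_def shift_def insert_block_def)
    ultimately show ?thesis unfolding Ac_def hmat_def by (cases "n = m") simp_all
  qed
  moreover have "cmod (Ac z n m) \<le> 1 + B0 + \<bar>E\<bar>" if z: "z \<in> ball 0 9" for z n m
  proof -
    have "cmod (if n = m then g n (of_real r * z) - of_real E else 0) \<le> B0 + \<bar>E\<bar>"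
      using norm_triangle_ineq4[of "g n (of_real r * z)" "of_real E"] g(3)[OF ball(1)[OF z], of n] B0 by auto
    thus ?thesis unfolding Ac_def
      using norm_triangle_ineq[of "s (\<lambda>i. n i - m i) / complex_of_real lam" "if n = m then g n (of_real r * z) - of_real E else 0"]
        cmod_toeplitz_le[OF lam s_decay rho, of "\<lambda>i. n i - m i"] by linarith
  qed
  moreover have "cmod (Ac z n m - hmat blk s v lam \<omega> E (insert_block blk j x y0) n m)
             \<le> (if n = m then (2 * B0 + 1) / r0 * (9 * r) else 0)" if z: "z \<in> ball 0 9" for z n m
  proof -
    have "g n 0 = complex_of_real (v (b n))" using g(2)[of 0 n] r0 by simp
    hence d: "Ac z n m - hmat blk s v lam \<omega> E (insert_block blk j x y0) n m = (if n = m then g n (of_real r * z) - g n 0 else 0)"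
      by (cases "n = m") (simp_all add: Ac_def hmat_def b_def)
    have "cmod (g n (of_real r * z) - g n 0) \<le> (2 * B0 + 1) / r0 * cmod (of_real r * z)"
      by (rule holomorphic_lipschitz_at_center[OF g(1) r0 g(3) ball(1)[OF z]])
    also have "\<dots> \<le> (2 * B0 + 1) / r0 * (9 * r)"
      using ball(2)[OF z] B0 r0 by (intro mult_left_mono) auto
    finally show ?thesis unfolding d by (cases "n = m") simp_all
  qed
  ultimately show ?thesis by (intro exI[of _ Ac]) blast
qed

section \<open>Large Green's functions\<close>

text \<open>\<open>P\<close> is one quantity that absorbs every polynomial factor. Two factorials,
  each at most K ^ cV, and the Schur entries fit into P ^ cV \<le> exp H; the factors lost when
  passing back to the whole region fit into P^2 \<le> exp (2 H), which raises \<sigma> + 1 to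
  \<sigma> + 3.\<close>

lemma cartan_constants:
  fixes K B \<beta>1 \<beta>3 Mb \<sigma> :: real and cU cV :: nat
  assumes cU: "real cU \<le> K" and cV: "real cV \<le> K" "real cV \<le> Mb" and Mb: "Mb \<ge> 1" and K: "K \<ge> 3"
    and B: "B \<ge> 1" and \<beta>1: "\<beta>1 \<ge> 1" and \<beta>3: "\<beta>3 \<ge> 1"
  defines "P \<equiv> 2 * K ^ 4 * B\<^sup>2 * \<beta>1 * \<beta>3"
  defines "H \<equiv> Mb * ln P"
  shows "H \<ge> 1"
    and "(fact cV)\<^sup>2 * ((B + real cU ^ 2 * (B * \<beta>1 * B)) * \<beta>3) ^ cV \<le> exp H"
    and "\<beta>' = real cV * exp ((\<sigma> + 1) * H) * (1 + real cU * B * \<beta>1) \<Longrightarrow> \<sigma> \<ge> 0 \<Longrightarrow>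
       K * (\<beta>1 * (1 + real cV * B * \<beta>') + \<beta>') \<le> exp ((\<sigma> + 3) * H)"
proof -
  have K4: "K ^ 4 \<ge> 3 ^ 4" using K by (intro power_mono) auto
  have B2: "B\<^sup>2 \<ge> 1" using B by simp
  have "162 * 1 * 1 * 1 \<le> P" unfolding P_def
    using K4 B2 \<beta>1 \<beta>3 by (intro mult_mono) auto
  hence P: "P \<ge> 162" by simp
  have lnP: "ln P \<ge> 1"
  proof -
    have "exp 1 \<le> P" using exp_le P by linarith
    thus ?thesis using P by (subst ln_ge_iff) auto
  qed
  show H1: "H \<ge> 1" unfolding H_def using mult_mono[of 1 Mb 1 "ln P"] Mb lnP by simp
  have PH: "P \<le> exp H"
  proof -
    have "1 * ln P \<le> Mb * ln P" using Mb lnP by (intro mult_right_mono) auto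
    hence "exp (ln P) \<le> exp H" by (simp add: H_def)
    thus ?thesis using P by simp
  qed
  have cU2: "real cU ^ 2 \<le> K\<^sup>2" using cU by (intro power_mono) auto
  have K2: "K\<^sup>2 \<ge> 1" using K by simp
  have ba: "B \<le> K\<^sup>2 * (B * \<beta>1 * B)"
  proof -
    have "1 * (B * 1 * 1) \<le> K\<^sup>2 * (B * \<beta>1 * B)"
      using K2 B \<beta>1 by (intro mult_mono) auto
    thus ?thesis by simp
  qed
  have "(fact cV)\<^sup>2 * ((B + real cU ^ 2 * (B * \<beta>1 * B)) * \<beta>3) ^ cV \<le> (K ^ cV)\<^sup>2 * ((2 * K\<^sup>2 * (B * \<beta>1 * B)) * \<beta>3) ^ cV"
  proof (intro mult_mono power_mono)
    have "(fact cV :: real) \<le> real cV ^ cV" by (metis fact_le_power order_refl of_nat_fact of_nat_power of_nat_le_iff)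
    also have "\<dots> \<le> K ^ cV" using cV by (intro power_mono) auto
    finally show "(fact cV :: real) \<le> K ^ cV" .
    have "real cU ^ 2 * (B * \<beta>1 * B) \<le> K\<^sup>2 * (B * \<beta>1 * B)" using cU2 B \<beta>1 by (intro mult_right_mono) auto
    thus "B + real cU ^ 2 * (B * \<beta>1 * B) \<le> 2 * K\<^sup>2 * (B * \<beta>1 * B)" using ba by simp
  qed (use B \<beta>1 \<beta>3 in auto)
  also have "\<dots> = P ^ cV"
  proof -
    have "(K ^ cV)\<^sup>2 = (K\<^sup>2) ^ cV" by (simp add: power_mult[symmetric] mult.commute)
    moreover have "K\<^sup>2 * ((2 * K\<^sup>2 * (B * \<beta>1 * B)) * \<beta>3) = P"
      unfolding P_def by (simp add: power2_eq_square power4_eq_xxxx)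
    ultimately show ?thesis by (simp only: power_mult_distrib[symmetric])
  qed
  also have "\<dots> = exp (real cV * ln P)" using P by (simp add: exp_of_nat_mult)
  also have "\<dots> \<le> exp H" unfolding H_def using cV lnP by (simp add: mult_right_mono)
  finally show "(fact cV)\<^sup>2 * ((B + real cU ^ 2 * (B * \<beta>1 * B)) * \<beta>3) ^ cV \<le> exp H" .
  assume b': "\<beta>' = real cV * exp ((\<sigma> + 1) * H) * (1 + real cU * B * \<beta>1)" and \<sigma>: "\<sigma> \<ge> 0"
  define e where "e = exp ((\<sigma> + 1) * H)"
  have e1: "e \<ge> 1" unfolding e_def using \<sigma> H1 by simp
  define b where "b = K * e * (2 * K * B * \<beta>1)"
  have KB: "K * B * \<beta>1 \<ge> 1"
  proof -
    have "1 * 1 * 1 \<le> K * B * \<beta>1" using K B \<beta>1 by (intro mult_mono) auto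
    thus ?thesis by simp
  qed
  have "1 + real cU * B * \<beta>1 \<le> 2 * K * B * \<beta>1"
  proof -
    have "real cU * B * \<beta>1 \<le> K * B * \<beta>1" using cU B \<beta>1 by (intro mult_right_mono) auto
    thus ?thesis using KB by simp
  qed
  hence bb: "\<beta>' \<le> b" unfolding b' b_def e_def[symmetric]
    using cV e1 B \<beta>1 K by (intro mult_mono) auto
  have b'0: "\<beta>' \<ge> 0" unfolding b' using B \<beta>1 by simp
  have b1: "b \<ge> 1"
  proof -
    have "1 * 1 * 1 \<le> K * e * (K * B * \<beta>1)" using K e1 KB by (intro mult_mono) auto
    thus ?thesis unfolding b_def by (simp add: mult_ac)
  qed
  have "K * (\<beta>1 * (1 + real cV * B * \<beta>') + \<beta>') \<le> K * (\<beta>1 * (1 + K * B * b) + b)"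
    using cV bb B \<beta>1 K b'0 by (intro mult_left_mono add_mono mult_mono) auto
  also have "\<dots> \<le> K * (3 * K * B * \<beta>1 * b)"
  proof (intro mult_left_mono)
    have "1 * 1 \<le> (K * B) * b" using mult_mono[of 1 K 1 B] K B b1 by (intro mult_mono) auto
    hence "1 + K * B * b \<le> 2 * (K * B * b)" by linarith
    hence "1 + K * B * b \<le> 2 * K * B * b" by (simp only: mult.assoc)
    hence "\<beta>1 * (1 + K * B * b) \<le> \<beta>1 * (2 * K * B * b)" using \<beta>1 by (intro mult_left_mono) auto
    moreover have "1 * b \<le> (K * B * \<beta>1) * b" using KB b1 by (intro mult_right_mono) auto
    ultimately show "\<beta>1 * (1 + K * B * b) + b \<le> 3 * K * B * \<beta>1 * b" by (simp add: mult_ac)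
  qed (use K in auto)
  also have "\<dots> = 6 * (K ^ 4 * B\<^sup>2 * \<beta>1\<^sup>2) * e"
    unfolding b_def by (simp add: power2_eq_square power4_eq_xxxx mult_ac)
  also have "\<dots> \<le> P\<^sup>2 * e"
  proof (intro mult_right_mono)
    have "P\<^sup>2 = 4 * (K ^ 4 * B\<^sup>2 * \<beta>3\<^sup>2) * (K ^ 4 * B\<^sup>2 * \<beta>1\<^sup>2)"
      unfolding P_def by (simp add: power2_eq_square mult_ac)
    moreover have "6 \<le> 4 * (K ^ 4 * B\<^sup>2 * \<beta>3\<^sup>2)"
    proof -
      have "81 * 1 * 1 \<le> K ^ 4 * B\<^sup>2 * \<beta>3\<^sup>2" using K4 B2 \<beta>3 by (intro mult_mono) auto
      thus ?thesis by linarith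
    qed
    ultimately show "6 * (K ^ 4 * B\<^sup>2 * \<beta>1\<^sup>2) \<le> P\<^sup>2"
      by (simp only:) (rule mult_right_mono, auto)
  qed (use e1 in auto)
  also have "\<dots> \<le> (exp H)\<^sup>2 * e" using PH P e1 by (intro mult_right_mono power_mono) auto
  also have "\<dots> = exp ((\<sigma> + 3) * H)"
    unfolding e_def power2_eq_square exp_add[symmetric] by (simp add: algebra_simps)
  finally show "K * (\<beta>1 * (1 + real cV * B * \<beta>') + \<beta>') \<le> exp ((\<sigma> + 3) * H)" .
qed

lemma tmod_in_torus: "tmod x \<in> torus"
  by (simp add: torus_def tmod_def frac_lt_1)

text \<open>Here the scales enter only through the inequalities \<open>n1\<close> to
  \<open>n7\<close>, which separates the analysis from the asymptotics. The radii: \<open>y0\<close>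
  is within r of \<open>x\<close>, so the cube about \<open>x\<close> lies in the cube of radius 2 r
  about \<open>y0\<close>; parameters of modulus below 9 move a point by at most 18 r from
  \<open>y0\<close>, hence 19 r from \<open>x\<close>. This explains the 18 in \<open>n5\<close> and
  the 19 in \<open>n6\<close>.\<close>

lemma green_norm_large_measure:
  fixes blk :: "'i::finite \<Rightarrow> 'd::finite" and N1 N2 \<rho> \<epsilon> r0 B0 Mb \<sigma> E :: real and N :: nat
    and \<Lambda> \<Lambda>b :: "('d \<Rightarrow> int) set"
  defines "r \<equiv> exp (- \<rho> * N1)" and "K \<equiv> (2 * real N + 1) ^ CARD('d)"
  defines "\<beta>0 \<equiv> 2 * ((2 * N1 + 1) ^ CARD('d) * exp (sqrt N1))"
    and "\<beta>3 \<equiv> 2 * ((2 * N2 + 1) ^ CARD('d) * exp (sqrt N2))"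
    and "Lip \<equiv> (2 * B0 + 1) / r0"
  defines "H \<equiv> Mb * ln (2 * K ^ 4 * (1 + B0 + \<bar>E\<bar>)\<^sup>2 * (2 * \<beta>0) * \<beta>3)"
  assumes rho: "\<rho> > 0" and s_decay: "\<And>m. cmod (s m) \<le> exp (- \<rho> * normZ m)"
    and per: "periodic1 v" and ext: "line_extension v r0 B0" and r0: "r0 > 0"
    and lam: "lam > 1" and rb: "\<rho> / 2 \<le> rb" "rb \<le> \<rho>" and N: "N \<ge> 1" and N1: "N1 \<ge> 0" and N2: "N2 \<ge> 0"
    and \<Lambda>: "\<Lambda> \<in> elem (real N)" and \<Lambda>b: "\<Lambda>b \<subseteq> \<Lambda>" and Mb: "real (card \<Lambda>b) \<le> Mb" "Mb \<ge> 1"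
    and cov1: "\<And>k. k \<in> \<Lambda> - \<Lambda>b \<Longrightarrow> \<exists>W\<in>elem N1. k \<in> W \<and> W \<subseteq> \<Lambda> - \<Lambda>b \<and> (\<forall>m\<in>\<Lambda> - \<Lambda>b - W. N1 / 2 \<le> normZ (\<lambda>i. k i - m i))"
    and good1: "\<And>k. k \<in> \<Lambda> - \<Lambda>b \<Longrightarrow> good blk s v lam \<omega> rb N1 E (tmod (shift blk \<omega> k x))"
    and sec2: "\<And>x. mes_le (blockM blk j) (xsection blk X2 j x) \<epsilon>" and \<epsilon>: "\<epsilon> \<ge> 0"
    and good2: "\<And>x. x \<in> torus - X2 \<Longrightarrow> good blk s v lam \<omega> rb N2 E x"
    and n1: "K * (2 * N1 + 1) ^ CARD('d) * exp (sqrt N1 - \<rho> * N1 / 4) \<le> 1/2"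
    and n2: "K * (2 * N2 + 1) ^ CARD('d) * exp (sqrt N2 - \<rho> * N2 / 4) \<le> 1/2"
    and n3: "2 * N2 + 2 \<le> real N"
    and n4: "K * 2 ^ bsize blk j * \<epsilon> < (2 * r) ^ bsize blk j"
    and n5: "18 * r < r0" "8 * r \<le> 1"
    and n6: "\<beta>0 * (Lip * (19 * r)) \<le> 1/2"
    and n7: "\<sigma> > 5" "(\<sigma> + 3) * H < sqrt (real N)"
  shows "mes_le (blockM blk j) {y \<in> {i. blk i = j} \<rightarrow>\<^sub>E UNIV. (\<forall>i. blk i = j \<longrightarrow> \<bar>y i - x i\<bar> \<le> r) \<and>
             gnorm blk s v lam \<omega> E (\<lambda>i. if blk i = j then y i else x i) \<Lambda> \<ge> ereal (exp (sqrt (real N)))}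
          (48 * sqrt (2 powr (5 - \<sigma>)))"
proof -
  define U where "U = \<Lambda> - \<Lambda>b"
  define V where "V = \<Lambda>b"
  define I where "I = {i. blk i = j}"
  define A where "A = (\<lambda>y. hmat blk s v lam \<omega> E (insert_block blk j x y))"
  define B where "B = 1 + B0 + \<bar>E\<bar>"
  have UV: "U \<union> V = \<Lambda>" "U \<inter> V = {}" using \<Lambda>b by (auto simp: U_def V_def)
  have f\<Lambda>: "finite \<Lambda>" by (rule finite_elem[OF \<Lambda>])
  have fin: "finite U" "finite V" using f\<Lambda> \<Lambda>b by (auto simp: U_def V_def intro: finite_subset)
  have c\<Lambda>: "real (card \<Lambda>) \<le> K" unfolding K_def by (rule card_elem[OF \<Lambda>]) simp
  have cU: "real (card U) \<le> K" using card_mono[OF f\<Lambda>, of U] c\<Lambda> by (auto simp: U_def)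
  have cV: "real (card V) \<le> K" using card_mono[OF f\<Lambda>, of V] c\<Lambda> \<Lambda>b by (auto simp: V_def)
  have K3: "K \<ge> 3"
  proof -
    have "3 ^ 1 \<le> (3::real) ^ CARD('d)" by (intro power_increasing) (auto simp: Suc_leI)
    also have "\<dots> \<le> K" unfolding K_def using N by (intro power_mono) auto
    finally show ?thesis by simp
  qed
  have B0: "B0 \<ge> 0" using line_extension_bound[OF ext r0, of "\<lambda>_. 0"] by linarith
  have B: "B \<ge> 1" using B0 by (simp add: B_def)
  have pw: "1 \<le> (2 * a + 1) ^ CARD('d) * exp (sqrt a)" if "a \<ge> 0" for a :: real
  proof -
    have "1 * 1 \<le> (2 * a + 1) ^ CARD('d) * exp (sqrt a)"
      using that by (intro mult_mono one_le_power) auto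
    thus ?thesis by simp
  qed
  have \<beta>0: "\<beta>0 \<ge> 1" and \<beta>3: "\<beta>3 \<ge> 1" unfolding \<beta>0_def \<beta>3_def using pw[OF N1] pw[OF N2] by auto
  have r: "r > 0" "2 * r < 1" using n5 by (auto simp: r_def)
  have Lip: "Lip \<ge> 0" using B0 r0 by (simp add: Lip_def)
  have b0: "bounded_below_on U (hmat blk s v lam \<omega> E x) \<beta>0"
    unfolding \<beta>0_def
  proof (rule bounded_below_on_hmat_cover[OF fin(1) cU N1 rho rb lam per s_decay _ _ n1])
    fix k assume k: "k \<in> U"
    show "\<exists>W\<in>elem N1. k \<in> W \<and> W \<subseteq> U \<and> (\<forall>m\<in>U - W. N1 / 2 \<le> normZ (\<lambda>i. k i - m i))"
      using cov1[OF k[unfolded U_def]] unfolding U_def .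
    show "good blk s v lam \<omega> rb N1 E (tmod (shift blk \<omega> k x))"
      by (rule good1[OF k[unfolded U_def]])
  qed
  have "real (card \<Lambda>) * 2 ^ bsize blk j * \<epsilon> < (2 * r) ^ bsize blk j"
  proof -
    have "real (card \<Lambda>) * 2 ^ bsize blk j * \<epsilon> \<le> K * 2 ^ bsize blk j * \<epsilon>"
      using c\<Lambda> \<epsilon> by (intro mult_right_mono) auto
    thus ?thesis using n4 by simp
  qed
  from exists_point_avoiding[OF f\<Lambda> \<epsilon> r sec2 this, of x \<omega>]
  obtain y0 where y0: "y0 \<in> I \<rightarrow>\<^sub>E UNIV" "\<And>i. blk i = j \<Longrightarrow> \<bar>y0 i - x i\<bar> \<le> r"
    and av: "\<And>k. k \<in> \<Lambda> \<Longrightarrow> tmod (shift blk \<omega> k (insert_block blk j x y0)) \<notin> X2"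
    unfolding I_def by blast
  have b3: "bounded_below_on (U \<union> V) (A y0) \<beta>3"
    unfolding UV(1) A_def \<beta>3_def
  proof (rule bounded_below_on_hmat_cover[OF f\<Lambda> c\<Lambda> N2 rho rb lam per s_decay _ _ n2])
    show "\<exists>W\<in>elem N2. k \<in> W \<and> W \<subseteq> \<Lambda> \<and> (\<forall>m\<in>\<Lambda> - W. N2 / 2 \<le> normZ (\<lambda>i. k i - m i))" if "k \<in> \<Lambda>" for k
      by (rule elem_window[OF \<Lambda> that N2 n3])
    show "good blk s v lam \<omega> rb N2 E (tmod (shift blk \<omega> k (insert_block blk j x y0)))" if "k \<in> \<Lambda>" for k
      using av[OF that] tmod_in_torus by (intro good2) auto
  qed
  have y0x: "cmod (A y0 n m - hmat blk s v lam \<omega> E x n m) \<le> (if n = m then Lip * r else 0)" for n m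
  proof -
    have "\<bar>v (shift blk \<omega> n (insert_block blk j x y0)) - v (shift blk \<omega> n x)\<bar> \<le> Lip * r"
      unfolding Lip_def
    proof (rule line_extension_lipschitz[OF ext r0])
      show "\<bar>shift blk \<omega> n (insert_block blk j x y0) i - shift blk \<omega> n x i\<bar> \<le> r" for i
        using y0(2)[of i] r by (auto simp: shift_def insert_block_def)
    qed (use r n5 in auto)
    thus ?thesis by (cases "n = m") (simp_all add: A_def hmat_def flip: of_real_diff)
  qed
  have ex: "extends_on_line (U \<union> V) U B (2 * \<beta>0) (\<lambda>t. A (\<lambda>i\<in>I. y0 i + t * w i))"
    if w: "w \<in> I \<rightarrow>\<^sub>E UNIV" "\<forall>i\<in>I. \<bar>w i\<bar> \<le> 2 * r" for w
  proof -
    have r2: "0 < 2 * r" "9 * (2 * r) < r0" using r n5 by auto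
    obtain Ac where Ac: "\<And>n m. (\<lambda>z. Ac z n m) holomorphic_on ball 0 9"
      "\<And>n m t. \<bar>t\<bar> < 9 \<Longrightarrow> Ac (complex_of_real t) n m = A (\<lambda>i\<in>I. y0 i + t * w i) n m"
      "\<And>z n m. z \<in> ball 0 9 \<Longrightarrow> cmod (Ac z n m) \<le> B"
      "\<And>z n m. z \<in> ball 0 9 \<Longrightarrow> cmod (Ac z n m - A y0 n m) \<le> (if n = m then Lip * (9 * (2 * r)) else 0)"
      using hmat_line_extension[OF ext r0 r2 lam s_decay rho w(2)[unfolded I_def], of \<omega> E x y0]
      unfolding A_def B_def Lip_def I_def by blast
    have "bounded_below_on U (Ac z) (2 * \<beta>0)" if z: "z \<in> ball 0 9" for z
    proof (rule bounded_below_on_perturb[OF fin(1) b0 _ _ n6])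
      fix n assume n: "n \<in> U"
      have "(\<Sum>m\<in>U. cmod (Ac z n m - hmat blk s v lam \<omega> E x n m)) \<le> (\<Sum>m\<in>U. if n = m then Lip * (19 * r) else 0)"
      proof (rule sum_mono)
        fix m
        have "cmod (Ac z n m - hmat blk s v lam \<omega> E x n m)
            \<le> cmod (Ac z n m - A y0 n m) + cmod (A y0 n m - hmat blk s v lam \<omega> E x n m)"
          using norm_triangle_ineq[of "Ac z n m - A y0 n m" "A y0 n m - hmat blk s v lam \<omega> E x n m"] by simp
        also have "\<dots> \<le> (if n = m then Lip * (9 * (2 * r)) else 0) + (if n = m then Lip * r else 0)"
          by (intro add_mono Ac(4)[OF z] y0x)
        also have "\<dots> = (if n = m then Lip * (19 * r) else 0)" by (simp add: algebra_simps)
        finally show "cmod (Ac z n m - hmat blk s v lam \<omega> E x n m) \<le> (if n = m then Lip * (19 * r) else 0)" .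
      qed
      also have "\<dots> = Lip * (19 * r)" using n fin by simp
      finally show "(\<Sum>m\<in>U. cmod (Ac z n m - hmat blk s v lam \<omega> E x n m)) \<le> Lip * (19 * r)" .
    qed (use \<beta>0 in auto)
    thus ?thesis unfolding extends_on_line_def using Ac(1-3) by (intro exI[of _ Ac]) auto
  qed
  have r2: "2 * r \<ge> 0" using r by simp
  have \<beta>1: "2 * \<beta>0 \<ge> 1" using \<beta>0 by simp
  have Mb': "real (card V) \<le> Mb" using Mb by (simp add: V_def)
  note cc = cartan_constants[OF cU cV Mb' Mb(2) K3 B \<beta>1 \<beta>3, folded B_def]
  have H: "H \<ge> 1" using cc(1) by (simp add: H_def B_def)
  have HH: "(fact (card V))\<^sup>2 * ((B + real (card U) ^ 2 * (B * (2 * \<beta>0) * B)) * \<beta>3) ^ card V \<le> exp H"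
    using cc(2) by (simp add: H_def B_def)
  have ms: "(\<lambda>y. A y n m) \<in> borel_measurable (PiM I (\<lambda>_. lborel))" for n m
    unfolding A_def I_def by (rule hmat_measurable[OF ext r0])
  define \<beta>' where "\<beta>' = card V * exp ((\<sigma> + 1) * H) * (1 + card U * B * (2 * \<beta>0))"
  define \<beta>f where "\<beta>f = 2 * \<beta>0 * (1 + card V * B * \<beta>') + \<beta>'"
  have fI: "finite I" by simp
  have "\<exists>Z\<in>sets (PiM I (\<lambda>_. lborel)).
     {y \<in> I \<rightarrow>\<^sub>E UNIV. (\<forall>i\<in>I. \<bar>y i - y0 i\<bar> \<le> 2 * r) \<and> \<not> bounded_below_on (U \<union> V) (A y) \<beta>f} \<subseteq> Z
     \<and> emeasure (PiM I (\<lambda>_. lborel)) Z \<le> ennreal (48 * sqrt (2 powr (5 - \<sigma>)) * (4 * (2 * r)) ^ card I)"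
    unfolding \<beta>f_def \<beta>'_def
    by (rule cartan_matrix[OF fI fin UV(2) r2 y0(1) ms ex b3 B \<beta>1 \<beta>3 H n7(1) HH])
  then obtain Z where Z: "Z \<in> sets (PiM I (\<lambda>_. lborel))"
     "{y \<in> I \<rightarrow>\<^sub>E UNIV. (\<forall>i\<in>I. \<bar>y i - y0 i\<bar> \<le> 2 * r) \<and> \<not> bounded_below_on (U \<union> V) (A y) \<beta>f} \<subseteq> Z"
     "emeasure (PiM I (\<lambda>_. lborel)) Z \<le> ennreal (48 * sqrt (2 powr (5 - \<sigma>)) * (4 * (2 * r)) ^ card I)" by blast
  have \<beta>'0: "\<beta>' \<ge> 0" unfolding \<beta>'_def using B \<beta>0 by simp
  have \<beta>f0: "\<beta>f \<ge> 0" unfolding \<beta>f_def using B \<beta>0 \<beta>'0 by simp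
  have "K * \<beta>f \<le> exp ((\<sigma> + 3) * H)"
    unfolding \<beta>f_def using cc(3)[of \<beta>' \<sigma>] n7(1) by (simp add: \<beta>'_def H_def B_def)
  hence fin\<beta>: "K * \<beta>f < exp (sqrt (real N))" using n7(2) by (smt (verit) exp_less_cancel_iff)
  have sub: "y \<in> Z" if y: "y \<in> I \<rightarrow>\<^sub>E UNIV" "\<And>i. blk i = j \<Longrightarrow> \<bar>y i - x i\<bar> \<le> r"
    "gnorm blk s v lam \<omega> E (\<lambda>i. if blk i = j then y i else x i) \<Lambda> \<ge> ereal (exp (sqrt (real N)))" for y
  proof -
    have "\<bar>y i - y0 i\<bar> \<le> 2 * r" if "i \<in> I" for i
      using y(2)[of i] y0(2)[of i] that by (auto simp: I_def)
    moreover have "\<not> bounded_below_on (U \<union> V) (A y) \<beta>f"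
    proof
      assume bb: "bounded_below_on (U \<union> V) (A y) \<beta>f"
      hence bb: "bounded_below_on \<Lambda> (A y) \<beta>f" by (simp add: UV)
      have "gnorm blk s v lam \<omega> E (\<lambda>i. if blk i = j then y i else x i) \<Lambda> = ereal (opnorm_on \<Lambda> (inv_on \<Lambda> (A y)))"
        using bounded_below_on_invertible[OF f\<Lambda> bb] unfolding gnorm_def greens_def A_def insert_block_def by simp
      moreover have "opnorm_on \<Lambda> (inv_on \<Lambda> (A y)) \<le> card \<Lambda> * \<beta>f" by (rule opnorm_on_inv_on_le[OF f\<Lambda> bb \<beta>f0])
      moreover have "card \<Lambda> * \<beta>f \<le> K * \<beta>f" using c\<Lambda> \<beta>f0 by (intro mult_right_mono)
      ultimately show False using y(3) fin\<beta> by simp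
    qed
    ultimately show ?thesis using y(1) Z(2) by blast
  qed
  \<comment> \<open>The volume factor from the average over rays is simply bounded by 1; the gain
    from Cartan's estimate is far larger.\<close>
  have "(4 * (2 * r)) ^ card I \<le> 1" using n5 r by (intro power_le_one) auto
  hence "48 * sqrt (2 powr (5 - \<sigma>)) * (4 * (2 * r)) ^ card I \<le> 48 * sqrt (2 powr (5 - \<sigma>)) * 1"
    by (intro mult_left_mono) auto
  hence "emeasure (PiM I (\<lambda>_. lborel)) Z \<le> ennreal (48 * sqrt (2 powr (5 - \<sigma>)))"
    using Z(3) by (auto intro: order_trans ennreal_leI)
  thus ?thesis unfolding mes_le_def blockM_def using Z(1) sub unfolding I_def by (intro bexI[of _ Z]) auto
qed

section \<open>Asymptotics of the scales\<close>

text \<open>The argument \<open>q\<close> stands for N_1. The term D * (ln 3 + q powr (1/4)) bounds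
  the logarithm of the volume of \<Lambda>, as N \<le> exp (q powr (1/4)). The line with q^2 is the
  reason for the exponent 2 / c1 in N_2: the sections have measure exp (- q^2), against a cube of
  volume about exp (- \<rho> q b). The line with \<open>C\<close> compares the logarithm of all
  constants, whose main term is sqrt N_2 = q powr (1 / c1), with N powr (1/100), which grows like
  the exponential of a power of q.\<close>

definition large_scale :: "real \<Rightarrow> real \<Rightarrow> real \<Rightarrow> real \<Rightarrow> real \<Rightarrow> real \<Rightarrow> real \<Rightarrow> real \<Rightarrow> real \<Rightarrow> real \<Rightarrow> bool" where
  "large_scale D b \<rho> c1 c3 r0 Lip C Ns q \<longleftrightarrow>
     Ns \<le> exp (c3 * q powr c1) / 4
   \<and> D * (ln 3 + q powr (1/4)) + D * ln (2 * q + 1) + sqrt q - \<rho> * q / 4 \<le> ln (1/2)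
   \<and> 2 * q powr (2 / c1) + 2 \<le> exp (c3 * q powr c1) / 4
   \<and> D * (ln 3 + q powr (1/4)) + b * ln 2 - q\<^sup>2 < - \<rho> * q * b
   \<and> 18 * exp (- \<rho> * q) < r0 \<and> 8 * exp (- \<rho> * q) \<le> 1
   \<and> ln 2 + D * ln (2 * q + 1) + sqrt q + ln (19 * Lip) - \<rho> * q \<le> ln (1/2)
   \<and> C + 4 * (D * (ln 3 + q powr (1/4))) + (D * ln (2 * q + 1) + sqrt q)
        + (D * ln (2 * q powr (2 / c1) + 1) + q powr (1 / c1)) \<le> q powr (1 / c1 + 1)
   \<and> q powr (1 / c1 + 1) \<le> (exp (c3 * q powr c1) / 4) powr (1/100) \<and> 1 \<le> q"

lemma eventually_large_scale:
  assumes "D > 0" "b > 0" "\<rho> > 0" "c1 > 0" "c1 \<le> 1/4" "c3 > 0" "r0 > 0" "Lip > 0"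
  shows "\<forall>\<^sub>F q in at_top. large_scale D b \<rho> c1 c3 r0 Lip C Ns q"
  unfolding large_scale_def using assms by (intro eventually_conj; real_asymp)

text \<open>The balance of exponents: the size of the Schur complement gives 1/10, the logarithm of
  the constants 1/100, Cartan's parameter 36/100, in total 47/100 < 1/2. On the other side 36/100 >
  1/3, so the measure beats exp (- N^(1/3)). Any value strictly between 1/3 and 39/100 would
  serve.\<close>

definition large_volume :: "real \<Rightarrow> real \<Rightarrow> bool" where
  "large_volume C N \<longleftrightarrow> (N powr (36/100) + 3) * (C * N powr (1/10) * N powr (1/100)) < sqrt N
   \<and> 48 * sqrt (2 powr (5 - N powr (36/100))) \<le> exp (- (N powr (1/3))) \<and> N powr (36/100) > 5 \<and> N \<ge> 1"

lemma eventually_large_volume: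
  assumes "C > 0"
  shows "\<forall>\<^sub>F N in at_top. large_volume C N"
  unfolding large_volume_def using assms by (intro eventually_conj; real_asymp)

lemma mes_le_mono: "mes_le M A r \<Longrightarrow> r \<le> r' \<Longrightarrow> mes_le M A r'"
  unfolding mes_le_def by (meson ennreal_leI order_trans)

lemma card_le_diamZ:
  fixes A :: "('d::finite \<Rightarrow> int) set"
  assumes fin: "finite A"
  shows "diamZ A \<ge> 0" and "real (card A) \<le> (2 * diamZ A + 1) ^ CARD('d)"
proof -
  have d: "normZ (\<lambda>i. n i - m i) \<le> diamZ A" if "n \<in> A" "m \<in> A" for n m
  proof -
    have "{normZ (\<lambda>i. n i - m i) |n m. n \<in> A \<and> m \<in> A} = (\<lambda>(n, m). normZ (\<lambda>i. n i - m i)) ` (A \<times> A)" by auto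
    hence "finite {normZ (\<lambda>i. n i - m i) |n m. n \<in> A \<and> m \<in> A}" using fin by simp
    thus ?thesis unfolding diamZ_def using that by (auto intro!: Max_ge)
  qed
  show d0: "diamZ A \<ge> 0"
  proof (cases "A = {}")
    case False
    then obtain k where "k \<in> A" by blast
    with d[of k k] normZ_nonneg[of "\<lambda>i. k i - k i"] show ?thesis by linarith
  qed (simp add: diamZ_def)
  show "real (card A) \<le> (2 * diamZ A + 1) ^ CARD('d)"
  proof (cases "A = {}")
    case False
    then obtain k where k: "k \<in> A" by blast
    have "A \<subseteq> translateZ k (cubeZ (diamZ A))"
    proof
      fix n assume "n \<in> A"
      thus "n \<in> translateZ k (cubeZ (diamZ A))"
        using d[of n k] k unfolding mem_translateZ cubeZ_def normZ_le_iff by simp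
    qed
    hence "card A \<le> card (translateZ k (cubeZ (diamZ A)))" by (intro card_mono finite_imageI finite_cubeZ)
    also have "\<dots> \<le> card (cubeZ (diamZ A) :: ('d \<Rightarrow> int) set)" by (rule card_image_le[OF finite_cubeZ])
    finally show ?thesis using card_cubeZ[OF d0, where 'd = 'd] by linarith
  qed (use d0 in simp)
qed

lemma bsize_pos: "surj blk \<Longrightarrow> bsize (blk :: 'i::finite \<Rightarrow> 'd) j \<ge> 1"
proof -
  assume "surj blk"
  then obtain i where "blk i = j" by (metis surjD)
  hence "{i. blk i = j} \<noteq> {}" by blast
  thus ?thesis unfolding bsize_def by (simp add: Suc_le_eq card_gt_0_iff)
qed

lemma power_eq_exp_ln: "a > 0 \<Longrightarrow> a ^ n = exp (real n * ln (a::real))"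
  by (simp add: exp_of_nat_mult)

theorem theorem3p5:
  fixes blk :: "'i::finite \<Rightarrow> 'd::finite"
    and s :: "('d \<Rightarrow> int) \<Rightarrow> complex"
    and v :: "('i \<Rightarrow> real) \<Rightarrow> real"
    and \<rho> Emin Emax c3 c4 :: real
  assumes blk_surj: "surj blk"
    and rho_pos: "\<rho> > 0"
    and s_selfadj: "\<And>m. s (\<lambda>i. - m i) = cnj (s m)"
    and s_decay: "\<And>m. cmod (s m) \<le> exp (- \<rho> * normZ m)"
    and v_per: "periodic1 v"
    and v_an: "real_analytic v"
    and c34: "0 < c3" "c3 < c4" "c4 < 1"
  shows "\<exists>N0::real. \<forall>(N1::nat) (lam::real) (rb::real) \<Omega>1 \<Omega>2 X1 X2 \<omega> (E::real) (j::'d)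
            (x::'i \<Rightarrow> real) (N::nat) (\<Lambda>::('d \<Rightarrow> int) set) \<Lambda>b.
    let c1 = c3 / (4 * real (btilde blk)); c2 = c1\<^sup>2 / 2;
        N2 = real N1 powr (2 / c1); N3 = exp (N2 powr c2) in
    real N1 \<ge> N0 \<and> lam > 1 \<and> \<rho> / 2 \<le> rb \<and> rb \<le> 4 * \<rho> / 5 \<and>
    propP blk s v lam c1 rb (real N1) \<Omega>1 X1 \<and> propP blk s v lam c1 rb N2 \<Omega>2 X2 \<and>
    \<omega> \<in> \<Omega>1 \<inter> \<Omega>2 \<and> E \<in> {Emin..Emax} \<and>
    N3 powr c3 / 4 \<le> real N \<and> real N \<le> N3 powr c4 \<and>
    \<Lambda> \<in> elem (real N) \<and> \<Lambda>b \<subseteq> \<Lambda> \<and> diamZ \<Lambda>b \<le> 10 * real N powr (1 / (10 * CARD('d))) \<and>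
    (\<forall>k\<in>\<Lambda> - \<Lambda>b. \<exists>W\<in>elem (real N1). k \<in> W \<and> W \<subseteq> \<Lambda> - \<Lambda>b \<and>
        distZ k ((\<Lambda> - \<Lambda>b) - W) \<ge> ereal (real N1 / 2) \<and>
        tmod (shift blk \<omega> k x) \<notin> X1 \<omega> E)
    \<longrightarrow> mes_le (blockM blk j)
          {y \<in> {i. blk i = j} \<rightarrow>\<^sub>E UNIV.
             (\<forall>i. blk i = j \<longrightarrow> \<bar>y i - x i\<bar> \<le> exp (- \<rho> * real N1)) \<and>
             gnorm blk s v lam \<omega> E (\<lambda>i. if blk i = j then y i else x i) \<Lambda> \<ge> ereal (exp (sqrt (real N)))}
          (exp (- (real N powr (1 / (3 * real (bsize blk j))))))"
proof -
  obtain r0 B0 where r0: "r0 > 0" and ext: "line_extension v r0 B0"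
    using real_analytic_line_extension[OF v_an v_per] by blast
  have B0: "B0 \<ge> 0" using line_extension_bound[OF ext r0, of "\<lambda>_. 0"] by linarith
  define D b where "D = real CARD('d)" and "b = real CARD('i)"
  define c1 where "c1 = c3 / (4 * real (btilde blk))"
  define Lip where "Lip = (2 * B0 + 1) / r0"
  \<comment> \<open>The energy is replaced by its bound over the fixed interval, which makes the
    threshold for N_1 uniform in \<open>E\<close>.\<close>
  define B1 where "B1 = 1 + B0 + max \<bar>Emin\<bar> \<bar>Emax\<bar>"
  define C where "C = ln 2 + 2 * ln B1 + ln 4 + ln 2"
  have B1: "B1 \<ge> 1" using B0 by (simp add: B1_def)
  have bt: "btilde blk \<ge> 1"
    unfolding btilde_def
    by (rule order_trans[OF bsize_pos[OF blk_surj, of undefined] Max_ge]) auto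
  have c1: "c1 > 0" "c1 \<le> 1/4"
  proof -
    show "c1 > 0" unfolding c1_def using bt c34 by simp
    have "c1 \<le> c3 / (4 * 1)" unfolding c1_def using bt c34 by (intro divide_left_mono) auto
    thus "c1 \<le> 1/4" using c34 by simp
  qed
  have D: "D > 0" and b: "b > 0" by (auto simp: D_def b_def)
  have Lip: "Lip > 0" using B0 r0 by (simp add: Lip_def)
  \<comment> \<open>The base 21 comes from the diameter: with a = N^(1/(10 d)) \<ge> 1, a set of
    diameter at most 10 a has at most (20 a + 1)^d \<le> (21 a)^d points.\<close>
  obtain Ns where Ns: "\<And>N. N \<ge> Ns \<Longrightarrow> large_volume (21 ^ CARD('d)) N"
    using eventually_large_volume[of "21 ^ CARD('d)"] unfolding eventually_at_top_linorder by auto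
  obtain q0 where "\<And>q. q \<ge> q0 \<Longrightarrow> large_scale D b \<rho> c1 c3 r0 Lip C Ns q"
    using eventually_large_scale[OF D b rho_pos c1 c34(1) r0 Lip] unfolding eventually_at_top_linorder by blast
  note q0 = this[unfolded large_scale_def]
  show ?thesis
    unfolding Let_def c1_def[symmetric]
  proof (intro exI[of _ q0] allI impI, elim conjE)
    fix N1 N :: nat and lam rb E :: real and \<Omega>1 \<Omega>2 and X1 X2 :: "('i \<Rightarrow> real) \<Rightarrow> real \<Rightarrow> ('i \<Rightarrow> real) set"
      and \<omega> x :: "'i \<Rightarrow> real" and j :: 'd and \<Lambda> \<Lambda>b :: "('d \<Rightarrow> int) set"
    define q where "q = real N1"
    define N2 where "N2 = q powr (2 / c1)"
    assume qq: "q0 \<le> real N1" and lam: "lam > 1" and rb: "\<rho> / 2 \<le> rb" "rb \<le> 4 * \<rho> / 5"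
      and P1: "propP blk s v lam c1 rb (real N1) \<Omega>1 X1"
      and P2: "propP blk s v lam c1 rb (real N1 powr (2 / c1)) \<Omega>2 X2"
      and om: "\<omega> \<in> \<Omega>1 \<inter> \<Omega>2" and E: "E \<in> {Emin..Emax}"
      and Nl: "exp ((real N1 powr (2 / c1)) powr (c1\<^sup>2 / 2)) powr c3 / 4 \<le> real N"
      and Nu: "real N \<le> exp ((real N1 powr (2 / c1)) powr (c1\<^sup>2 / 2)) powr c4"
      and \<Lambda>: "\<Lambda> \<in> elem (real N)" and \<Lambda>b: "\<Lambda>b \<subseteq> \<Lambda>"
      and dm: "diamZ \<Lambda>b \<le> 10 * real N powr (1 / real (10 * CARD('d)))"
      and cov: "\<forall>k\<in>\<Lambda> - \<Lambda>b. \<exists>W\<in>elem (real N1). k \<in> W \<and> W \<subseteq> \<Lambda> - \<Lambda>b \<and>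
        distZ k ((\<Lambda> - \<Lambda>b) - W) \<ge> ereal (real N1 / 2) \<and> tmod (shift blk \<omega> k x) \<notin> X1 \<omega> E"
    have qq': "q \<ge> q0" using qq by (simp add: q_def)
    note Q = q0[OF qq']
    have q1: "q \<ge> 1" using Q by simp
    \<comment> \<open>The choice of c_2 cancels the exponent of N_2, so that N_3 = exp (q powr
      c1).\<close>
    have "(q powr (2 / c1)) powr (c1\<^sup>2 / 2) = q powr c1"
      using c1 by (simp add: powr_powr power2_eq_square)
    hence Nl': "exp (c3 * q powr c1) / 4 \<le> real N" and Nu': "real N \<le> exp (c4 * q powr c1)"
      using Nl Nu by (auto simp: q_def exp_powr_real mult.commute)
    have "real N \<ge> Ns" using Q Nl' by linarith
    note NsN = Ns[OF this, unfolded large_volume_def]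
    have NN: "real N \<ge> 1" using NsN by simp
    have qc: "q powr c1 \<le> q powr (1/4)" using q1 c1 by (intro powr_mono) auto
    have Nq: "real N \<le> exp (q powr (1/4))"
    proof -
      have "c4 * q powr c1 \<le> 1 * q powr c1" using c34 by (intro mult_right_mono) auto
      hence "c4 * q powr c1 \<le> q powr (1/4)" using qc by simp
      thus ?thesis using Nu' by (meson exp_le_cancel_iff order_trans)
    qed
    have N2q: "N2 \<ge> q"
    proof -
      have "q powr 1 \<le> q powr (2 / c1)" using q1 c1 by (intro powr_mono) (auto simp: field_simps)
      thus ?thesis using q1 by (simp add: N2_def)
    qed
    have N20: "N2 \<ge> 0" using N2q q1 by linarith
    have sqN2: "sqrt N2 = q powr (1 / c1)"
      unfolding N2_def powr_half_sqrt[symmetric, OF powr_ge_zero] powr_powr by simp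
    define K where "K = (2 * real N + 1) ^ CARD('d)"
    have Kb: "K \<le> exp (D * (ln 3 + a powr (1/4)))" if a: "a \<ge> q" for a
    proof -
      have "real N \<le> exp (a powr (1/4))"
        using Nq a q1 powr_mono2[of "1/4" q a] by (meson exp_le_cancel_iff order_trans divide_nonneg_nonneg zero_le_one zero_le_numeral)
      moreover have "1 \<le> exp (a powr (1/4))" by simp
      moreover have "exp (ln 3 + a powr (1/4)) = 3 * exp (a powr (1/4))" by (simp add: exp_add)
      ultimately have "2 * real N + 1 \<le> exp (ln 3 + a powr (1/4))" by linarith
      hence "K \<le> exp (ln 3 + a powr (1/4)) ^ CARD('d)" unfolding K_def by (intro power_mono) auto
      thus ?thesis by (simp add: D_def exp_of_nat_mult)
    qed
    have K0: "K > 0" unfolding K_def by simp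
    have pe: "(2 * a + 1) ^ CARD('d) = exp (D * ln (2 * a + 1))" if "a \<ge> 0" for a
      using that unfolding D_def by (intro power_eq_exp_ln) auto
    \<comment> \<open>The scale conditions hold at every argument beyond \<open>q0\<close>, so one
      proof covers both a = q and a = N_2.\<close>
    have nn: "K * (2 * a + 1) ^ CARD('d) * exp (sqrt a - \<rho> * a / 4) \<le> 1/2" if a: "a \<ge> q" for a
    proof -
      have a0: "a \<ge> 0" using a q1 by linarith
      have "K * (2 * a + 1) ^ CARD('d) * exp (sqrt a - \<rho> * a / 4)
         \<le> exp (D * (ln 3 + a powr (1/4))) * exp (D * ln (2 * a + 1)) * exp (sqrt a - \<rho> * a / 4)"
        unfolding pe[OF a0] using Kb[OF a] by (intro mult_right_mono) auto
      also have "\<dots> = exp (D * (ln 3 + a powr (1/4)) + D * ln (2 * a + 1) + sqrt a - \<rho> * a / 4)"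
        unfolding exp_add[symmetric] by (simp add: algebra_simps)
      also have "\<dots> \<le> exp (ln (1/2))" unfolding exp_le_cancel_iff using q0[of a] a qq' by auto
      finally show ?thesis by simp
    qed
    define r where "r = exp (- \<rho> * q)"
    define \<epsilon> where "\<epsilon> = exp (- (N2 powr c1))"
    \<comment> \<open>The exponent 2 / c1 in N_2 turns the sub-exponential bound of property P into
      a Gaussian one in q.\<close>
    have \<epsilon>q: "\<epsilon> = exp (- q\<^sup>2)"
      unfolding \<epsilon>_def N2_def powr_powr using c1 q1 by simp
    have bj: "1 \<le> bsize blk j" by (rule bsize_pos[OF blk_surj])
    have bjb: "bsize blk j \<le> CARD('i)" unfolding bsize_def by (rule card_mono) auto
    have n4: "K * 2 ^ bsize blk j * \<epsilon> < (2 * r) ^ bsize blk j"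
    proof -
      have "(2::real) ^ bsize blk j \<le> 2 ^ CARD('i)" using bjb by (intro power_increasing) auto
      also have "\<dots> = exp (b * ln 2)" unfolding b_def by (rule power_eq_exp_ln) simp
      finally have "K * 2 ^ bsize blk j * \<epsilon> \<le> exp (D * (ln 3 + q powr (1/4))) * exp (b * ln 2) * exp (- q\<^sup>2)"
        unfolding \<epsilon>q using Kb[of q] K0 by (intro mult_right_mono mult_mono) auto
      also have "\<dots> = exp (D * (ln 3 + q powr (1/4)) + b * ln 2 - q\<^sup>2)"
        unfolding exp_add[symmetric] by (simp add: algebra_simps)
      also have "\<dots> < exp (- \<rho> * q * b)" unfolding exp_less_cancel_iff using Q by simp
      also have "\<dots> = r ^ CARD('i)" unfolding r_def b_def by (simp add: exp_of_nat_mult[symmetric] mult_ac)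
      also have "\<dots> \<le> r ^ bsize blk j" using bjb q1 rho_pos by (intro power_decreasing) (auto simp: r_def)
      also have "\<dots> \<le> (2 * r) ^ bsize blk j" by (intro power_mono) (auto simp: r_def)
      finally show ?thesis .
    qed
    define \<beta>0 where "\<beta>0 = 2 * ((2 * q + 1) ^ CARD('d) * exp (sqrt q))"
    define \<beta>3 where "\<beta>3 = 2 * ((2 * N2 + 1) ^ CARD('d) * exp (sqrt N2))"
    have q0': "q \<ge> 0" using q1 by simp
    have n6: "\<beta>0 * (Lip * (19 * r)) \<le> 1/2"
    proof -
      have "\<beta>0 * (Lip * (19 * r)) = exp (ln 2) * exp (D * ln (2 * q + 1)) * exp (sqrt q) * exp (ln (19 * Lip)) * exp (- \<rho> * q)"
        unfolding \<beta>0_def pe[OF q0'] r_def using Lip by simp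
      also have "\<dots> = exp (ln 2 + D * ln (2 * q + 1) + sqrt q + ln (19 * Lip) - \<rho> * q)"
        unfolding exp_add[symmetric] by simp
      also have "\<dots> \<le> exp (ln (1/2))" unfolding exp_le_cancel_iff using Q by simp
      finally show ?thesis by simp
    qed
    define \<sigma> where "\<sigma> = real N powr (36/100)"
    define Mb where "Mb = 21 ^ CARD('d) * real N powr (1/10)"
    have Mb1: "Mb \<ge> 1"
    proof -
      have "1 * 1 \<le> Mb" unfolding Mb_def using NN by (intro mult_mono one_le_power ge_one_powr_ge_zero) auto
      thus ?thesis by simp
    qed
    have Mbc: "real (card \<Lambda>b) \<le> Mb"
    proof -
      have f: "finite \<Lambda>b" using finite_elem[OF \<Lambda>] \<Lambda>b finite_subset by blast
      define a where "a = real N powr (1 / real (10 * CARD('d)))"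
      have a1: "a \<ge> 1" unfolding a_def using NN by (intro ge_one_powr_ge_zero) auto
      have "real (card \<Lambda>b) \<le> (2 * diamZ \<Lambda>b + 1) ^ CARD('d)" by (rule card_le_diamZ(2)[OF f])
      also have "\<dots> \<le> (21 * a) ^ CARD('d)"
        using dm a1 card_le_diamZ(1)[OF f] unfolding a_def[symmetric] by (intro power_mono) auto
      also have "\<dots> = 21 ^ CARD('d) * a ^ CARD('d)" by (rule power_mult_distrib)
      also have "a ^ CARD('d) = real N powr (1/10)"
        unfolding a_def using NN by (simp add: powr_power)
      finally show ?thesis by (simp add: Mb_def)
    qed
    define P where "P = 2 * K ^ 4 * (1 + B0 + \<bar>E\<bar>)\<^sup>2 * (2 * \<beta>0) * \<beta>3"
    have \<beta>p: "\<beta>0 > 0" "\<beta>3 > 0" unfolding \<beta>0_def \<beta>3_def using q1 N20 by auto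
    have Bp: "1 + B0 + \<bar>E\<bar> > 0" using B0 by linarith
    have lnP: "ln P \<le> real N powr (1/100)"
    proof -
      have l1: "ln P = ln 2 + 4 * ln K + 2 * ln (1 + B0 + \<bar>E\<bar>) + ln (2 * \<beta>0) + ln \<beta>3"
      proof -
        have *: "ln (2 * k ^ 4 * a\<^sup>2 * u * w) = ln 2 + 4 * ln k + 2 * ln a + ln u + ln w"
          if "k > 0" "a > 0" "u > 0" "w > 0" for k a u w :: real
          using that by (simp add: ln_mult ln_realpow)
        show ?thesis unfolding P_def by (rule *) (use K0 \<beta>p Bp in auto)
      qed
      have l2: "ln (2 * \<beta>0) = ln 4 + (D * ln (2 * q + 1) + sqrt q)"
      proof -
        have "2 * \<beta>0 = 4 * (exp (D * ln (2 * q + 1)) * exp (sqrt q))" unfolding \<beta>0_def pe[OF q0'] by simp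
        thus ?thesis by (simp add: ln_mult)
      qed
      have l3: "ln \<beta>3 = ln 2 + (D * ln (2 * N2 + 1) + q powr (1 / c1))"
        unfolding \<beta>3_def pe[OF N20] sqN2 by (simp add: ln_mult)
      have "ln K \<le> ln (exp (D * (ln 3 + q powr (1/4))))" using Kb[of q] K0 by (subst ln_le_cancel_iff) auto
      hence l4: "ln K \<le> D * (ln 3 + q powr (1/4))" by simp
      have l5: "ln (1 + B0 + \<bar>E\<bar>) \<le> ln B1"
      proof -
        have "1 + B0 + \<bar>E\<bar> \<le> B1" using E unfolding B1_def by auto
        thus ?thesis using Bp by simp
      qed
      have "ln P \<le> C + 4 * (D * (ln 3 + q powr (1/4))) + (D * ln (2 * q + 1) + sqrt q)
        + (D * ln (2 * N2 + 1) + q powr (1 / c1))"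
        unfolding C_def using l1 l2 l3 l4 l5 by linarith
      also have "\<dots> \<le> q powr (1 / c1 + 1)" unfolding N2_def using Q by simp
      also have "\<dots> \<le> (exp (c3 * q powr c1) / 4) powr (1/100)" using Q by simp
      also have "\<dots> \<le> real N powr (1/100)" using Nl' by (intro powr_mono2) auto
      finally show ?thesis .
    qed
    have n7: "\<sigma> > 5" "(\<sigma> + 3) * (Mb * ln P) < sqrt (real N)"
    proof -
      show "\<sigma> > 5" using NsN by (simp add: \<sigma>_def)
      have "(\<sigma> + 3) * (Mb * ln P) \<le> (\<sigma> + 3) * (Mb * real N powr (1/100))"
        using lnP Mb1 \<open>\<sigma> > 5\<close> by (intro mult_left_mono) auto
      also have "\<dots> < sqrt (real N)" using NsN by (simp add: \<sigma>_def Mb_def)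
      finally show "(\<sigma> + 3) * (Mb * ln P) < sqrt (real N)" .
    qed
    have om1: "\<omega> \<in> \<Omega>1" and om2: "\<omega> \<in> \<Omega>2" using om by auto
    have good1: "good blk s v lam \<omega> rb q E (tmod (shift blk \<omega> k x))" if "k \<in> \<Lambda> - \<Lambda>b" for k
    proof -
      have "tmod (shift blk \<omega> k x) \<in> torus - X1 \<omega> E" using cov that tmod_in_torus by blast
      thus ?thesis using P1 om1 unfolding propP_def q_def by blast
    qed
    have cov1: "\<exists>W\<in>elem q. k \<in> W \<and> W \<subseteq> \<Lambda> - \<Lambda>b \<and> (\<forall>m\<in>\<Lambda> - \<Lambda>b - W. q / 2 \<le> normZ (\<lambda>i. k i - m i))"
      if k: "k \<in> \<Lambda> - \<Lambda>b" for k
    proof -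
      obtain W where W: "W \<in> elem q" "k \<in> W" "W \<subseteq> \<Lambda> - \<Lambda>b" "distZ k ((\<Lambda> - \<Lambda>b) - W) \<ge> ereal (q / 2)"
        using cov k unfolding q_def by blast
      have "q / 2 \<le> normZ (\<lambda>i. k i - m i)" if "m \<in> \<Lambda> - \<Lambda>b - W" for m
      proof -
        have "distZ k ((\<Lambda> - \<Lambda>b) - W) \<le> ereal (normZ (\<lambda>i. k i - m i))"
          unfolding distZ_def using that by (rule INF_lower)
        hence "ereal (q / 2) \<le> ereal (normZ (\<lambda>i. k i - m i))" using W(4) by (rule order_trans[rotated])
        thus ?thesis by simp
      qed
      thus ?thesis using W by (intro bexI[of _ W]) auto
    qed
    have good2: "good blk s v lam \<omega> rb N2 E x'" if "x' \<in> torus - X2 \<omega> E" for x'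
      using P2 om2 that unfolding propP_def N2_def q_def by blast
    have sec2: "mes_le (blockM blk j) (xsection blk (X2 \<omega> E) j x') \<epsilon>" for x'
      using P2 om2 unfolding propP_def N2_def q_def \<epsilon>_def by blast
    have n5: "18 * r < r0" "8 * r \<le> 1" using Q by (auto simp: r_def)
    have n3: "2 * N2 + 2 \<le> real N" using Q Nl' unfolding N2_def by linarith
    have \<epsilon>0: "\<epsilon> \<ge> 0" by (simp add: \<epsilon>_def)
    have rb': "rb \<le> \<rho>" using rb rho_pos by simp
    have N1': "N \<ge> 1" using NN by simp
    have "mes_le (blockM blk j) {y \<in> {i. blk i = j} \<rightarrow>\<^sub>E UNIV. (\<forall>i. blk i = j \<longrightarrow> \<bar>y i - x i\<bar> \<le> exp (- \<rho> * q)) \<and>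
             gnorm blk s v lam \<omega> E (\<lambda>i. if blk i = j then y i else x i) \<Lambda> \<ge> ereal (exp (sqrt (real N)))}
          (48 * sqrt (2 powr (5 - \<sigma>)))"
      by (rule green_norm_large_measure[OF rho_pos s_decay v_per ext r0 lam rb(1) rb' N1' q0' N20 \<Lambda> \<Lambda>b Mbc Mb1
          cov1 good1 sec2 \<epsilon>0 good2 nn[OF order_refl, unfolded K_def] nn[OF N2q, unfolded K_def] n3
          n4[unfolded K_def r_def] n5[unfolded r_def] n6[unfolded \<beta>0_def Lip_def r_def]
          n7(1) n7(2)[unfolded P_def K_def \<beta>0_def \<beta>3_def]])
    \<comment> \<open>The bound exp (- N^(1/3)) is relaxed to the stated exponent, using that the
      block has at least one coordinate and N \<ge> 1.\<close>
    moreover have "48 * sqrt (2 powr (5 - \<sigma>)) \<le> exp (- (real N powr (1 / (3 * real (bsize blk j)))))"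
    proof -
      have "real N powr (1 / (3 * real (bsize blk j))) \<le> real N powr (1/3)"
        using NN bj by (intro powr_mono) (auto simp: field_simps)
      hence "exp (- (real N powr (1/3))) \<le> exp (- (real N powr (1 / (3 * real (bsize blk j)))))" by simp
      thus ?thesis using NsN unfolding \<sigma>_def by linarith
    qed
    ultimately show "mes_le (blockM blk j)
          {y \<in> {i. blk i = j} \<rightarrow>\<^sub>E UNIV.
             (\<forall>i. blk i = j \<longrightarrow> \<bar>y i - x i\<bar> \<le> exp (- \<rho> * real N1)) \<and>
             gnorm blk s v lam \<omega> E (\<lambda>i. if blk i = j then y i else x i) \<Lambda> \<ge> ereal (exp (sqrt (real N)))}
          (exp (- (real N powr (1 / (3 * real (bsize blk j))))))"
      unfolding q_def by (rule mes_le_mono)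
  qed
qed

end
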